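(* Let $q>p-1$ and $g\in L^1(\Omega)$ with $g\ge0$, $g\not\equiv0$. Let $w$ be the unique nonnegative entropy solution of $(-\Delta)^s_{p,\beta}w=g$ in $\Omega$, $w=0$ in $\mathbb R^N\setminus\Omega$, and assume $w^q\le g$ a.e. in $\Omega$. Then there exists $\bar\lambda>0$ such that for every $0<\lambda<\bar\lambda$ the problem $(-\Delta)^s_{p,\beta}u=\lambda u^q+g$ in $\Omega$, $u\ge0$ in $\Omega$, $u=0$ in $\mathbb R^N\setminus\Omega$, has a minimal positive entropy solution (a measurable $u\ge0$ with $u^q\in L^1(\Omega)$ that is an entropy solution with datum $\lambda u^q+g$, and lies below every other such solution).
   Context: Standing assumptions: $s\in(0,1)$, $1<p<N$, $ps<N$, $0\le\beta<\frac{N-ps}{2}$, and $\Omega\subset\mathbb R^N$ is a smooth bounded domain containing the origin. Set $d\mu=|x|^{-2\beta}dx$ and $d\nu=\frac{dx\,dy}{|x-y|^{N+ps}|x|^\beta|y|^\beta}$. $D_\Omega=(\mathbb R^N\times\mathbb R^N)\setminus\big((\mathbb R^N\setminus\Omega)\times(\mathbb R^N\setminus\Omega)\big)$. $W^{s,p}_{\beta,0}(\Omega)$ is the closure of $C_c^\infty(\Omega)$ under the norm $(\int_\Omega|\phi|^pd\mu)^{1/p}+(\int_\Omega\int_\Omega|\phi(x)-\phi(y)|^pd\nu)^{1/p}$; its elements are extended by $0$ outside $\Omega$. For $k>0$, $T_k(a)=\max\{-k,\min\{k,a\}\}$. Entropy solution: given $f\in L^1(\Omega)$, a measurable $u$ vanishing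 outside $\Omega$ with $T_k(u)\in W^{s,p}_{\beta,0}(\Omega)$ for all $k>0$ is an entropy solution of $(-\Delta)^s_{p,\beta}u=f$ if (i) $\iint_{R_h}|u(x)-u(y)|^{p-1}d\nu\to0$ as $h\to\infty$, where $R_h=\{(x,y)\in\mathbb R^N\times\mathbb R^N:\ h+1\le\max\{|u(x)|,|u(y)|\}$ and ($\min\{|u(x)|,|u(y)|\}\le h$ or $u(x)u(y)<0$)$\}$; and (ii) for all $k>0$ and all $\varphi\in W^{s,p}_{\beta,0}(\Omega)\cap L^\infty(\Omega)$, $\frac12\iint_{D_\Omega}|u(x)-u(y)|^{p-2}(u(x)-u(y))[T_k(u(x)-\varphi(x))-T_k(u(y)-\varphi(y))]d\nu\le\int_\Omega f\,T_k(u-\varphi)\,dx$. (Existence and uniqueness of the nonnegative entropy solution $w$ for nonnegative $L^1$ data is known.) *)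

theory Defs
  imports "HOL-Analysis.Analysis"
begin

coinductive cinfty :: "('a::euclidean_space \<Rightarrow> real) \<Rightarrow> bool" where
  "continuous_on UNIV f \<Longrightarrow>
   (\<forall>i\<in>Basis. \<exists>g. (\<forall>x. ((\<lambda>t. f (x + t *\<^sub>R i)) has_real_derivative g x) (at 0)) \<and> cinfty g)
   \<Longrightarrow> cinfty f"

definition smooth_bounded_domain :: "'a::euclidean_space set \<Rightarrow> bool" where
  "smooth_bounded_domain \<Omega> \<longleftrightarrow> bounded \<Omega> \<and> connected \<Omega> \<and> \<Omega> \<noteq> {} \<and>
     (\<exists>\<rho>. cinfty \<rho> \<and> \<Omega> = {x. \<rho> x < 0} \<and>
        (\<forall>x. \<rho> x = 0 \<longrightarrow> (\<exists>D. (\<rho> has_derivative D) (at x) \<and> D \<noteq> (\<lambda>_. 0))))"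

definition test_fun :: "'a::euclidean_space set \<Rightarrow> ('a \<Rightarrow> real) \<Rightarrow> bool" where
  "test_fun \<Omega> \<phi> \<longleftrightarrow> cinfty \<phi> \<and> compact (closure {x. \<phi> x \<noteq> 0}) \<and> closure {x. \<phi> x \<noteq> 0} \<subseteq> \<Omega>"

definition mu_meas :: "real \<Rightarrow> 'a::euclidean_space measure" where
  "mu_meas \<beta> = density lebesgue (\<lambda>x. ennreal (norm x powr (-2 * \<beta>)))"

definition nu_meas :: "real \<Rightarrow> real \<Rightarrow> real \<Rightarrow> ('a::euclidean_space \<times> 'a) measure" where
  "nu_meas s p \<beta> = density (lebesgue \<Otimes>\<^sub>M lebesgue)
     (\<lambda>(x,y). ennreal (1 / (dist x y powr (real DIM('a) + p * s) * norm x powr \<beta> * norm y powr \<beta>)))"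

text \<open>W^{s,p}_{beta,0}(Omega): limits (in the norm of the space) of C_c^infinity(Omega) functions,
  extended by 0 outside Omega. Norm convergence to 0 is written as convergence to 0 of both
  p-th powers of the two summands of the norm.\<close>
definition W_space :: "real \<Rightarrow> real \<Rightarrow> real \<Rightarrow> 'a::euclidean_space set \<Rightarrow> ('a \<Rightarrow> real) \<Rightarrow> bool" where
  "W_space s p \<beta> \<Omega> u \<longleftrightarrow> u \<in> borel_measurable lebesgue \<and> (\<forall>x. x \<notin> \<Omega> \<longrightarrow> u x = 0) \<and>
     (\<exists>\<phi>::nat \<Rightarrow> 'a \<Rightarrow> real. (\<forall>n. test_fun \<Omega> (\<phi> n)) \<and>
        (\<lambda>n. \<integral>\<^sup>+ x. indicator \<Omega> x * ennreal (\<bar>u x - \<phi> n x\<bar> powr p) \<partial>mu_meas \<beta>) \<longlonglongrightarrow> 0 \<and>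
        (\<lambda>n. \<integral>\<^sup>+ z. indicator (\<Omega> \<times> \<Omega>) z *
              ennreal (\<bar>(u (fst z) - \<phi> n (fst z)) - (u (snd z) - \<phi> n (snd z))\<bar> powr p) \<partial>nu_meas s p \<beta>)
          \<longlonglongrightarrow> 0)"

definition trunc :: "real \<Rightarrow> real \<Rightarrow> real" where
  "trunc k a = max (-k) (min k a)"

definition R_set :: "('a \<Rightarrow> real) \<Rightarrow> real \<Rightarrow> ('a \<times> 'a) set" where
  "R_set u h = {(x,y). h + 1 \<le> max \<bar>u x\<bar> \<bar>u y\<bar> \<and>
                       (min \<bar>u x\<bar> \<bar>u y\<bar> \<le> h \<or> u x * u y < 0)}"

definition D_set :: "'a set \<Rightarrow> ('a \<times> 'a) set" where
  "D_set \<Omega> = UNIV - ((UNIV - \<Omega>) \<times> (UNIV - \<Omega>))"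

definition entropy_solution ::
  "real \<Rightarrow> real \<Rightarrow> real \<Rightarrow> 'a::euclidean_space set \<Rightarrow> ('a \<Rightarrow> real) \<Rightarrow> ('a \<Rightarrow> real) \<Rightarrow> bool" where
  "entropy_solution s p \<beta> \<Omega> f u \<longleftrightarrow>
     u \<in> borel_measurable lebesgue \<and> (\<forall>x. x \<notin> \<Omega> \<longrightarrow> u x = 0) \<and>
     (\<forall>k>0. W_space s p \<beta> \<Omega> (\<lambda>x. trunc k (u x))) \<and>
     ((\<lambda>h. \<integral>\<^sup>+ z. indicator (R_set u h) z *
             ennreal (\<bar>u (fst z) - u (snd z)\<bar> powr (p - 1)) \<partial>nu_meas s p \<beta>) \<longlongrightarrow> 0) at_top \<and>
     (\<forall>k>0. \<forall>\<phi>. W_space s p \<beta> \<Omega> \<phi> \<and> (\<exists>C. AE x in lebesgue. x \<in> \<Omega> \<longrightarrow> \<bar>\<phi> x\<bar> \<le> C) \<longrightarrow>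
        (let F = (\<lambda>z. \<bar>u (fst z) - u (snd z)\<bar> powr (p - 2) * (u (fst z) - u (snd z)) *
                   (trunc k (u (fst z) - \<phi> (fst z)) - trunc k (u (snd z) - \<phi> (snd z))))
         in set_integrable (nu_meas s p \<beta>) (D_set \<Omega>) F \<and>
            (1/2) * (\<integral>z\<in>D_set \<Omega>. F z \<partial>nu_meas s p \<beta>)
              \<le> (\<integral>x\<in>\<Omega>. f x * trunc k (u x - \<phi> x) \<partial>lebesgue)))"

definition pos_sol :: "real \<Rightarrow> real \<Rightarrow> real \<Rightarrow> 'a::euclidean_space set \<Rightarrow> real \<Rightarrow> real \<Rightarrow>
    ('a \<Rightarrow> real) \<Rightarrow> ('a \<Rightarrow> real) \<Rightarrow> bool" where
  "pos_sol s p \<beta> \<Omega> q lam g u \<longleftrightarrow>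
     u \<in> borel_measurable lebesgue \<and> (AE x in lebesgue. 0 \<le> u x) \<and>
     set_integrable lebesgue \<Omega> (\<lambda>x. u x powr q) \<and>
     entropy_solution s p \<beta> \<Omega> (\<lambda>x. lam * u x powr q + g x) u"

end

theory Submission
  imports Defs
begin

text \<open>
  Since \<open>w powr q \<le> g\<close>, the function \<open>2 * w\<close> is a supersolution as soon as
  \<open>lam \<le> (2 powr (p - 1) - 1) / 2 powr q\<close>. The minimal solution is the monotone limit of
  \<open>Z 0 = 0\<close>, \<open>Z (n + 1)\<close> = minimiser of the convex functional with datum \<open>lam * Z n powr q + g\<close> among
  functions bounded by \<open>n + 1\<close>. The bound makes the \<open>L\<^sup>1\<close> datum harmless, and the minimiser satisfies
  the entropy inequality for all test functions below the bound. Comparison with an arbitrary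
  entropy supersolution \<open>v\<close> (test \<open>v\<close> with \<open>max (Z n) (trunc h v)\<close> and let \<open>h\<close> tend to infinity)
  keeps all iterates below \<open>2 * w\<close> and below every other solution. Truncations of the iterates have
  bounded energy, so Fatou's lemma passes the entropy inequality to the limit; the vanishing of the
  tails then follows from the test function \<open>trunc h u\<close>.
\<close>

section \<open>Powers, fluxes and truncations\<close>

text \<open>Two features of the definition shape the proof. First, the norm of \<open>W\<close> sees
  only pairs in \<Omega> \<times> \<Omega>, whereas the entropy inequality integrates over all pairs
  that meet \<Omega>. An element of \<open>W\<close> may a priori have infinite energy across the
  boundary, so the variational arguments take place in the subspace \<open>X\<close> of functions of
  finite energy over the whole space, and the passage from \<open>X\<close> back to \<open>W\<close>
  needs its own argument. It works because integrability of the entropy integrand is part of the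
  definition: the given solution \<open>w\<close> thereby supplies integrable majorants on the pairs
  that cross the boundary. Second, the entropy integrand has no sign, so Fatou's lemma needs lower
  bounds that are integrable up to an error of small integral. Young's inequality with a free weight
  provides them, because the energies involved are bounded, though not known to converge. Uniform
  convexity does the work of compactness: it turns minimising sequences into Cauchy sequences, and
  the exterior of \<Omega> supplies a Poincare inequality.\<close>

definition flux :: "real \<Rightarrow> real \<Rightarrow> real" where
  "flux p t = \<bar>t\<bar> powr (p - 2) * t"

lemma flux_pos: "0 \<le> t \<Longrightarrow> flux p t = t powr (p - 1)"
proof (cases "t = 0")
  case False
  moreover assume "0 \<le> t"
  ultimately show ?thesis
    using powr_mult_base[of t "p - 2"] by (simp add: flux_def mult.commute)
qed (simp add: flux_def)

lemma flux_minus [simp]: "flux p (- t) = - flux p t"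
  by (simp add: flux_def)

lemma flux_zero [simp]: "flux p 0 = 0"
  by (simp add: flux_def)

lemma abs_flux: "\<bar>flux p t\<bar> = \<bar>t\<bar> powr (p - 1)"
proof (cases "0 \<le> t")
  case True then show ?thesis by (simp add: flux_pos)
next
  case False
  then have "flux p t = - ((- t) powr (p - 1))" using flux_pos[of "- t" p] by simp
  then show ?thesis using False by simp
qed

lemma abs_powr_eq_mult: "\<bar>t::real\<bar> powr p = \<bar>t\<bar> powr (p - 1) * \<bar>t\<bar>"
proof (cases "t = 0")
  case False
  then show ?thesis using powr_mult_base[of "\<bar>t\<bar>" "p - 1"] by (simp add: mult.commute)
qed simp

lemma flux_mult_self: "flux p t * t = \<bar>t\<bar> powr p"
proof (cases "0 \<le> t")
  case True then show ?thesis using abs_powr_eq_mult[of t p] by (simp add: flux_pos)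
next
  case False
  then have "flux p t = - (\<bar>t\<bar> powr (p - 1))" using flux_pos[of "- t" p] by simp
  then show ?thesis using False abs_powr_eq_mult[of t p] by simp
qed

lemma flux_mono_strict:
  assumes "1 < p" "a < b" shows "flux p a < flux p b"
proof -
  have *: "flux p a < flux p b" if "0 \<le> a" "a < b" for a b
    using that assms(1) by (simp add: flux_pos powr_less_mono2)
  consider "0 \<le> a" | "b \<le> 0" | "a < 0" "0 < b" by linarith
  then show ?thesis
  proof cases
    case 1 then show ?thesis using * assms by blast
  next
    case 2
    then have "flux p (- b) < flux p (- a)" using *[of "- b" "- a"] assms by simp
    then show ?thesis by simp
  next
    case 3
    have "flux p 0 < flux p b" "flux p 0 < flux p (- a)" using *[of 0 b] *[of 0 "- a"] 3 by auto
    then show ?thesis by simp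
  qed
qed

lemma flux_mono: "1 < p \<Longrightarrow> a \<le> b \<Longrightarrow> flux p a \<le> flux p b"
  using flux_mono_strict[of p a b] by (cases "a = b") auto

lemma flux_diff_mult_nonneg:
  assumes "1 < p" "(a \<le> b \<longrightarrow> c \<le> 0)" "(b \<le> a \<longrightarrow> 0 \<le> c)"
  shows "0 \<le> (flux p a - flux p b) * c"
proof (cases "a \<le> b")
  case True
  then show ?thesis using assms flux_mono[of p a b] by (simp add: mult_nonpos_nonpos)
next
  case False
  then show ?thesis using assms flux_mono[of p b a] by simp
qed

lemma tendsto_flux:
  assumes "1 < p" "(f \<longlongrightarrow> a) F" shows "((\<lambda>x. flux p (f x)) \<longlongrightarrow> flux p a) F"
proof -
  \<comment> \<open>For \<open>p < 2\<close> the factor \<open>\<bar>t\<bar> powr (p - 2)\<close> is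
    unbounded near 0; continuity is read off from a formula with the positive exponent
    \<open>p - 1\<close>.\<close>
  have eq: "flux p t = (max t 0) powr (p - 1) - (max (- t) 0) powr (p - 1)" for t
  proof (cases "0 \<le> t")
    case True then show ?thesis by (simp add: flux_pos max_def)
  next
    case False
    then show ?thesis using flux_pos[of "- t" p] by (simp add: max_def)
  qed
  show ?thesis unfolding eq
    by (intro tendsto_intros tendsto_powr' tendsto_max assms) (use assms(1) in auto)
qed

lemma tendsto_abs_powr:
  fixes p :: real
  assumes "0 < p" "(f \<longlongrightarrow> a) F" shows "((\<lambda>x. \<bar>f x\<bar> powr p) \<longlongrightarrow> \<bar>a\<bar> powr p) F"
  by (intro tendsto_powr' tendsto_rabs assms tendsto_const) (use assms(1) in auto)

lemma borel_measurable_flux [measurable]: "flux p \<in> borel_measurable borel"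
  unfolding flux_def by measurable

section \<open>Differentiability and convexity of the p-th power\<close>

lemma has_real_derivative_abs_powr:
  assumes "1 < p"
  shows "((\<lambda>t::real. \<bar>t\<bar> powr p) has_real_derivative p * flux p t) (at t)"
proof -
  consider "0 < t" | "t < 0" | "t = 0" by linarith
  then show ?thesis
  proof cases
    case 1
    have "((\<lambda>t::real. t powr p) has_real_derivative p * flux p t) (at t)"
      using 1 has_real_derivative_powr[of t p] by (simp add: flux_pos)
    then show ?thesis
      by (rule has_field_derivative_transform_within_open[where S="{0<..}"]) (use 1 in auto)
  next
    case 2
    have "flux p t = - ((- t) powr (p - 1))" using 2 flux_pos[of "- t" p] by simp
    then have "((\<lambda>t::real. (- t) powr p) has_real_derivative p * flux p t) (at t)"
      using 2 by (auto intro!: derivative_eq_intros)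
    then show ?thesis
      by (rule has_field_derivative_transform_within_open[where S="{..<0}"]) (use 2 in auto)
  next
    case 3
    \<comment> \<open>At 0 the difference quotient is \<open>flux p h\<close> itself, so continuity
      of the flux gives the derivative.\<close>
    have "((\<lambda>h. \<bar>h\<bar> powr p / h) \<longlongrightarrow> 0) (at 0)"
    proof -
      have "((\<lambda>h. flux p h) \<longlongrightarrow> flux p 0) (at 0)" by (intro tendsto_flux assms tendsto_ident_at)
      moreover have "\<bar>h\<bar> powr p / h = flux p h" if "h \<noteq> 0" for h
        using flux_mult_self[of p h] that by (metis nonzero_eq_divide_eq)
      ultimately show ?thesis using LIM_equal[of 0 "\<lambda>h. \<bar>h\<bar> powr p / h" "flux p" 0] by simp
    qed
    then show ?thesis using 3 by (simp add: DERIV_def)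
  qed
qed

lemma abs_powr_tangent_strict:
  assumes "1 < p" "a \<noteq> b"
  shows "\<bar>a\<bar> powr p + p * flux p a * (b - a) < \<bar>b\<bar> powr p"
proof (cases "a < b")
  case True
  obtain c where c: "a < c" "c < b" "\<bar>b\<bar> powr p - \<bar>a\<bar> powr p = (b - a) * (p * flux p c)"
    using MVT2[OF True, of "\<lambda>t. \<bar>t\<bar> powr p" "\<lambda>t. p * flux p t"] has_real_derivative_abs_powr[OF assms(1)]
    by blast
  have "(b - a) * (p * flux p a) < (b - a) * (p * flux p c)"
    using flux_mono_strict[OF assms(1) c(1)] True assms(1) by simp
  then show ?thesis using c(3) by (simp add: algebra_simps)
next
  case False
  then have "b < a" using assms by simp
  obtain c where c: "b < c" "c < a" "\<bar>a\<bar> powr p - \<bar>b\<bar> powr p = (a - b) * (p * flux p c)"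
    using MVT2[OF \<open>b < a\<close>, of "\<lambda>t. \<bar>t\<bar> powr p" "\<lambda>t. p * flux p t"] has_real_derivative_abs_powr[OF assms(1)]
    by blast
  have "(a - b) * (p * flux p c) < (a - b) * (p * flux p a)"
    using flux_mono_strict[OF assms(1) c(2)] \<open>b < a\<close> assms(1) by simp
  then show ?thesis using c(3) by (simp add: algebra_simps)
qed

lemma abs_powr_tangent:
  "1 < p \<Longrightarrow> \<bar>a\<bar> powr p + p * flux p a * (b - a) \<le> \<bar>b\<bar> powr p"
  using abs_powr_tangent_strict[of p a b] by (cases "a = b") auto

lemma abs_powr_midpoint_strict:
  fixes a b p :: real
  assumes "1 < p" "a \<noteq> b"
  shows "\<bar>(a + b) / 2\<bar> powr p < (\<bar>a\<bar> powr p + \<bar>b\<bar> powr p) / 2"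
proof -
  let ?m = "(a + b) / 2"
  have "?m \<noteq> a" "?m \<noteq> b" using assms by auto
  from abs_powr_tangent_strict[OF assms(1) this(1)] abs_powr_tangent_strict[OF assms(1) this(2)]
  have "2 * \<bar>?m\<bar> powr p + (p * flux p ?m) * ((a - ?m) + (b - ?m)) < \<bar>a\<bar> powr p + \<bar>b\<bar> powr p"
    by (simp only: distrib_left)
  also have "(a - ?m) + (b - ?m) = 0" by (simp add: field_simps)
  finally show ?thesis by simp
qed

lemma abs_powr_midpoint:
  fixes a b p :: real
  assumes "1 < p"
  shows "\<bar>(a + b) / 2\<bar> powr p \<le> (\<bar>a\<bar> powr p + \<bar>b\<bar> powr p) / 2"
  using abs_powr_midpoint_strict[OF assms, of a b] by (cases "a = b") auto

lemma abs_powr_mono: "\<bar>a\<bar> \<le> \<bar>b\<bar> \<Longrightarrow> 0 \<le> p \<Longrightarrow> \<bar>a::real\<bar> powr p \<le> \<bar>b\<bar> powr p"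
  by (simp add: powr_mono2)

lemma abs_powr_add_le:
  fixes a b p :: real
  assumes "0 < p"
  shows "\<bar>a + b\<bar> powr p \<le> 2 powr p * (\<bar>a\<bar> powr p + \<bar>b\<bar> powr p)"
proof -
  define m where "m = max \<bar>a\<bar> \<bar>b\<bar>"
  have "\<bar>a + b\<bar> powr p \<le> (2 * m) powr p"
    using assms by (intro powr_mono2) (auto simp: m_def)
  also have "\<dots> = 2 powr p * m powr p" by (simp add: powr_mult m_def)
  also have "m powr p \<le> \<bar>a\<bar> powr p + \<bar>b\<bar> powr p" by (simp add: m_def max_def)
  finally show ?thesis by simp
qed

lemma abs_powr_diff_le:
  fixes a b p :: real
  assumes "0 < p"
  shows "\<bar>a - b\<bar> powr p \<le> 2 powr p * (\<bar>a\<bar> powr p + \<bar>b\<bar> powr p)"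
  using abs_powr_add_le[OF assms, of a "- b"] by simp

text \<open>Either \<open>y \<le> e * x\<close>, and the first term suffices, or
  \<open>x \<le> y / e\<close>, and the second one does. The constants are not sharp; what matters
  is that \<open>e\<close> can make either of the two coefficients as small as desired.\<close>

lemma powr_young:
  fixes x y p e :: real
  assumes "1 < p" "0 < e" "0 \<le> x" "0 \<le> y"
  shows "x powr (p - 1) * y \<le> e * x powr p + e powr (1 - p) * y powr p"
proof (cases "y \<le> e * x")
  case True
  have "x powr (p - 1) * y \<le> x powr (p - 1) * (e * x)" using True by (intro mult_left_mono) auto
  also have "\<dots> = e * x powr p" using abs_powr_eq_mult[of x p] assms by simp
  finally show ?thesis using assms by (smt (verit) mult_nonneg_nonneg powr_ge_zero)
next
  case False
  then have x: "x \<le> y / e" using assms by (simp add: field_simps)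
  have "x powr (p - 1) * y \<le> (y / e) powr (p - 1) * y"
    using x assms by (intro mult_right_mono powr_mono2) auto
  also have "\<dots> = e powr (1 - p) * (y powr (p - 1) * y)"
    using assms by (simp add: powr_divide powr_diff field_simps)
  also have "\<dots> = e powr (1 - p) * y powr p" using abs_powr_eq_mult[of y p] assms by simp
  finally show ?thesis using assms by (smt (verit) mult_nonneg_nonneg powr_ge_zero)
qed

lemma abs_flux_mult_le:
  assumes "1 < p" shows "\<bar>flux p a * b\<bar> \<le> \<bar>a\<bar> powr p + \<bar>b\<bar> powr p"
  using powr_young[OF assms, of 1 "\<bar>a\<bar>" "\<bar>b\<bar>"] by (simp add: abs_mult abs_flux)

text \<open>Uniform convexity of the p-th power: by homogeneity it suffices to bound the convexity
  defect from below on the compact set of normalised pairs that are at distance at least \<open>\<epsilon>\<close>,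
  where strict convexity makes it positive.\<close>

lemma abs_powr_uniformly_convex:
  fixes p e :: real
  assumes "1 < p" "0 < e"
  obtains C where "0 < C" "\<And>a b::real. \<bar>a - b\<bar> powr p \<le>
    C * ((\<bar>a\<bar> powr p + \<bar>b\<bar> powr p) / 2 - \<bar>(a + b) / 2\<bar> powr p) + e * (\<bar>a\<bar> powr p + \<bar>b\<bar> powr p)"
proof -
  define D where "D = (\<lambda>z::real \<times> real. (\<bar>fst z\<bar> powr p + \<bar>snd z\<bar> powr p) / 2 - \<bar>(fst z + snd z) / 2\<bar> powr p)"
  define n where "n = (\<lambda>z::real \<times> real. \<bar>fst z\<bar> powr p + \<bar>snd z\<bar> powr p)"
  define S where "S = {z. n z = 1 \<and> e \<le> \<bar>fst z - snd z\<bar> powr p}"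
  have p0: "0 < p" using assms by simp
  have cn: "continuous_on UNIV n" unfolding n_def
    by (intro continuous_intros continuous_on_powr') (use p0 in auto)
  have cd: "continuous_on UNIV (\<lambda>z::real\<times>real. \<bar>fst z - snd z\<bar> powr p)"
    by (intro continuous_intros continuous_on_powr') (use p0 in auto)
  have cD: "continuous_on S D" unfolding D_def
    by (intro continuous_intros continuous_on_powr') (use p0 in auto)
  have "closed S"
  proof -
    have "S = (n -` {1}) \<inter> ((\<lambda>z. \<bar>fst z - snd z\<bar> powr p) -` {e..})" by (auto simp: S_def)
    then show ?thesis
      using closed_Int[OF closed_vimage[OF closed_singleton cn] closed_vimage[OF closed_atLeast cd]] by simp
  qed
  moreover have "bounded S"
  proof -
    have "z \<in> cball 0 1 \<times> cball 0 1" if "z \<in> S" for z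
    proof -
      have "\<bar>t\<bar> \<le> 1" if "\<bar>t\<bar> powr p \<le> 1" for t :: real
        using that p0 powr_less_mono2[of p 1 "\<bar>t\<bar>"] by fastforce
      moreover have "\<bar>fst z\<bar> powr p \<le> 1" "\<bar>snd z\<bar> powr p \<le> 1"
        using \<open>z \<in> S\<close> powr_ge_zero[of "\<bar>fst z\<bar>" p] powr_ge_zero[of "\<bar>snd z\<bar>" p]
        unfolding S_def n_def mem_Collect_eq by linarith+
      ultimately show ?thesis by (cases z) (simp add: dist_real_def)
    qed
    then show ?thesis using bounded_subset[OF bounded_Times[OF bounded_cball bounded_cball], of S] by blast
  qed
  ultimately have cS: "compact S" by (simp add: compact_eq_bounded_closed)
  have pos: "0 < D z" if "z \<in> S" for z
  proof -
    have "fst z \<noteq> snd z" using that assms(2) by (auto simp: S_def)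
    then show ?thesis using abs_powr_midpoint_strict[OF assms(1)] by (simp add: D_def)
  qed
  obtain d where d: "0 < d" "\<And>z. z \<in> S \<Longrightarrow> d \<le> D z"
  proof (cases "S = {}")
    case True then show ?thesis using that[of 1] by auto
  next
    case False
    then obtain z0 where "z0 \<in> S" "\<And>z. z \<in> S \<Longrightarrow> D z0 \<le> D z"
      using continuous_attains_inf[OF cS False cD] by auto
    then show ?thesis using that[of "D z0"] pos by auto
  qed
  \<comment> \<open>On \<open>S\<close> the left side is at most \<open>2 powr p\<close> and the
    defect at least \<open>d\<close>, so this constant is large enough there. For the remaining
    normalised pairs the term \<open>e\<close> alone absorbs the left side.\<close>
  define C where "C = 2 * 2 powr p / d"
  have D0: "0 \<le> D z" for z using abs_powr_midpoint[OF assms(1), of "fst z" "snd z"] by (simp add: D_def)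
  have C0: "0 < C" using d by (simp add: C_def)
  have unit: "\<bar>a - b\<bar> powr p \<le> C * D (a, b) + e" if "n (a, b) = 1" for a b
  proof (cases "(a, b) \<in> S")
    case True
    have "\<bar>a - b\<bar> powr p \<le> 2 powr p" using abs_powr_diff_le[OF p0, of a b] that by (simp add: n_def)
    also have "\<dots> \<le> C * d" using d by (simp add: C_def)
    also have "\<dots> \<le> C * D (a, b)" using C0 d(2)[OF True] by simp
    finally show ?thesis using assms by simp
  next
    case False
    then have "\<bar>a - b\<bar> powr p \<le> e" using that by (simp add: S_def)
    then show ?thesis using C0 D0[of "(a,b)"] by (smt (verit) mult_nonneg_nonneg)
  qed
  have "\<bar>a - b\<bar> powr p \<le> C * D (a, b) + e * n (a, b)" for a b
  proof (cases "n (a, b) = 0")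
    case True
    then have "a = 0 \<and> b = 0" unfolding n_def
      by (smt (verit) fst_conv snd_conv powr_ge_zero powr_eq_0_iff abs_eq_0)
    then show ?thesis by (simp add: D_def n_def)
  next
    case False
    define r where "r = n (a, b) powr (1 / p)"
    have "0 \<le> n (a, b)" by (simp add: n_def)
    then have n0: "0 < n (a,b)" using False by simp
    then have r: "0 < r" "r powr p = n (a, b)" using p0 by (auto simp: r_def powr_powr)
    have sc: "\<bar>t / r\<bar> powr p = \<bar>t\<bar> powr p / n (a, b)" for t
      using r by (simp add: powr_divide)
    have "n (a / r, b / r) = 1" using n0 sc by (simp add: n_def) (simp add: add_divide_distrib[symmetric] n_def)
    from unit[OF this] have "\<bar>(a - b) / r\<bar> powr p \<le> C * D (a / r, b / r) + e"
      by (simp add: diff_divide_distrib)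
    moreover have "D (a / r, b / r) = D (a, b) / n (a, b)"
    proof -
      have "(a / r + b / r) / 2 = ((a + b) / 2) / r" by (simp add: add_divide_distrib)
      then have "D (a / r, b / r)
          = (\<bar>a\<bar> powr p / n (a, b) + \<bar>b\<bar> powr p / n (a, b)) / 2 - \<bar>(a + b) / 2\<bar> powr p / n (a, b)"
        by (simp only: D_def fst_conv snd_conv sc)
      then show ?thesis by (simp add: D_def diff_divide_distrib add_divide_distrib mult.commute)
    qed
    ultimately have "\<bar>a - b\<bar> powr p / n (a, b) \<le> C * (D (a, b) / n (a, b)) + e" using sc by simp
    then show ?thesis using n0 by (simp add: field_simps)
  qed
  then show ?thesis using that[OF C0] by (simp add: D_def n_def)
qed

section \<open>Truncations and pointwise bounds for the entropy integrand\<close>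

lemma trunc_mono: "a \<le> b \<Longrightarrow> trunc k a \<le> trunc k b"
  by (auto simp: trunc_def)

lemma trunc_lipschitz: "\<bar>trunc k a - trunc k b\<bar> \<le> \<bar>a - b\<bar>"
  by (auto simp: trunc_def max_def min_def)

lemma abs_trunc_le: "0 \<le> k \<Longrightarrow> \<bar>trunc k a\<bar> \<le> k"
  by (auto simp: trunc_def)

lemma trunc_zero [simp]: "0 \<le> k \<Longrightarrow> trunc k 0 = 0"
  by (auto simp: trunc_def)

lemma trunc_id: "\<bar>a\<bar> \<le> k \<Longrightarrow> trunc k a = a"
  by (auto simp: trunc_def)

lemma abs_trunc_diff_le: "0 \<le> k \<Longrightarrow> \<bar>trunc k b\<bar> \<le> \<bar>trunc k a\<bar> + \<bar>trunc k (a - b)\<bar>"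
  by (auto simp: trunc_def max_def min_def)

lemma abs_mult_trunc_le: "0 \<le> k \<Longrightarrow> \<bar>a\<bar> \<le> b \<Longrightarrow> \<bar>a * trunc k c\<bar> \<le> k * b"
  using mult_mono[of "\<bar>a\<bar>" b "\<bar>trunc k c\<bar>" k] abs_trunc_le[of k c] by (simp add: abs_mult mult.commute)

lemma borel_measurable_trunc [measurable]: "trunc k \<in> borel_measurable borel"
  unfolding trunc_def by measurable

lemma tendsto_trunc: "(f \<longlongrightarrow> a) F \<Longrightarrow> ((\<lambda>x. trunc k (f x)) \<longlongrightarrow> trunc k a) F"
  unfolding trunc_def by (intro tendsto_intros)

text \<open>Truncation is monotone and 1-Lipschitz, so inserting the smaller increment of the
  truncations into the flux can only decrease the product. With test function 0 the right side is
  the entropy integrand, which therefore controls the energy of truncations.\<close>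

lemma flux_trunc_lower:
  assumes "1 < p" "0 \<le> k"
  shows "\<bar>trunc k a - trunc k b\<bar> powr p \<le> flux p (a - b) * (trunc k a - trunc k b)"
proof -
  have *: "\<bar>trunc k a - trunc k b\<bar> powr p \<le> flux p (a - b) * (trunc k a - trunc k b)" if "b \<le> a" for a b
  proof -
    have 0: "0 \<le> trunc k a - trunc k b" "trunc k a - trunc k b \<le> a - b"
      using trunc_mono[OF that, of k] trunc_lipschitz[of k a b] that by auto
    have "\<bar>trunc k a - trunc k b\<bar> powr p = flux p (trunc k a - trunc k b) * (trunc k a - trunc k b)"
      by (simp add: flux_mult_self)
    also have "\<dots> \<le> flux p (a - b) * (trunc k a - trunc k b)"
      using 0 assms by (intro mult_right_mono flux_mono) auto
    finally show ?thesis .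
  qed
  show ?thesis
  proof (cases "b \<le> a")
    case False
    then have "\<bar>trunc k b - trunc k a\<bar> powr p \<le> flux p (b - a) * (trunc k b - trunc k a)"
      using * by simp
    moreover have "flux p (b - a) = - flux p (a - b)" using flux_minus[of p "a - b"] by simp
    ultimately show ?thesis by (simp add: abs_minus_commute algebra_simps)
  qed (use * in simp)
qed

lemma flux_mult_nonneg:
  assumes "1 < p" "(a \<le> 0 \<longrightarrow> c \<le> 0)" "(0 \<le> a \<longrightarrow> 0 \<le> c)"
  shows "0 \<le> flux p a * c"
  using flux_diff_mult_nonneg[OF assms(1), of a 0 c] assms by simp

text \<open>The negative part of the entropy integrand only sees truncations, because it vanishes
  unless the larger value of \<open>u\<close> is below \<open>k + sup \<bar>\<phi>\<bar>\<close>.\<close>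

lemma flux_entropy_lower:
  assumes p: "1 < p" and k: "0 \<le> k" and ab: "0 \<le> a" "0 \<le> b" and cd: "\<bar>c\<bar> \<le> C" "\<bar>d\<bar> \<le> C"
  shows "- (\<bar>trunc (k + C) a - trunc (k + C) b\<bar> powr (p - 1) * \<bar>c - d\<bar>)
           \<le> flux p (a - b) * (trunc k (a - c) - trunc k (b - d))"
proof -
  have *: "- (\<bar>trunc (k + C) a - trunc (k + C) b\<bar> powr (p - 1) * \<bar>c - d\<bar>)
           \<le> flux p (a - b) * (trunc k (a - c) - trunc k (b - d))"
    if h: "b \<le> a" "0 \<le> b" "\<bar>c\<bar> \<le> C" "\<bar>d\<bar> \<le> C" for a b c d
  proof (cases "trunc k (b - d) \<le> trunc k (a - c)")
    case True
    have "0 \<le> flux p (a - b) * (trunc k (a - c) - trunc k (b - d))"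
      using True h p by (intro mult_nonneg_nonneg) (auto simp: flux_pos)
    moreover have "0 \<le> \<bar>trunc (k + C) a - trunc (k + C) b\<bar> powr (p - 1) * \<bar>c - d\<bar>" by simp
    ultimately show ?thesis by linarith
  next
    case False
    \<comment> \<open>A reversed order of the truncations forces \<open>trunc k (a - c) < k\<close>,
      hence \<open>a < k + C\<close>. Then \<open>a\<close> and the smaller \<open>b\<close> are
      both left unchanged by truncation at \<open>k + C\<close>.\<close>
    then have "a - c < k" "- \<bar>c - d\<bar> \<le> trunc k (a - c) - trunc k (b - d)"
      using h k by (auto simp: trunc_def max_def min_def split: if_splits)
    then have le: "trunc (k + C) a = a" "trunc (k + C) b = b"
      using h by (auto intro!: trunc_id)
    have "(a - b) powr (p - 1) * (- \<bar>c - d\<bar>) \<le> (a - b) powr (p - 1) * (trunc k (a - c) - trunc k (b - d))"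
      using \<open>- \<bar>c - d\<bar> \<le> _\<close> by (intro mult_left_mono) auto
    then show ?thesis using le h by (simp add: flux_pos)
  qed
  show ?thesis
  proof (cases "b \<le> a")
    case False
    have "flux p (b - a) = - flux p (a - b)" using flux_minus[of p "a - b"] by simp
    then show ?thesis using *[of a b d c] False assms by (simp add: abs_minus_commute algebra_simps)
  qed (use * assms in simp)
qed

section \<open>Integration\<close>

lemma sigma_finite_completion:
  assumes "sigma_finite_measure M" shows "sigma_finite_measure (completion M)"
proof -
  obtain A where A: "countable A" "A \<subseteq> sets M" "\<Union>A = space M" "\<forall>a\<in>A. emeasure M a \<noteq> \<infinity>"
    using sigma_finite_measure.sigma_finite_countable[OF assms] by blast
  show ?thesis
    by (rule sigma_finite_measure.intro, rule exI[of _ A]) (use A in \<open>auto simp: emeasure_completion\<close>)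
qed

lemma sigma_finite_lebesgue: "sigma_finite_measure (lebesgue :: 'a::euclidean_space measure)"
  by (rule sigma_finite_completion) (rule sigma_finite_lborel)

lemma pair_sigma_finite_lebesgue:
  "pair_sigma_finite (lebesgue :: 'a::euclidean_space measure) (lebesgue :: 'b::euclidean_space measure)"
  by (simp add: pair_sigma_finite_def sigma_finite_lebesgue)

text \<open>A null set times the whole space is null in either order. This carries every a.e.
  statement about points over to pairs.\<close>

lemma AE_fst_snd_lebesgue:
  fixes P :: "'a::euclidean_space \<Rightarrow> bool"
  assumes "AE x in lebesgue. P x"
  shows "AE z in (lebesgue :: 'a measure) \<Otimes>\<^sub>M (lebesgue :: 'a measure). P (fst z) \<and> P (snd z)"
proof -
  interpret pair_sigma_finite "lebesgue :: 'a measure" "lebesgue :: 'a measure"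
    by (rule pair_sigma_finite_lebesgue)
  obtain N where N: "N \<in> sets lebesgue" "emeasure lebesgue N = 0" "{x. \<not> P x} \<subseteq> N"
    using assms by (auto elim!: AE_E)
  have 1: "N \<times> UNIV \<in> null_sets (lebesgue \<Otimes>\<^sub>M (lebesgue :: 'a measure))"
    using N by (auto simp: null_sets_def sigma_finite_measure.emeasure_pair_measure_Times[OF sigma_finite_lebesgue])
  have 2: "UNIV \<times> N \<in> null_sets ((lebesgue :: 'a measure) \<Otimes>\<^sub>M (lebesgue :: 'a measure))"
    using N by (auto simp: null_sets_def sigma_finite_measure.emeasure_pair_measure_Times[OF sigma_finite_lebesgue])
  show ?thesis
    using AE_not_in[OF 1] AE_not_in[OF 2] by eventually_elim (use N(3) in auto)
qed

text \<open>Along a subsequence with integrals at most \<open>(1/2) ^ n\<close> the sum of the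
  functions has finite integral, so it is finite a.e. and its terms tend to 0.\<close>

lemma nn_integral_tendsto_0_AE_subseq:
  fixes f :: "nat \<Rightarrow> 'b \<Rightarrow> ennreal"
  assumes [measurable]: "\<And>n. f n \<in> borel_measurable M"
    and lim: "(\<lambda>n. \<integral>\<^sup>+ x. f n x \<partial>M) \<longlonglongrightarrow> 0"
  obtains r where "strict_mono r" "AE x in M. (\<lambda>n. f (r n) x) \<longlonglongrightarrow> 0"
proof -
  have ev: "\<forall>\<^sub>F k in sequentially. (\<integral>\<^sup>+ x. f k x \<partial>M) \<le> ennreal ((1/2) ^ n)" for n :: nat
  proof -
    have "\<forall>\<^sub>F k in sequentially. (\<integral>\<^sup>+ x. f k x \<partial>M) < ennreal ((1/2) ^ n)"
      using lim by (rule order_tendstoD) auto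
    then show ?thesis by (rule eventually_mono) auto
  qed
  obtain r where "\<And>n. (\<integral>\<^sup>+ x. f (r n) x \<partial>M) \<le> ennreal ((1/2) ^ n)" "\<And>n. r n < r (Suc n)"
  proof (rule dependent_nat_choice[where P="\<lambda>n k. (\<integral>\<^sup>+ x. f k x \<partial>M) \<le> ennreal ((1/2) ^ n)" and Q="\<lambda>_ m n. m < n", THEN exE], goal_cases)
    case 1
    show ?case using ev[of 0] eventually_happens'[OF sequentially_bot] by blast
  next
    case (2 x n)
    have "\<forall>\<^sub>F k in sequentially. (\<integral>\<^sup>+ x. f k x \<partial>M) \<le> ennreal ((1/2) ^ Suc n) \<and> x < k"
      using ev[of "Suc n"] eventually_gt_at_top[of x] by (rule eventually_conj)
    then show ?case using eventually_happens'[OF sequentially_bot] by blast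
  qed blast
  then have r: "strict_mono r" "\<And>n::nat. (\<integral>\<^sup>+ x. f (r n) x \<partial>M) \<le> ennreal ((1/2) ^ n)"
    by (auto simp: strict_mono_Suc_iff)
  have "(\<integral>\<^sup>+ x. (\<Sum>n. f (r n) x) \<partial>M) = (\<Sum>n. \<integral>\<^sup>+ x. f (r n) x \<partial>M)"
    by (rule nn_integral_suminf) simp
  also have "\<dots> \<le> (\<Sum>n. ennreal ((1/2) ^ n))" by (intro suminf_le r(2)) auto
  also have "\<dots> = ennreal (\<Sum>n. (1/2) ^ n)" by (rule suminf_ennreal2) (auto simp: summable_geometric)
  also have "\<dots> < \<infinity>" by simp
  finally have "AE x in M. (\<Sum>n. f (r n) x) \<noteq> \<infinity>" by (intro nn_integral_noteq_infinite) auto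
  then have "AE x in M. (\<lambda>n. f (r n) x) \<longlonglongrightarrow> 0"
  proof eventually_elim
    case (elim x)
    define a where "a n = enn2real (f (r n) x)" for n
    have fin: "f (r n) x = ennreal (a n)" for n
    proof -
      have "f (r n) x \<le> (\<Sum>n. f (r n) x)"
        using sum_le_suminf[OF summableI, of "{n}" "\<lambda>n. f (r n) x"] by simp
      then have "f (r n) x < top" using elim by (simp add: top.not_eq_extremum le_less_trans)
      then show ?thesis by (simp add: a_def)
    qed
    have "summable a"
      using elim unfolding fin by (intro summable_suminf_not_top) (auto simp: a_def)
    then have "a \<longlonglongrightarrow> 0" by (rule summable_LIMSEQ_zero)
    then show ?case unfolding fin using tendsto_ennrealI by fastforce
  qed
  then show ?thesis using r(1) that by blast
qed

lemma integrable_mult_bounded: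
  fixes F v :: "'b \<Rightarrow> real"
  assumes "integrable N F" "v \<in> borel_measurable N" "AE x in N. \<bar>v x\<bar> \<le> M"
  shows "integrable N (\<lambda>x. F x * v x)"
proof (rule Bochner_Integration.integrable_bound)
  show "integrable N (\<lambda>x. M * F x)" using assms by simp
  show "AE x in N. norm (F x * v x) \<le> norm (M * F x)"
    using assms(3)
  proof eventually_elim
    case (elim x)
    then have "\<bar>v x\<bar> * \<bar>F x\<bar> \<le> \<bar>M\<bar> * \<bar>F x\<bar>" by (intro mult_right_mono) auto
    then show ?case by (simp add: abs_mult mult.commute)
  qed
  show "(\<lambda>x. F x * v x) \<in> borel_measurable N" using assms borel_measurable_integrable[OF assms(1)] by measurable
qed

section \<open>Integrals of p-th powers, Cauchy sequences and Fatou's lemma\<close>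

lemma nn_integral_abs_powr_add:
  fixes f g :: "'b \<Rightarrow> real" and p :: real
  assumes "0 < p" and [measurable]: "f \<in> borel_measurable M" "g \<in> borel_measurable M"
  shows "(\<integral>\<^sup>+x. ennreal (\<bar>f x + g x\<bar> powr p) \<partial>M)
     \<le> ennreal (2 powr p) * ((\<integral>\<^sup>+x. ennreal (\<bar>f x\<bar> powr p) \<partial>M) + (\<integral>\<^sup>+x. ennreal (\<bar>g x\<bar> powr p) \<partial>M))"
proof -
  have "(\<integral>\<^sup>+x. ennreal (\<bar>f x + g x\<bar> powr p) \<partial>M) \<le> (\<integral>\<^sup>+x. ennreal (2 powr p) * (ennreal (\<bar>f x\<bar> powr p) + ennreal (\<bar>g x\<bar> powr p)) \<partial>M)"
    by (intro nn_integral_mono) (use abs_powr_add_le[OF assms(1)] in \<open>simp add: ennreal_mult[symmetric] ennreal_plus[symmetric] ennreal_leI del: ennreal_plus\<close>)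
  also have "\<dots> = ennreal (2 powr p) * ((\<integral>\<^sup>+x. ennreal (\<bar>f x\<bar> powr p) \<partial>M) + (\<integral>\<^sup>+x. ennreal (\<bar>g x\<bar> powr p) \<partial>M))"
    by (simp add: nn_integral_cmult nn_integral_add)
  finally show ?thesis .
qed

lemma integrable_abs_powr_add:
  fixes a b :: "'b \<Rightarrow> real"
  assumes "0 < p" "a \<in> borel_measurable M" "b \<in> borel_measurable M"
    and "integrable M (\<lambda>x. \<bar>a x\<bar> powr p)" "integrable M (\<lambda>x. \<bar>b x\<bar> powr p)"
  shows "integrable M (\<lambda>x. \<bar>a x + b x\<bar> powr p)"
  by (rule Bochner_Integration.integrable_bound[where f="\<lambda>x. 2 powr p * (\<bar>a x\<bar> powr p + \<bar>b x\<bar> powr p)"])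
     (use assms abs_powr_add_le in auto)

lemma integrable_abs_powr_cmult:
  fixes a :: "'b \<Rightarrow> real"
  assumes "integrable M (\<lambda>x. \<bar>a x\<bar> powr p)"
  shows "integrable M (\<lambda>x. \<bar>c * a x\<bar> powr p)"
  using assms by (simp add: abs_mult powr_mult)

lemma integrable_abs_powr_diff:
  fixes a b :: "'b \<Rightarrow> real"
  assumes "0 < p" "a \<in> borel_measurable M" "b \<in> borel_measurable M"
    and "integrable M (\<lambda>x. \<bar>a x\<bar> powr p)" "integrable M (\<lambda>x. \<bar>b x\<bar> powr p)"
  shows "integrable M (\<lambda>x. \<bar>a x - b x\<bar> powr p)"
  using integrable_abs_powr_add[of p a M "\<lambda>x. - b x"] assms by simp

lemma integrable_abs_powr_mono:
  fixes a b :: "'b \<Rightarrow> real"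
  assumes "0 < p" "a \<in> borel_measurable M" "integrable M (\<lambda>x. \<bar>b x\<bar> powr p)"
    and "AE x in M. \<bar>a x\<bar> \<le> \<bar>b x\<bar>"
  shows "integrable M (\<lambda>x. \<bar>a x\<bar> powr p)"
  by (rule Bochner_Integration.integrable_bound[OF assms(3)])
     (use assms abs_powr_mono in auto)

text \<open>The pointwise uniform convexity inequality is integrated; it takes the place of
  Clarkson's inequalities and treats all \<open>p > 1\<close> alike. The bound \<open>B\<close>
  controls the error term, the assumption on the midpoints controls the rest.\<close>

lemma uniformly_convex_imp_Cauchy:
  fixes a :: "nat \<Rightarrow> 'b \<Rightarrow> real"
  assumes p: "1 < p" and [measurable]: "\<And>n. a n \<in> borel_measurable M"
    and int: "\<And>n. integrable M (\<lambda>x. \<bar>a n x\<bar> powr p)"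
    and B: "\<And>n. (\<integral>x. \<bar>a n x\<bar> powr p \<partial>M) \<le> B"
    and defect: "\<And>d. 0 < d \<Longrightarrow> \<exists>N. \<forall>m\<ge>N. \<forall>n\<ge>N. ((\<integral>x. \<bar>a m x\<bar> powr p \<partial>M) + (\<integral>x. \<bar>a n x\<bar> powr p \<partial>M)) / 2
        - (\<integral>x. \<bar>(a m x + a n x) / 2\<bar> powr p \<partial>M) < d"
    and d: "0 < d"
  shows "\<exists>N. \<forall>m\<ge>N. \<forall>n\<ge>N. (\<integral>x. \<bar>a m x - a n x\<bar> powr p \<partial>M) < d"
proof -
  have B0: "0 \<le> B" using B[of 0] by (smt (verit) integral_nonneg_AE AE_I2 powr_ge_zero)
  \<comment> \<open>The error term then contributes at most \<open>e * (B + B) \<le> d / 2\<close>,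
    and a defect below \<open>d / (2 * C)\<close> contributes the other half.\<close>
  define e where "e = d / (4 * (B + 1))"
  have e: "0 < e" using d B0 by (simp add: e_def)
  obtain C where C: "0 < C" "\<And>a b::real. \<bar>a - b\<bar> powr p \<le>
    C * ((\<bar>a\<bar> powr p + \<bar>b\<bar> powr p) / 2 - \<bar>(a + b) / 2\<bar> powr p) + e * (\<bar>a\<bar> powr p + \<bar>b\<bar> powr p)"
    using abs_powr_uniformly_convex[OF p e] by blast
  obtain N where N: "\<And>m n. m \<ge> N \<Longrightarrow> n \<ge> N \<Longrightarrow> ((\<integral>x. \<bar>a m x\<bar> powr p \<partial>M) + (\<integral>x. \<bar>a n x\<bar> powr p \<partial>M)) / 2
        - (\<integral>x. \<bar>(a m x + a n x) / 2\<bar> powr p \<partial>M) < d / (2 * C)"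
    using defect[of "d / (2 * C)"] d C(1) by auto
  have "(\<integral>x. \<bar>a m x - a n x\<bar> powr p \<partial>M) < d" if "m \<ge> N" "n \<ge> N" for m n
  proof -
    have i1: "integrable M (\<lambda>x. \<bar>(a m x + a n x) / 2\<bar> powr p)"
      using integrable_abs_powr_cmult[OF integrable_abs_powr_add[OF _ _ _ int int, of m n], of "1/2"] p by simp
    have i2: "integrable M (\<lambda>x. \<bar>a m x - a n x\<bar> powr p)"
      using integrable_abs_powr_diff[OF _ _ _ int int, of m n] p by simp
    have "(\<integral>x. \<bar>a m x - a n x\<bar> powr p \<partial>M) \<le> (\<integral>x. C * ((\<bar>a m x\<bar> powr p + \<bar>a n x\<bar> powr p) / 2 - \<bar>(a m x + a n x) / 2\<bar> powr p)
        + e * (\<bar>a m x\<bar> powr p + \<bar>a n x\<bar> powr p) \<partial>M)"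
      by (intro integral_mono C(2) i2 Bochner_Integration.integrable_add Bochner_Integration.integrable_diff
           integrable_mult_right integrable_divide int i1)
    also have "\<dots> = C * (((\<integral>x. \<bar>a m x\<bar> powr p \<partial>M) + (\<integral>x. \<bar>a n x\<bar> powr p \<partial>M)) / 2
        - (\<integral>x. \<bar>(a m x + a n x) / 2\<bar> powr p \<partial>M)) + e * ((\<integral>x. \<bar>a m x\<bar> powr p \<partial>M) + (\<integral>x. \<bar>a n x\<bar> powr p \<partial>M))"
      using int i1 by simp
    also have "\<dots> < C * (d / (2 * C)) + e * ((\<integral>x. \<bar>a m x\<bar> powr p \<partial>M) + (\<integral>x. \<bar>a n x\<bar> powr p \<partial>M))"
      using N[OF that] C(1) by (intro add_strict_right_mono mult_strict_left_mono) auto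
    also have "\<dots> \<le> C * (d / (2 * C)) + e * (B + B)"
      using B e by (intro add_left_mono mult_left_mono add_mono) auto
    also have "\<dots> \<le> d"
    proof -
      have "e * (B + B) = d / 2 * (B / (B + 1))" using B0 by (simp add: e_def field_simps)
      also have "\<dots> \<le> d / 2 * 1" using B0 d by (intro mult_left_mono) auto
      finally show ?thesis using C(1) by simp
    qed
    finally show ?thesis .
  qed
  then show ?thesis by blast
qed

text \<open>The limit is known pointwise only along \<open>r\<close>. Fatou's lemma in
  \<open>i\<close>, applied to the distance of \<open>a n\<close> from \<open>a (r i)\<close>,
  carries the Cauchy estimate over to the distance of \<open>a n\<close> from \<open>b\<close>, for
  the whole sequence.\<close>

lemma Cauchy_AE_limit:
  fixes a :: "nat \<Rightarrow> 'b \<Rightarrow> real"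
  assumes p: "1 < p" and [measurable]: "\<And>n. a n \<in> borel_measurable M" "b \<in> borel_measurable M"
    and int: "\<And>n. integrable M (\<lambda>x. \<bar>a n x\<bar> powr p)"
    and cauchy: "\<And>d. 0 < d \<Longrightarrow> \<exists>N. \<forall>m\<ge>N. \<forall>n\<ge>N. (\<integral>x. \<bar>a m x - a n x\<bar> powr p \<partial>M) < d"
    and r: "strict_mono r" "AE x in M. (\<lambda>n. a (r n) x) \<longlonglongrightarrow> b x"
  shows "integrable M (\<lambda>x. \<bar>b x\<bar> powr p)"
    and "0 < d \<Longrightarrow> \<exists>N. \<forall>n\<ge>N. integrable M (\<lambda>x. \<bar>a n x - b x\<bar> powr p) \<and> (\<integral>\<^sup>+x. ennreal (\<bar>a n x - b x\<bar> powr p) \<partial>M) \<le> ennreal d"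
proof -
  have p0: "0 < p" using p by simp
  have main: "\<exists>N. \<forall>n\<ge>N. integrable M (\<lambda>x. \<bar>a n x - b x\<bar> powr p) \<and> (\<integral>\<^sup>+x. ennreal (\<bar>a n x - b x\<bar> powr p) \<partial>M) \<le> ennreal d"
    if "0 < d" for d
  proof -
    obtain N where N: "\<And>m n. m \<ge> N \<Longrightarrow> n \<ge> N \<Longrightarrow> (\<integral>x. \<bar>a m x - a n x\<bar> powr p \<partial>M) < d"
      using cauchy[OF \<open>0 < d\<close>] by blast
    have "(\<integral>\<^sup>+x. ennreal (\<bar>a n x - b x\<bar> powr p) \<partial>M) \<le> ennreal d" if "n \<ge> N" for n
    proof -
      have "(\<integral>\<^sup>+x. ennreal (\<bar>a n x - b x\<bar> powr p) \<partial>M)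
          = (\<integral>\<^sup>+x. liminf (\<lambda>i. ennreal (\<bar>a n x - a (r i) x\<bar> powr p)) \<partial>M)"
      proof (rule nn_integral_cong_AE)
        show "AE x in M. ennreal (\<bar>a n x - b x\<bar> powr p) = liminf (\<lambda>i. ennreal (\<bar>a n x - a (r i) x\<bar> powr p))"
          using r(2)
        proof eventually_elim
          case (elim x)
          have "(\<lambda>i. ennreal (\<bar>a n x - a (r i) x\<bar> powr p)) \<longlonglongrightarrow> ennreal (\<bar>a n x - b x\<bar> powr p)"
            by (intro tendsto_ennrealI tendsto_abs_powr p0 tendsto_intros elim)
          then show ?case by (metis lim_imp_Liminf sequentially_bot)
        qed
      qed
      also have "\<dots> \<le> liminf (\<lambda>i. \<integral>\<^sup>+x. ennreal (\<bar>a n x - a (r i) x\<bar> powr p) \<partial>M)"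
        by (rule nn_integral_liminf) simp
      also have "\<dots> \<le> ennreal d"
      proof (rule Liminf_le)
        show "\<forall>\<^sub>F i in sequentially. (\<integral>\<^sup>+x. ennreal (\<bar>a n x - a (r i) x\<bar> powr p) \<partial>M) \<le> ennreal d"
          using eventually_ge_at_top[of N]
        proof eventually_elim
          case (elim i)
          then have "N \<le> r i" using seq_suble[OF r(1), of i] by linarith
          have "(\<integral>\<^sup>+x. ennreal (\<bar>a n x - a (r i) x\<bar> powr p) \<partial>M) = ennreal (\<integral>x. \<bar>a n x - a (r i) x\<bar> powr p \<partial>M)"
            by (rule nn_integral_eq_integral[OF integrable_abs_powr_diff[OF p0 _ _ int int]]) auto
          then show ?case using N[OF \<open>n \<ge> N\<close> \<open>N \<le> r i\<close>] by (simp add: ennreal_leI)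
        qed
      qed simp
      finally show ?thesis .
    qed
    moreover have "integrable M (\<lambda>x. \<bar>a n x - b x\<bar> powr p)"
      if "(\<integral>\<^sup>+x. ennreal (\<bar>a n x - b x\<bar> powr p) \<partial>M) \<le> ennreal d" for n
      using that by (intro integrableI_nonneg) (auto simp: top.not_eq_extremum[symmetric] top_unique)
    ultimately show ?thesis by blast
  qed
  then obtain N where "integrable M (\<lambda>x. \<bar>a N x - b x\<bar> powr p)" using zero_less_one by blast
  from integrable_abs_powr_diff[OF p0 _ _ int[of N] this]
  show "integrable M (\<lambda>x. \<bar>b x\<bar> powr p)" by simp
  show "0 < d \<Longrightarrow> \<exists>N. \<forall>n\<ge>N. integrable M (\<lambda>x. \<bar>a n x - b x\<bar> powr p) \<and> (\<integral>\<^sup>+x. ennreal (\<bar>a n x - b x\<bar> powr p) \<partial>M) \<le> ennreal d"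
    using main by blast
qed

text \<open>Fatou's lemma is applied to the nonnegative functions \<open>F n + G + Gn n\<close>.
  Dropping \<open>Gn n \<ge> 0\<close> on the side of the limit costs at most \<open>e\<close> in
  the integral, the integral of \<open>G\<close> cancels, and \<open>e\<close> tends to 0 at the
  end. Since \<open>Gn n\<close> need not converge pointwise, the negative part of \<open>F'\<close>
  is controlled separately by \<open>H\<close>.\<close>

lemma fatou_small_defect:
  fixes F :: "nat \<Rightarrow> 'b \<Rightarrow> real"
  assumes int: "\<And>n. integrable M (F n)" and [measurable]: "F' \<in> borel_measurable M"
    and lim: "AE x in M. (\<lambda>n. F n x) \<longlonglongrightarrow> F' x"
    and H: "integrable M H" "AE x in M. - H x \<le> F' x"
    and up: "\<And>n. (\<integral>x. F n x \<partial>M) \<le> r n" "r \<longlonglongrightarrow> R"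
    and low: "\<And>e::real. 0 < e \<Longrightarrow> \<exists>G Gn. integrable M G \<and> (\<forall>n. integrable M (Gn n) \<and> (\<integral>x. Gn n x \<partial>M) \<le> e
       \<and> (AE x in M. 0 \<le> Gn n x) \<and> (AE x in M. - (G x + Gn n x) \<le> F n x))"
  shows "integrable M F' \<and> (\<integral>x. F' x \<partial>M) \<le> R"
proof -
  have [measurable]: "F n \<in> borel_measurable M" for n using int by auto
  have main: "integrable M F' \<and> (\<integral>x. F' x \<partial>M) \<le> R + e" if "0 < e" for e
  proof -
    obtain G Gn where G: "integrable M G" and Gn: "\<And>n. integrable M (Gn n)" "\<And>n. (\<integral>x. Gn n x \<partial>M) \<le> e"
       "\<And>n. AE x in M. 0 \<le> Gn n x" "\<And>n. AE x in M. - (G x + Gn n x) \<le> F n x"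
      using low[OF \<open>0 < e\<close>] by blast
    have [measurable]: "G \<in> borel_measurable M" "Gn n \<in> borel_measurable M" for n using G Gn by auto
    define c where "c n = r n + (\<integral>x. G x \<partial>M) + e" for n
    define c' where "c' = R + (\<integral>x. G x \<partial>M) + e"
    have c: "c \<longlonglongrightarrow> c'" unfolding c_def c'_def by (intro tendsto_intros up)
    have bd: "(\<integral>\<^sup>+x. ennreal (F n x + G x + Gn n x) \<partial>M) \<le> ennreal (c n)" and c0: "0 \<le> c n" for n
    proof -
      have nn: "AE x in M. 0 \<le> F n x + G x + Gn n x" using Gn(4)[of n] by eventually_elim auto
      have I: "(\<integral>x. F n x + G x + Gn n x \<partial>M) = (\<integral>x. F n x \<partial>M) + (\<integral>x. G x \<partial>M) + (\<integral>x. Gn n x \<partial>M)"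
        using int G Gn by simp
      then have le: "(\<integral>x. F n x + G x + Gn n x \<partial>M) \<le> c n"
        using up(1)[of n] Gn(2)[of n] unfolding c_def by linarith
      then show "0 \<le> c n" using integral_nonneg_AE[OF nn] by linarith
      have "(\<integral>\<^sup>+x. ennreal (F n x + G x + Gn n x) \<partial>M) = ennreal (\<integral>x. F n x + G x + Gn n x \<partial>M)"
        using int G Gn nn by (intro nn_integral_eq_integral) auto
      then show "(\<integral>\<^sup>+x. ennreal (F n x + G x + Gn n x) \<partial>M) \<le> ennreal (c n)" using le by (simp add: ennreal_leI)
    qed
    have c'0: "0 \<le> c'" using c c0 by (intro LIMSEQ_le_const) auto
    have "(\<integral>\<^sup>+x. ennreal (F' x + G x) \<partial>M) \<le> (\<integral>\<^sup>+x. liminf (\<lambda>n. ennreal (F n x + G x + Gn n x)) \<partial>M)"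
    proof (rule nn_integral_mono_AE)
      have "AE x in M. \<forall>n. 0 \<le> Gn n x" using Gn(3) by (simp add: AE_all_countable)
      then show "AE x in M. ennreal (F' x + G x) \<le> liminf (\<lambda>n. ennreal (F n x + G x + Gn n x))"
        using lim
      proof eventually_elim
        case (elim x)
        have "(\<lambda>n. ennreal (F n x + G x)) \<longlonglongrightarrow> ennreal (F' x + G x)"
          by (intro tendsto_ennrealI tendsto_intros elim)
        then have "ennreal (F' x + G x) = liminf (\<lambda>n. ennreal (F n x + G x))"
          by (metis lim_imp_Liminf sequentially_bot)
        also have "\<dots> \<le> liminf (\<lambda>n. ennreal (F n x + G x + Gn n x))"
          by (intro Liminf_mono always_eventually allI ennreal_leI) (use elim in auto)
        finally show ?case .
      qed
    qed
    also have "\<dots> \<le> liminf (\<lambda>n. \<integral>\<^sup>+x. ennreal (F n x + G x + Gn n x) \<partial>M)"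
      by (rule nn_integral_liminf) simp
    also have "\<dots> \<le> liminf (\<lambda>n. ennreal (c n))"
      by (intro Liminf_mono always_eventually allI bd)
    also have "\<dots> = ennreal c'"
      using tendsto_ennrealI[OF c] by (metis lim_imp_Liminf sequentially_bot)
    finally have le: "(\<integral>\<^sup>+x. ennreal (F' x + G x) \<partial>M) \<le> ennreal c'" .
    \<comment> \<open>\<open>ennreal\<close> sends negative reals to 0, so the bound just obtained
      concerns only the positive part.\<close>
    define m where "m x = max (F' x + G x) 0" for x
    have [measurable]: "m \<in> borel_measurable M" unfolding m_def by measurable
    have em: "ennreal (m x) = ennreal (F' x + G x)" for x by (simp add: m_def max_def ennreal_neg)
    have le': "(\<integral>\<^sup>+x. ennreal (m x) \<partial>M) \<le> ennreal c'" using le by (simp add: em)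
    have mi: "integrable M m"
      by (intro integrableI_nonneg) (use le' in \<open>auto simp: m_def top.not_eq_extremum[symmetric] top_unique\<close>)
    have "(\<integral>\<^sup>+x. ennreal (m x) \<partial>M) = ennreal (\<integral>x. m x \<partial>M)"
      by (rule nn_integral_eq_integral[OF mi]) (simp add: m_def)
    then have "ennreal (\<integral>x. m x \<partial>M) \<le> ennreal c'" using le' by simp
    then have mc: "(\<integral>x. m x \<partial>M) \<le> c'" using c'0 by simp
    have Fi: "integrable M F'"
    proof (rule Bochner_Integration.integrable_bound)
      show "integrable M (\<lambda>x. m x + \<bar>G x\<bar> + \<bar>H x\<bar>)" using mi G H by auto
      show "AE x in M. norm (F' x) \<le> norm (m x + \<bar>G x\<bar> + \<bar>H x\<bar>)"
        using H(2) by eventually_elim (auto simp: m_def max_def)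
    qed simp
    have "(\<integral>x. F' x \<partial>M) + (\<integral>x. G x \<partial>M) = (\<integral>x. F' x + G x \<partial>M)" using Fi G by simp
    also have "\<dots> \<le> (\<integral>x. m x \<partial>M)" using Fi G mi by (intro integral_mono) (auto simp: m_def)
    finally show ?thesis using Fi mc unfolding c'_def by linarith
  qed
  then have "integrable M F'" using zero_less_one by blast
  moreover have "(\<integral>x. F' x \<partial>M) \<le> R" using main by (meson field_le_epsilon)
  ultimately show ?thesis by blast
qed

text \<open>The function is dominated by a series of constants on balls, and the volume of a ball is
  proportional to \<open>r k ^ DIM('a)\<close>. With dyadic radii this does the work of polar
  coordinates for powers of the norm.\<close>

lemma nn_integral_shells_finite:
  fixes f :: "'a::euclidean_space \<Rightarrow> ennreal" and c r :: "nat \<Rightarrow> real"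
  assumes cover: "\<And>z. f z \<noteq> 0 \<Longrightarrow> \<exists>k. norm z \<le> r k \<and> f z \<le> ennreal (c k)"
    and c: "\<And>k. 0 \<le> c k" and r: "\<And>k. 0 \<le> r k"
    and sm: "summable (\<lambda>k. c k * r k ^ DIM('a))"
  shows "(\<integral>\<^sup>+z. f z \<partial>(lborel :: 'a measure)) < \<infinity>"
proof -
  have fle: "f z \<le> (\<Sum>k. ennreal (c k) * indicator (cball 0 (r k)) z)" for z :: 'a
  proof (cases "f z = 0")
    case False
    then obtain k where k: "norm z \<le> r k" "f z \<le> ennreal (c k)" using cover by blast
    have "ennreal (c k) * indicator (cball 0 (r k)) z \<le> (\<Sum>k. ennreal (c k) * indicator (cball 0 (r k)) z)"
      using sum_le_suminf[OF summableI, of "{k}" "\<lambda>k. ennreal (c k) * indicator (cball 0 (r k)) z"]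
      by (simp del: sum_mult_indicator)
    then show ?thesis using k by simp
  qed simp
  have "(\<integral>\<^sup>+z. f z \<partial>lborel) \<le> (\<integral>\<^sup>+z. (\<Sum>k. ennreal (c k) * indicator (cball 0 (r k)) z) \<partial>(lborel :: 'a measure))"
    by (rule nn_integral_mono) (rule fle)
  also have "\<dots> = (\<Sum>k. \<integral>\<^sup>+z. ennreal (c k) * indicator (cball 0 (r k)) z \<partial>(lborel::'a measure))"
    by (rule nn_integral_suminf)
       (auto intro!: borel_measurable_times_ennreal borel_measurable_indicator borel_closed closed_cball)
  also have "\<dots> = (\<Sum>k. ennreal (unit_ball_vol (real DIM('a)) * (c k * r k ^ DIM('a))))"
    using c r by (intro suminf_cong) (simp add: nn_integral_cmult_indicator emeasure_cball ennreal_mult[symmetric] mult_ac)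
  also have "\<dots> = ennreal (\<Sum>k. unit_ball_vol (real DIM('a)) * (c k * r k ^ DIM('a)))"
    using c r sm by (intro suminf_ennreal2 summable_mult) (auto intro!: mult_nonneg_nonneg)
  also have "\<dots> < \<infinity>" by simp
  finally show ?thesis .
qed

text \<open>On the shell between radii \<open>(1/2) ^ Suc k\<close> and \<open>(1/2) ^ k\<close> the
  power is at most its value at the inner radius, which leaves a geometric series of ratio
  \<open>2 powr (a - DIM('a))\<close>.\<close>

lemma nn_integral_norm_powr_near_0:
  assumes "0 \<le> a" "a < real DIM('a)"
  shows "(\<integral>\<^sup>+z. indicator (cball 0 1) z * ennreal (norm z powr (- a)) \<partial>(lborel :: 'a::euclidean_space measure)) < \<infinity>"
proof (rule nn_integral_shells_finite[where r="\<lambda>k. (1/2) ^ k" and c="\<lambda>k. ((1/2) ^ Suc k) powr (- a)"])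
  fix z :: 'a assume "indicator (cball 0 1) z * ennreal (norm z powr (- a)) \<noteq> 0"
  \<comment> \<open>Because \<open>0 powr r = 0\<close>, the integrand vanishes at the origin, the
    only point of the ball that lies in no shell.\<close>
  then have z: "norm z \<le> 1" "0 < norm z" by (auto simp: indicator_def split: if_splits)
  define k where "k = (LEAST k. (1/2::real) ^ Suc k < norm z)"
  have "\<exists>k. (1/2::real) ^ Suc k < norm z"
  proof -
    obtain n where "(1/2::real) ^ n < norm z" using real_arch_pow_inv[of "norm z" "1/2"] z by auto
    moreover have "(1/2::real) ^ Suc n \<le> (1/2) ^ n" by simp
    ultimately show ?thesis by (meson le_less_trans)
  qed
  then have k1: "(1/2::real) ^ Suc k < norm z" unfolding k_def by (rule LeastI_ex)
  have k2: "norm z \<le> (1/2) ^ k"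
  proof (cases k)
    case (Suc j)
    then have "\<not> (1/2::real) ^ Suc j < norm z" unfolding k_def by (metis lessI not_less_Least)
    then show ?thesis using Suc by simp
  qed (use z in simp)
  have "norm z powr (- a) \<le> ((1/2) ^ Suc k) powr (- a)"
    using k1 assms by (intro powr_mono2') auto
  then show "\<exists>k. norm z \<le> (1/2) ^ k \<and> indicator (cball 0 1) z * ennreal (norm z powr (- a)) \<le> ennreal (((1/2) ^ Suc k) powr (- a))"
    using k2 z by (intro exI[of _ k]) (auto simp: ennreal_leI)
next
  have "(\<lambda>k. ((1/2::real) ^ Suc k) powr (- a) * ((1/2) ^ k) ^ DIM('a)) = (\<lambda>k. 2 powr a * (2 powr (a - real DIM('a))) ^ k)"
  proof
    fix k
    have h: "((1/2::real) ^ j) = 2 powr (- real j)" for j by (simp add: powr_minus powr_realpow power_one_over inverse_eq_divide)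
    have "((1/2::real) ^ Suc k) powr (- a) = 2 powr (real (Suc k) * a)"
      by (simp only: h powr_powr) (simp add: algebra_simps)
    moreover have "((1/2::real) ^ k) ^ DIM('a) = 2 powr (- real (k * DIM('a)))" by (metis power_mult h)
    ultimately have "((1/2::real) ^ Suc k) powr (- a) * ((1/2) ^ k) ^ DIM('a) = 2 powr (real (Suc k) * a) * 2 powr (- real (k * DIM('a)))"
      by simp
    also have "\<dots> = 2 powr (a + (a - real DIM('a)) * real k)" by (simp add: powr_add[symmetric] algebra_simps)
    also have "\<dots> = 2 powr a * (2 powr (a - real DIM('a))) ^ k" by (simp add: powr_add powr_powr[symmetric] powr_realpow)
    finally show "((1/2::real) ^ Suc k) powr (- a) * ((1/2) ^ k) ^ DIM('a) = 2 powr a * (2 powr (a - real DIM('a))) ^ k" .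
  qed
  moreover have "2 powr (a - real DIM('a)) < 1" using assms powr_less_one[of 2 "a - real DIM('a)"] by simp
  ultimately show "summable (\<lambda>k. ((1/2::real) ^ Suc k) powr (- a) * ((1/2) ^ k) ^ DIM('a))"
    by (simp add: summable_geometric summable_mult)
qed auto

text \<open>The same count on the shells between \<open>2 ^ k\<close> and \<open>2 ^ Suc k\<close>;
  the ratio is now \<open>2 powr (DIM('a) - b)\<close>.\<close>

lemma nn_integral_norm_powr_far:
  assumes "real DIM('a) < b"
  shows "(\<integral>\<^sup>+z. indicator (- cball 0 1) z * ennreal (norm z powr (- b)) \<partial>(lborel :: 'a::euclidean_space measure)) < \<infinity>"
proof (rule nn_integral_shells_finite[where r="\<lambda>k. 2 ^ Suc k" and c="\<lambda>k. (2 ^ k) powr (- b)"])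
  have b0: "0 \<le> b" using assms by simp
  fix z :: 'a assume "indicator (- cball 0 1) z * ennreal (norm z powr (- b)) \<noteq> 0"
  then have z: "1 < norm z" by (auto simp: indicator_def split: if_splits)
  define k where "k = (LEAST k. norm z \<le> 2 ^ Suc k)"
  have "\<exists>k. norm z \<le> 2 ^ Suc k"
  proof -
    obtain n where "norm z < 2 ^ n" using real_arch_pow[of 2 "norm z"] by auto
    moreover have "(2::real) ^ n \<le> 2 ^ Suc n" by simp
    ultimately show ?thesis by (meson le_less_trans less_imp_le order_trans)
  qed
  then have k1: "norm z \<le> 2 ^ Suc k" unfolding k_def by (rule LeastI_ex)
  have k2: "2 ^ k \<le> norm z"
  proof (cases k)
    case (Suc j)
    then have "\<not> norm z \<le> 2 ^ Suc j" unfolding k_def by (metis lessI not_less_Least)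
    then show ?thesis using Suc by simp
  qed (use z in simp)
  have "norm z powr (- b) \<le> (2 ^ k) powr (- b)"
    using k2 b0 by (intro powr_mono2') auto
  then show "\<exists>k. norm z \<le> 2 ^ Suc k \<and> indicator (- cball 0 1) z * ennreal (norm z powr (- b)) \<le> ennreal ((2 ^ k) powr (- b))"
    using k1 z by (intro exI[of _ k]) (auto simp: ennreal_leI)
next
  have "(\<lambda>k. (2 ^ k) powr (- b) * (2 ^ Suc k) ^ DIM('a)) = (\<lambda>k. 2 ^ DIM('a) * (2 powr (real DIM('a) - b)) ^ k)"
  proof
    fix k
    have h: "((2::real) ^ j) = 2 powr (real j)" for j by (simp add: powr_realpow)
    have "((2::real) ^ k) powr (- b) = 2 powr (- (real k * b))" by (simp only: h powr_powr) simp
    moreover have "((2::real) ^ Suc k) ^ DIM('a) = 2 powr (real (Suc k * DIM('a)))" by (metis power_mult h)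
    ultimately have "((2::real) ^ k) powr (- b) * (2 ^ Suc k) ^ DIM('a) = 2 powr (- (real k * b)) * 2 powr (real (Suc k * DIM('a)))"
      by simp
    also have "\<dots> = 2 powr (real DIM('a) + (real DIM('a) - b) * real k)" by (simp add: powr_add[symmetric] algebra_simps)
    also have "\<dots> = 2 ^ DIM('a) * (2 powr (real DIM('a) - b)) ^ k" by (simp add: powr_add powr_powr[symmetric] powr_realpow)
    finally show "((2::real) ^ k) powr (- b) * (2 ^ Suc k) ^ DIM('a) = 2 ^ DIM('a) * (2 powr (real DIM('a) - b)) ^ k" .
  qed
  moreover have "2 powr (real DIM('a) - b) < 1" using assms powr_less_one[of 2 "real DIM('a) - b"] by simp
  ultimately show "summable (\<lambda>k. ((2::real) ^ k) powr (- b) * (2 ^ Suc k) ^ DIM('a))"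
    by (simp add: summable_geometric summable_mult)
qed auto

section \<open>Smooth functions and test functions\<close>

lemma cinfty_continuous: "cinfty f \<Longrightarrow> continuous_on UNIV f"
  by (erule cinfty.cases) auto

lemma cinfty_deriv:
  assumes "cinfty f" "i \<in> Basis"
  obtains g where "\<And>x. ((\<lambda>t. f (x + t *\<^sub>R i)) has_real_derivative g x) (at 0)" "cinfty g"
proof -
  have "\<forall>i\<in>Basis. \<exists>g. (\<forall>x. ((\<lambda>t. f (x + t *\<^sub>R i)) has_real_derivative g x) (at 0)) \<and> cinfty g"
    using assms(1) by (rule cinfty.cases) simp
  then show ?thesis using assms(2) that by blast
qed

lemma cinfty_const: "cinfty (\<lambda>x. c)"
proof -
  have "\<exists>c. f = (\<lambda>x. c) \<Longrightarrow> cinfty f" for f :: "'a \<Rightarrow> real"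
  proof (coinduction arbitrary: f)
    case cinfty
    then obtain c where f: "f = (\<lambda>x. c)" by blast
    have "\<exists>g. (\<forall>x. ((\<lambda>t. f (x + t *\<^sub>R i)) has_real_derivative g x) (at 0)) \<and> ((\<exists>c. g = (\<lambda>x. c)) \<or> cinfty g)" for i
      unfolding f by (rule exI[of _ "\<lambda>_. 0"]) auto
    then show ?case using f by auto
  qed
  then show ?thesis by blast
qed

text \<open>An algebra of functions containing the smooth ones and all real powers of \<open>h\<close>. It is closed
  under partial derivatives, which makes it a coinductive invariant.\<close>

inductive smooth_alg :: "('a::euclidean_space \<Rightarrow> real) \<Rightarrow> ('a \<Rightarrow> real) \<Rightarrow> bool" for h where
  base: "cinfty f \<Longrightarrow> smooth_alg h f"
| add: "smooth_alg h f \<Longrightarrow> smooth_alg h g \<Longrightarrow> smooth_alg h (\<lambda>x. f x + g x)"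
| mult: "smooth_alg h f \<Longrightarrow> smooth_alg h g \<Longrightarrow> smooth_alg h (\<lambda>x. f x * g x)"
| pow: "smooth_alg h (\<lambda>x. h x powr r)"

lemma smooth_alg_step:
  assumes "smooth_alg h f" and h: "cinfty h" "\<And>x. 0 < h x"
  shows "continuous_on UNIV f \<and> (\<forall>i\<in>Basis. \<exists>g. (\<forall>x. ((\<lambda>t. f (x + t *\<^sub>R i)) has_real_derivative g x) (at 0)) \<and> smooth_alg h g)"
  using assms(1)
proof induction
  case (base f)
  have "\<exists>g. (\<forall>x. ((\<lambda>t. f (x + t *\<^sub>R i)) has_real_derivative g x) (at 0)) \<and> smooth_alg h g" if i: "i \<in> Basis" for i
  proof -
    obtain g where "\<And>x. ((\<lambda>t. f (x + t *\<^sub>R i)) has_real_derivative g x) (at 0)" "cinfty g"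
      using cinfty_deriv[OF base i] by metis
    then show ?thesis using smooth_alg.base[of g h] by auto
  qed
  then show ?case using cinfty_continuous[OF base] by blast
next
  case (add f g)
  have "\<exists>d. (\<forall>x. ((\<lambda>t. f (x + t *\<^sub>R i) + g (x + t *\<^sub>R i)) has_real_derivative d x) (at 0)) \<and> smooth_alg h d"
    if i: "i \<in> Basis" for i
  proof -
    obtain f' where f': "\<And>x. ((\<lambda>t. f (x + t *\<^sub>R i)) has_real_derivative f' x) (at 0)" "smooth_alg h f'"
      using add.IH(1)[THEN conjunct2, THEN bspec, OF i] by auto
    obtain g' where g': "\<And>x. ((\<lambda>t. g (x + t *\<^sub>R i)) has_real_derivative g' x) (at 0)" "smooth_alg h g'"
      using add.IH(2)[THEN conjunct2, THEN bspec, OF i] by auto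
    have "smooth_alg h (\<lambda>x. f' x + g' x)" by (intro smooth_alg.add f' g')
    moreover have "((\<lambda>t. f (x + t *\<^sub>R i) + g (x + t *\<^sub>R i)) has_real_derivative f' x + g' x) (at 0)" for x
      by (intro DERIV_add f' g')
    ultimately show ?thesis by (intro exI[of _ "\<lambda>x. f' x + g' x"]) simp
  qed
  then show ?case using add.IH by (auto intro!: continuous_intros)
next
  case (mult f g)
  have "\<exists>d. (\<forall>x. ((\<lambda>t. f (x + t *\<^sub>R i) * g (x + t *\<^sub>R i)) has_real_derivative d x) (at 0)) \<and> smooth_alg h d"
    if i: "i \<in> Basis" for i
  proof -
    obtain f' where f': "\<And>x. ((\<lambda>t. f (x + t *\<^sub>R i)) has_real_derivative f' x) (at 0)" "smooth_alg h f'"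
      using mult.IH(1)[THEN conjunct2, THEN bspec, OF i] by auto
    obtain g' where g': "\<And>x. ((\<lambda>t. g (x + t *\<^sub>R i)) has_real_derivative g' x) (at 0)" "smooth_alg h g'"
      using mult.IH(2)[THEN conjunct2, THEN bspec, OF i] by auto
    show ?thesis
    proof (intro exI[of _ "\<lambda>x. f' x * g x + g' x * f x"] conjI allI)
      fix x
      show "((\<lambda>t. f (x + t *\<^sub>R i) * g (x + t *\<^sub>R i)) has_real_derivative f' x * g x + g' x * f x) (at 0)"
        using DERIV_mult[OF f'(1)[of x] g'(1)[of x]] by simp
      show "smooth_alg h (\<lambda>x. f' x * g x + g' x * f x)"
        using f' g' mult.hyps by (intro smooth_alg.add smooth_alg.mult)
    qed
  qed
  then show ?case using mult.IH by (auto intro!: continuous_intros)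
next
  case (pow r)
  have "\<exists>d. (\<forall>x. ((\<lambda>t. h (x + t *\<^sub>R i) powr r) has_real_derivative d x) (at 0)) \<and> smooth_alg h d"
    if i: "i \<in> Basis" for i
  proof -
    obtain h' where d: "\<And>x. ((\<lambda>t. h (x + t *\<^sub>R i)) has_real_derivative h' x) (at 0)" "cinfty h'"
      using cinfty_deriv[OF h(1) i] by metis
    show ?thesis
    \<comment> \<open>The exponent is written as a constant function so that the derivative has
      literally the shape of the rule \<open>smooth_alg.mult\<close>.\<close>
    proof (intro exI[of _ "\<lambda>x. (\<lambda>_. r) x * (h x powr (r - 1)) * h' x"] conjI allI)
      fix x
      have "((\<lambda>z. z powr r) has_real_derivative r * h x powr (r - 1)) (at (h (x + 0 *\<^sub>R i)))"
        using has_real_derivative_powr[OF h(2)[of x], of r] by simp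
      from DERIV_chain2[OF this d(1)[of x]]
      show "((\<lambda>t. h (x + t *\<^sub>R i) powr r) has_real_derivative (\<lambda>_. r) x * (h x powr (r - 1)) * h' x) (at 0)"
        by simp
      show "smooth_alg h (\<lambda>x. (\<lambda>_. r) x * (h x powr (r - 1)) * h' x)"
        using d by (intro smooth_alg.mult smooth_alg.pow smooth_alg.base cinfty_const)
    qed
  qed
  moreover have "continuous_on UNIV (\<lambda>x. h x powr r)"
    using cinfty_continuous[OF h(1)] h(2) by (intro continuous_on_powr continuous_intros) (auto simp: less_imp_neq[symmetric])
  ultimately show ?case by auto
qed

lemma smooth_alg_cinfty:
  assumes "smooth_alg h f" "cinfty h" "\<And>x. 0 < h x"
  shows "cinfty f"
  using assms(1)
proof (coinduction arbitrary: f)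
  case cinfty
  then show ?case using smooth_alg_step[OF cinfty assms(2,3)] by blast
qed

lemma cinfty_add: "cinfty f \<Longrightarrow> cinfty g \<Longrightarrow> cinfty (\<lambda>x. f x + g x)"
  by (rule smooth_alg_cinfty[of "\<lambda>_. 1"]) (auto intro!: smooth_alg.add intro: smooth_alg.base cinfty_const)

lemma cinfty_mult: "cinfty f \<Longrightarrow> cinfty g \<Longrightarrow> cinfty (\<lambda>x. f x * g x)"
  by (rule smooth_alg_cinfty[of "\<lambda>_. 1"]) (auto intro!: smooth_alg.mult intro: smooth_alg.base cinfty_const)

lemma cinfty_powr: "cinfty h \<Longrightarrow> (\<And>x. 0 < h x) \<Longrightarrow> cinfty (\<lambda>x. h x powr r)"
  by (rule smooth_alg_cinfty[of h]) (auto intro: smooth_alg.pow)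

section \<open>Test functions: algebra, regularised absolute values, Lipschitz bounds\<close>

lemma compact_closure_subset: "compact T \<Longrightarrow> closure S \<subseteq> T \<Longrightarrow> compact (closure S)"
  using compact_Int_closed[of T "closure S"] by (simp add: Int_absorb1)

lemma test_fun_subset:
  assumes "cinfty \<psi>" "test_fun \<Omega> \<phi>" "\<And>x. \<phi> x = 0 \<Longrightarrow> \<psi> x = 0"
  shows "test_fun \<Omega> \<psi>"
proof -
  have "closure {x. \<psi> x \<noteq> 0} \<subseteq> closure {x. \<phi> x \<noteq> 0}" by (rule closure_mono) (use assms(3) in auto)
  then show ?thesis using assms(1,2) compact_closure_subset unfolding test_fun_def by blast
qed

lemma test_fun_add:
  assumes "test_fun \<Omega> \<phi>" "test_fun \<Omega> \<psi>" shows "test_fun \<Omega> (\<lambda>x. \<phi> x + \<psi> x)"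
proof -
  have "closure {x. \<phi> x + \<psi> x \<noteq> 0} \<subseteq> closure {x. \<phi> x \<noteq> 0} \<union> closure {x. \<psi> x \<noteq> 0}"
    unfolding closure_Un[symmetric] by (rule closure_mono) auto
  moreover have "compact (closure {x. \<phi> x \<noteq> 0} \<union> closure {x. \<psi> x \<noteq> 0})"
    using assms by (auto simp: test_fun_def)
  ultimately have "compact (closure {x. \<phi> x + \<psi> x \<noteq> 0})"
    by (meson compact_closure_subset)
  then show ?thesis
    using assms \<open>closure {x. \<phi> x + \<psi> x \<noteq> 0} \<subseteq> _\<close> unfolding test_fun_def by (auto intro: cinfty_add)
qed

lemma test_fun_cmult: "test_fun \<Omega> \<phi> \<Longrightarrow> test_fun \<Omega> (\<lambda>x. c * \<phi> x)"
  by (rule test_fun_subset[OF cinfty_mult[OF cinfty_const]]) (auto simp: test_fun_def)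

lemma test_fun_zero: "test_fun \<Omega> (\<lambda>x. 0)"
  by (simp add: test_fun_def cinfty_const)

text \<open>A smooth substitute for the absolute value of \<open>\<phi> x - a\<close>. Subtracting
  its value at \<open>\<phi> x = 0\<close> preserves the compact support. These functions bring the
  lattice operations into the closure \<open>W\<close>.\<close>

lemma test_fun_smooth_abs:
  assumes "test_fun \<Omega> \<phi>" "0 < e"
  shows "test_fun \<Omega> (\<lambda>x. sqrt ((\<phi> x - a)\<^sup>2 + e\<^sup>2) - sqrt (a\<^sup>2 + e\<^sup>2))"
proof (rule test_fun_subset[OF _ assms(1)])
  have c: "cinfty \<phi>" using assms by (simp add: test_fun_def)
  have d: "cinfty (\<lambda>x. \<phi> x + (- a))" by (intro cinfty_add c cinfty_const)
  have "cinfty (\<lambda>x. (\<phi> x + (- a)) * (\<phi> x + (- a)) + e\<^sup>2)"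
    by (intro cinfty_add cinfty_mult d cinfty_const)
  moreover have pos: "0 < (\<phi> x + (- a)) * (\<phi> x + (- a)) + e\<^sup>2" for x
    using assms(2) by (simp add: add_nonneg_pos)
  ultimately have "cinfty (\<lambda>x. ((\<phi> x + (- a)) * (\<phi> x + (- a)) + e\<^sup>2) powr (1/2))"
    by (rule cinfty_powr)
  then have "cinfty (\<lambda>x. ((\<phi> x + (- a)) * (\<phi> x + (- a)) + e\<^sup>2) powr (1/2) + (- sqrt (a\<^sup>2 + e\<^sup>2)))"
    by (intro cinfty_add cinfty_const)
  moreover have "((\<phi> x + (- a)) * (\<phi> x + (- a)) + e\<^sup>2) powr (1/2) = sqrt ((\<phi> x - a)\<^sup>2 + e\<^sup>2)" for x
    using pos[of x] by (simp add: powr_half_sqrt power2_eq_square)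
  ultimately show "cinfty (\<lambda>x. sqrt ((\<phi> x - a)\<^sup>2 + e\<^sup>2) - sqrt (a\<^sup>2 + e\<^sup>2))" by simp
qed simp

text \<open>Each root is the modulus of \<open>Complex t e\<close>, so this is the reverse triangle
  inequality.\<close>

lemma sqrt_shift_lipschitz: "\<bar>sqrt (x\<^sup>2 + e\<^sup>2) - sqrt (y\<^sup>2 + e\<^sup>2)\<bar> \<le> \<bar>x - y\<bar>"
proof -
  have eq: "sqrt (t\<^sup>2 + e\<^sup>2) = norm (Complex t e)" for t by (simp add: norm_complex_def)
  have "\<bar>norm (Complex x e) - norm (Complex y e)\<bar> \<le> norm (Complex x e - Complex y e)"
    by (rule norm_triangle_ineq3)
  also have "Complex x e - Complex y e = complex_of_real (x - y)" by (simp add: complex_eq_iff)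
  finally show ?thesis unfolding eq by (simp only: norm_of_real)
qed

lemma sqrt_shift_approx:
  assumes "0 \<le> e" shows "\<bar>sqrt (x\<^sup>2 + e\<^sup>2) - \<bar>x\<bar>\<bar> \<le> e"
proof -
  have "sqrt (x\<^sup>2 + e\<^sup>2) \<le> sqrt ((\<bar>x\<bar> + e)\<^sup>2)"
    using assms by (intro real_sqrt_le_mono) (simp add: power2_sum)
  moreover have "sqrt (x\<^sup>2) \<le> sqrt (x\<^sup>2 + e\<^sup>2)" by (intro real_sqrt_le_mono) simp
  ultimately show ?thesis using assms by simp
qed

text \<open>Each partial derivative is continuous and vanishes off the compact support, hence is
  bounded. As \<open>cinfty\<close> speaks of partial derivatives only, the mean value inequality is
  used along one coordinate direction at a time and the increments are added up.\<close>

lemma test_fun_lipschitz: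
  fixes \<phi> :: "'a::euclidean_space \<Rightarrow> real"
  assumes "test_fun \<Omega> \<phi>"
  obtains L where "0 \<le> L" "\<And>x y. \<bar>\<phi> x - \<phi> y\<bar> \<le> L * norm (x - y)"
proof -
  define K where "K = closure {x. \<phi> x \<noteq> 0}"
  have c: "cinfty \<phi>" and K: "compact K" using assms by (auto simp: test_fun_def K_def)
  have "\<exists>B\<ge>0. \<forall>x t. \<bar>\<phi> (x + t *\<^sub>R i) - \<phi> x\<bar> \<le> B * \<bar>t\<bar>" if i: "i \<in> Basis" for i
  proof -
    obtain g where g: "\<And>x. ((\<lambda>t. \<phi> (x + t *\<^sub>R i)) has_real_derivative g x) (at 0)" "cinfty g"
      using cinfty_deriv[OF c i] by metis
    have "compact (g ` K)" using cinfty_continuous[OF g(2)] K continuous_on_subset compact_continuous_image by blast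
    then obtain B where B: "\<And>x. x \<in> K \<Longrightarrow> \<bar>g x\<bar> \<le> B"
      by (metis bounded_iff compact_imp_bounded imageI real_norm_def)
    have zero: "g x = 0" if "x \<notin> K" for x
    proof -
      have o: "open ((\<lambda>t. x + t *\<^sub>R i) -` (- K))"
        by (rule open_vimage[OF open_Compl[OF compact_imp_closed[OF K]]]) (intro continuous_intros)
      have "\<phi> y = 0" if "y \<notin> K" for y using that closure_subset by (force simp: K_def)
      then have "((\<lambda>t. \<phi> (x + t *\<^sub>R i)) has_real_derivative 0) (at 0)"
        using \<open>x \<notin> K\<close> has_field_derivative_transform_within_open[OF DERIV_const o, of 0 0] by simp
      then show ?thesis using g(1)[of x] DERIV_unique by blast
    qed
    define B' where "B' = max B 0"
    have B': "\<bar>g x\<bar> \<le> B'" for x using B[of x] zero[of x] by (cases "x \<in> K") (auto simp: B'_def)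
    have der: "((\<lambda>t. \<phi> (x + t *\<^sub>R i)) has_real_derivative g (x + t *\<^sub>R i)) (at t)" for x t
    proof -
      have "((\<lambda>h. \<phi> ((x + t *\<^sub>R i) + h *\<^sub>R i)) has_real_derivative g (x + t *\<^sub>R i)) (at 0)" by (rule g)
      moreover have "(\<lambda>h. \<phi> ((x + t *\<^sub>R i) + h *\<^sub>R i)) = (\<lambda>h. \<phi> (x + (h + t) *\<^sub>R i))"
        by (simp add: algebra_simps)
      ultimately show ?thesis
        using DERIV_shift[of "\<lambda>t. \<phi> (x + t *\<^sub>R i)" "g (x + t *\<^sub>R i)" 0 t] by simp
    qed
    have "\<bar>\<phi> (x + t *\<^sub>R i) - \<phi> x\<bar> \<le> B' * \<bar>t\<bar>" for x t
    proof -
      have "norm ((\<lambda>t. \<phi> (x + t *\<^sub>R i)) t - (\<lambda>t. \<phi> (x + t *\<^sub>R i)) 0) \<le> B' * norm (t - 0)"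
        by (rule field_differentiable_bound[of UNIV "\<lambda>t. \<phi> (x + t *\<^sub>R i)" "\<lambda>t. g (x + t *\<^sub>R i)"])
           (auto intro: der B')
      then show ?thesis by simp
    qed
    then show ?thesis using max.cobounded2[of 0 B] unfolding B'_def by blast
  qed
  then obtain B where B: "\<And>i. i \<in> Basis \<Longrightarrow> 0 \<le> B i" "\<And>i x t. i \<in> Basis \<Longrightarrow> \<bar>\<phi> (x + t *\<^sub>R i) - \<phi> x\<bar> \<le> B i * \<bar>t\<bar>"
    by metis
  have part: "\<bar>\<phi> (x + (\<Sum>i\<in>I. (z \<bullet> i) *\<^sub>R i)) - \<phi> x\<bar> \<le> (\<Sum>i\<in>I. B i * \<bar>z \<bullet> i\<bar>)" if "I \<subseteq> Basis" for I x z
    using finite_subset[OF that finite_Basis] that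
  proof (induction I rule: finite_induct)
    case (insert j I)
    let ?y = "x + (\<Sum>i\<in>I. (z \<bullet> i) *\<^sub>R i)"
    have e: "x + (\<Sum>i\<in>insert j I. (z \<bullet> i) *\<^sub>R i) = ?y + (z \<bullet> j) *\<^sub>R j"
      "(\<Sum>i\<in>insert j I. B i * \<bar>z \<bullet> i\<bar>) = B j * \<bar>z \<bullet> j\<bar> + (\<Sum>i\<in>I. B i * \<bar>z \<bullet> i\<bar>)"
      using insert by (simp_all add: algebra_simps)
    have "\<bar>\<phi> (?y + (z \<bullet> j) *\<^sub>R j) - \<phi> ?y\<bar> \<le> B j * \<bar>z \<bullet> j\<bar>" using B(2) insert by simp
    moreover have "\<bar>\<phi> ?y - \<phi> x\<bar> \<le> (\<Sum>i\<in>I. B i * \<bar>z \<bullet> i\<bar>)" using insert by simp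
    ultimately show ?case unfolding e by linarith
  qed simp
  have "\<bar>\<phi> x - \<phi> y\<bar> \<le> (\<Sum>i\<in>Basis. B i) * norm (x - y)" for x y
  proof -
    have "\<bar>\<phi> x - \<phi> y\<bar> \<le> (\<Sum>i\<in>Basis. B i * \<bar>(x - y) \<bullet> i\<bar>)"
      using part[of Basis y "x - y"] unfolding euclidean_representation by simp
    also have "\<dots> \<le> (\<Sum>i\<in>Basis. B i * norm (x - y))"
      using B(1) by (intro sum_mono mult_left_mono Basis_le_norm) auto
    also have "\<dots> = (\<Sum>i\<in>Basis. B i) * norm (x - y)" by (rule sum_distrib_right[symmetric])
    finally show ?thesis .
  qed
  moreover have "0 \<le> (\<Sum>i\<in>Basis. B i)" using B(1) by (simp add: sum_nonneg)
  ultimately show ?thesis using that by blast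
qed

lemma test_fun_bounded:
  assumes "test_fun \<Omega> \<phi>" obtains C where "0 \<le> C" "\<And>x. \<bar>\<phi> x\<bar> \<le> C"
proof -
  define K where "K = closure {x. \<phi> x \<noteq> 0}"
  have "compact (\<phi> ` K)"
    using assms cinfty_continuous continuous_on_subset compact_continuous_image
    unfolding test_fun_def K_def by blast
  then obtain B where B: "\<And>x. x \<in> K \<Longrightarrow> \<bar>\<phi> x\<bar> \<le> B"
    by (metis bounded_iff compact_imp_bounded imageI real_norm_def)
  have z: "\<phi> y = 0" if "y \<notin> K" for y using that closure_subset by (force simp: K_def)
  have "\<bar>\<phi> x\<bar> \<le> max B 0" for x using B[of x] z[of x] by (cases "x \<in> K") auto
  then show ?thesis using that[of "max B 0"] by simp
qed

lemma test_fun_outside: "test_fun \<Omega> \<phi> \<Longrightarrow> x \<notin> \<Omega> \<Longrightarrow> \<phi> x = 0"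
  using closure_subset[of "{x. \<phi> x \<noteq> 0}"] unfolding test_fun_def by auto

lemma test_fun_measurable: "test_fun \<Omega> \<phi> \<Longrightarrow> \<phi> \<in> borel_measurable borel"
  unfolding test_fun_def by (intro borel_measurable_continuous_onI cinfty_continuous) simp

section \<open>The weighted measures\<close>

definition gap :: "('a \<Rightarrow> real) \<Rightarrow> 'a \<times> 'a \<Rightarrow> real" where
  "gap v z = v (fst z) - v (snd z)"

text \<open>By Tonelli and translation invariance, integrating first in the variable that
  \<open>h\<close> does not see leaves the product of the two integrals. This is the majorant for
  the energy of test functions.\<close>

lemma nn_integral_convolution_finite:
  fixes m h :: "'a::euclidean_space \<Rightarrow> ennreal"
  assumes [measurable]: "m \<in> borel_measurable borel" "h \<in> borel_measurable borel"
    and even: "\<And>z. m (- z) = m z"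
    and fin: "(\<integral>\<^sup>+z. m z \<partial>lborel) < \<infinity>" "(\<integral>\<^sup>+z. h z \<partial>lborel) < \<infinity>"
  shows "(\<integral>\<^sup>+z. m (fst z - snd z) * (h (fst z) + h (snd z)) \<partial>(lebesgue \<Otimes>\<^sub>M lebesgue)) < \<infinity>"
proof -
  interpret L: sigma_finite_measure "lebesgue :: 'a measure" by (rule sigma_finite_lebesgue)
  interpret P: pair_sigma_finite "lebesgue :: 'a measure" "lebesgue :: 'a measure"
    by (rule pair_sigma_finite_lebesgue)
  have idm [measurable]: "(\<lambda>x::'a. x) \<in> measurable lebesgue borel"
    using id_borel_measurable_lebesgue by (simp add: id_def)
  have [measurable]: "fst \<in> measurable (lebesgue \<Otimes>\<^sub>M lebesgue) (borel :: 'a measure)"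
      "snd \<in> measurable (lebesgue \<Otimes>\<^sub>M lebesgue) (borel :: 'a measure)"
    using measurable_compose[OF measurable_fst idm] measurable_compose[OF measurable_snd idm] by (simp_all add: eta_contract_eq)
  have tr: "(\<integral>\<^sup>+y. m (y - x) \<partial>lebesgue) = (\<integral>\<^sup>+z. m z \<partial>lborel)" for x
  proof -
    have "(\<integral>\<^sup>+z. m z \<partial>lborel) = (\<integral>\<^sup>+z. m z \<partial>distr lborel borel ((+) (- x)))" by (simp add: lborel_distr_plus)
    also have "\<dots> = (\<integral>\<^sup>+y. m (y - x) \<partial>lborel)" by (subst nn_integral_distr) auto
    finally show ?thesis by (simp add: nn_integral_completion)
  qed
  have 1: "(\<integral>\<^sup>+z. m (fst z - snd z) * h (fst z) \<partial>(lebesgue \<Otimes>\<^sub>M lebesgue)) < \<infinity>"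
  proof -
    have "(\<integral>\<^sup>+z. m (fst z - snd z) * h (fst z) \<partial>(lebesgue \<Otimes>\<^sub>M lebesgue))
        = (\<integral>\<^sup>+x. \<integral>\<^sup>+y. m (x - y) * h x \<partial>lebesgue \<partial>lebesgue)"
      by (subst L.nn_integral_fst[symmetric]) auto
    also have "\<dots> = (\<integral>\<^sup>+x. (\<integral>\<^sup>+z. m z \<partial>lborel) * h x \<partial>lebesgue)"
    proof (rule nn_integral_cong)
      fix x :: 'a
      have "m (x - y) = m (y - x)" for y using even[of "x - y"] by simp
      then show "(\<integral>\<^sup>+y. m (x - y) * h x \<partial>lebesgue) = (\<integral>\<^sup>+z. m z \<partial>lborel) * h x"
        using tr[of x] by (simp add: nn_integral_multc)
    qed
    also have "\<dots> = (\<integral>\<^sup>+z. m z \<partial>lborel) * (\<integral>\<^sup>+x. h x \<partial>lborel)"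
      by (subst nn_integral_cmult) (auto simp: nn_integral_completion)
    finally show ?thesis using fin by (simp add: ennreal_mult_less_top)
  qed
  have 2: "(\<integral>\<^sup>+z. m (fst z - snd z) * h (snd z) \<partial>(lebesgue \<Otimes>\<^sub>M lebesgue)) < \<infinity>"
  proof -
    have "(\<integral>\<^sup>+z. m (fst z - snd z) * h (snd z) \<partial>(lebesgue \<Otimes>\<^sub>M lebesgue))
        = (\<integral>\<^sup>+y. \<integral>\<^sup>+x. m (x - y) * h y \<partial>lebesgue \<partial>lebesgue)"
      by (subst P.nn_integral_snd[symmetric]) auto
    also have "\<dots> = (\<integral>\<^sup>+y. (\<integral>\<^sup>+z. m z \<partial>lborel) * h y \<partial>lebesgue)"
      using tr by (intro nn_integral_cong) (simp add: nn_integral_multc)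
    also have "\<dots> = (\<integral>\<^sup>+z. m z \<partial>lborel) * (\<integral>\<^sup>+x. h x \<partial>lborel)"
      by (subst nn_integral_cmult) (auto simp: nn_integral_completion)
    finally show ?thesis using fin by (simp add: ennreal_mult_less_top)
  qed
  show ?thesis using 1 2 by (simp add: distrib_left nn_integral_add)
qed

locale weighted_domain =
  fixes s p \<beta> :: real and \<Omega> :: "'a::euclidean_space set"
  assumes s: "0 < s" "s < 1" and p: "1 < p" "p < real DIM('a)"
    and beta: "0 \<le> \<beta>" "\<beta> < (real DIM('a) - p * s) / 2"
    and domain: "smooth_bounded_domain \<Omega>"
begin

abbreviation "L2 \<equiv> (lebesgue :: 'a measure) \<Otimes>\<^sub>M (lebesgue :: 'a measure)"
abbreviation "\<nu> \<equiv> nu_meas s p \<beta> :: ('a \<times> 'a) measure"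
abbreviation "\<mu> \<equiv> mu_meas \<beta> :: 'a measure"
abbreviation "W \<equiv> W_space s p \<beta> \<Omega>"

definition wt :: "'a \<times> 'a \<Rightarrow> real" where
  "wt z = 1 / (dist (fst z) (snd z) powr (real DIM('a) + p * s) * norm (fst z) powr \<beta> * norm (snd z) powr \<beta>)"

lemma p0: "0 < p" using p by simp

lemma two_beta: "2 * \<beta> < real DIM('a)"
proof -
  have "0 < p * s" using p s by simp
  then show ?thesis using beta by (simp add: field_simps)
qed

lemma id_measurable [measurable]: "(\<lambda>x::'a. x) \<in> measurable lebesgue borel"
  using id_borel_measurable_lebesgue by (simp add: id_def)

lemma fst_snd_measurable: "fst \<in> measurable L2 (borel :: 'a measure)"
      "snd \<in> measurable L2 (borel :: 'a measure)"
  using measurable_compose[OF measurable_fst id_measurable] measurable_compose[OF measurable_snd id_measurable]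
  by (simp_all add: eta_contract_eq)

lemma nu_eq: "\<nu> = density L2 (\<lambda>z. ennreal (wt z))"
  unfolding nu_meas_def wt_def by (simp add: case_prod_beta')

lemma sets_nu [measurable_cong, simp]: "sets \<nu> = sets L2"
  by (simp add: nu_eq)

lemma sets_mu [measurable_cong, simp]: "sets \<mu> = sets lebesgue"
  by (simp add: mu_meas_def)

lemma wt_measurable [measurable]: "wt \<in> borel_measurable L2"
proof -
  note [measurable] = fst_snd_measurable
  show ?thesis unfolding wt_def by measurable
qed

lemma wt_nonneg [simp]: "0 \<le> wt z" by (simp add: wt_def)

lemma gap_measurable [measurable]: "v \<in> borel_measurable lebesgue \<Longrightarrow> gap v \<in> borel_measurable L2"
  unfolding gap_def by (intro borel_measurable_diff measurable_compose[OF measurable_fst] measurable_compose[OF measurable_snd])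

lemma open_domain: "open \<Omega>"
proof -
  obtain \<rho> where "cinfty \<rho>" "\<Omega> = {x. \<rho> x < 0}" using domain by (auto simp: smooth_bounded_domain_def)
  moreover have "open (\<rho> -` {..<0})"
    using cinfty_continuous[OF \<open>cinfty \<rho>\<close>] by (intro open_vimage) auto
  ultimately show ?thesis by (simp add: vimage_def)
qed

lemma bounded_domain: "bounded \<Omega>"
  using domain by (simp add: smooth_bounded_domain_def)

lemma domain_subset_cball: obtains R where "\<Omega> \<subseteq> cball 0 R"
  using bounded_domain unfolding bounded_iff by (auto simp: subset_iff)

lemma domain_measurable [measurable]: "\<Omega> \<in> sets lebesgue" "\<Omega> \<in> sets borel"
  using open_domain by auto

lemma emeasure_domain: "emeasure lebesgue \<Omega> < \<infinity>"
proof -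
  obtain R where "\<Omega> \<subseteq> cball 0 R" using domain_subset_cball .
  then have "emeasure lebesgue \<Omega> \<le> emeasure lebesgue (cball (0::'a) R)"
    by (intro emeasure_mono) auto
  also have "\<dots> < \<infinity>" using emeasure_bounded_finite[of "cball (0::'a) R"] by (simp add: emeasure_completion)
  finally show ?thesis .
qed

lemma AE_nonzero: "AE x in (lebesgue :: 'a measure). x \<noteq> 0"
proof -
  have "{0::'a} \<in> null_sets lborel" by (rule finite_imp_null_set_lborel) simp
  then have "{0::'a} \<in> null_sets lebesgue" by (simp add: null_sets_completionI)
  from AE_not_in[OF this] show ?thesis by simp
qed

lemma AE_nu: "AE z in L2. P z \<Longrightarrow> AE z in \<nu>. P z"
  unfolding nu_eq by (subst AE_density) auto

lemma AE_nu_pair: "AE x in lebesgue. P x \<Longrightarrow> AE z in \<nu>. P (fst z) \<and> P (snd z)"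
  by (rule AE_nu) (rule AE_fst_snd_lebesgue)

text \<open>The weight vanishes only at the origin, where \<open>0 powr r = 0\<close>, and a point
  is a null set.\<close>

lemma AE_mu_iff: "(AE x in \<mu>. P x) \<longleftrightarrow> (AE x in lebesgue. P x)"
proof -
  have "(AE x in \<mu>. P x) \<longleftrightarrow> (AE x in lebesgue. 0 < ennreal (norm x powr (- 2 * \<beta>)) \<longrightarrow> P x)"
    unfolding mu_meas_def by (subst AE_density) auto
  also have "\<dots> \<longleftrightarrow> (AE x in lebesgue. P x)"
  proof
    assume "AE x in lebesgue. 0 < ennreal (norm x powr (- 2 * \<beta>)) \<longrightarrow> P x"
    then show "AE x in lebesgue. P x" using AE_nonzero by eventually_elim auto
  qed (auto elim: eventually_mono)
  finally show ?thesis .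
qed

lemma weight_near_0:
  "(\<integral>\<^sup>+x. indicator (cball 0 1) x * ennreal (norm x powr (- 2 * \<beta>)) \<partial>(lborel :: 'a measure)) < \<infinity>"
  using nn_integral_norm_powr_near_0[of "2 * \<beta>", where ?'a='a] beta two_beta by simp

lemma weight_le: "norm x powr (- 2 * \<beta>) \<le> indicator (cball 0 1) x * norm x powr (- 2 * \<beta>) + 1" for x :: 'a
proof (cases "norm x \<le> 1")
  case False
  then have "norm x powr (- 2 * \<beta>) \<le> 1 powr (- 2 * \<beta>)" using beta by (intro powr_mono2') auto
  then show ?thesis by (simp add: indicator_def)
qed simp

lemma emeasure_mu_domain: "emeasure \<mu> \<Omega> < \<infinity>"
proof -
  have "emeasure \<mu> \<Omega> = (\<integral>\<^sup>+x. ennreal (norm x powr (- 2 * \<beta>)) * indicator \<Omega> x \<partial>lebesgue)"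
    unfolding mu_meas_def by (subst emeasure_density) auto
  also have "\<dots> \<le> (\<integral>\<^sup>+x. indicator (cball 0 1) x * ennreal (norm x powr (- 2 * \<beta>)) + indicator \<Omega> x \<partial>lebesgue)"
  proof (rule nn_integral_mono)
    fix x :: 'a
    have "ennreal (norm x powr (- 2 * \<beta>)) \<le> ennreal (indicator (cball 0 1) x * norm x powr (- 2 * \<beta>) + 1)"
      using weight_le[of x] by (rule ennreal_leI)
    also have "\<dots> = indicator (cball 0 1) x * ennreal (norm x powr (- 2 * \<beta>)) + 1"
      by (simp add: indicator_def)
    finally show "ennreal (norm x powr (- 2 * \<beta>)) * indicator \<Omega> x
        \<le> indicator (cball 0 1) x * ennreal (norm x powr (- 2 * \<beta>)) + indicator \<Omega> x"
      by (auto simp: indicator_def split: if_splits)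
  qed
  also have "\<dots> = (\<integral>\<^sup>+x. indicator (cball 0 1) x * ennreal (norm x powr (- 2 * \<beta>)) \<partial>(lborel :: 'a measure)) + emeasure lebesgue \<Omega>"
  proof -
    have "(\<integral>\<^sup>+x. indicator (cball 0 1) x * ennreal (norm x powr (- 2 * \<beta>)) + indicator \<Omega> x \<partial>(lebesgue :: 'a measure))
      = (\<integral>\<^sup>+x. indicator (cball 0 1) x * ennreal (norm x powr (- 2 * \<beta>)) \<partial>(lebesgue :: 'a measure)) + (\<integral>\<^sup>+x. indicator \<Omega> x \<partial>lebesgue)"
    proof (rule nn_integral_add)
      have [measurable]: "cball (0::'a) 1 \<in> sets lebesgue" by simp
      show "(\<lambda>x::'a. indicator (cball 0 1) x * ennreal (norm x powr (- 2 * \<beta>))) \<in> borel_measurable lebesgue"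
        by measurable
    qed auto
    also have "(\<integral>\<^sup>+x. indicator (cball 0 1) x * ennreal (norm x powr (- 2 * \<beta>)) \<partial>(lebesgue :: 'a measure))
      = (\<integral>\<^sup>+x. indicator (cball 0 1) x * ennreal (norm x powr (- 2 * \<beta>)) \<partial>(lborel :: 'a measure))" by (rule nn_integral_completion)
    also have "(\<integral>\<^sup>+x. indicator \<Omega> x \<partial>lebesgue) = emeasure lebesgue \<Omega>" by simp
    finally show ?thesis .
  qed
  also have "\<dots> < \<infinity>" using weight_near_0 emeasure_domain by simp
  finally show ?thesis .
qed

text \<open>The increment is at most the minimum of \<open>L * norm (x - y)\<close> and
  \<open>2 * C\<close>. Near the diagonal the kernel exponent thus drops to
  \<open>DIM('a) + p * s - p\<close>, which is integrable because \<open>s < 1\<close>; far away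
  \<open>DIM('a) + p * s\<close> is integrable. The two weights are separated by
  \<open>a * b \<le> a\<^sup>2 + b\<^sup>2\<close>, and the squares are integrable near 0 because
  \<open>2 * \<beta> < DIM('a)\<close>. The energy is finite over all pairs, not only over \<Omega>
  \<times> \<Omega>.\<close>

lemma test_fun_energy:
  assumes "test_fun \<Omega> \<phi>"
  shows "integrable \<nu> (\<lambda>z. \<bar>gap \<phi> z\<bar> powr p)"
proof -
  obtain L where L: "0 \<le> L" "\<And>x y. \<bar>\<phi> x - \<phi> y\<bar> \<le> L * norm (x - y)" using test_fun_lipschitz[OF assms] by blast
  obtain C where C: "0 \<le> C" "\<And>x. \<bar>\<phi> x\<bar> \<le> C" using test_fun_bounded[OF assms] by blast
  obtain R where R: "\<Omega> \<subseteq> cball 0 R" using domain_subset_cball .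
  have meas [measurable]: "\<phi> \<in> borel_measurable borel" "\<phi> \<in> borel_measurable lebesgue"
    using test_fun_measurable[OF assms] measurable_completion by auto
  let ?N = "real DIM('a)"
  define m where "m z = ennreal (L powr p) * (indicator (cball 0 1) z * ennreal (norm z powr (- (?N + p * s - p))))
     + ennreal ((2 * C) powr p) * (indicator (- cball 0 1) z * ennreal (norm z powr (- (?N + p * s))))" for z :: 'a
  \<comment> \<open>Off the unit ball the weight is at most 1. The two constants 1, for
    \<open>x\<close> and for \<open>y\<close>, are paid by \<open>2 * indicator (cball 0 R)\<close>,
    because at least one of the points lies in that ball whenever the increment is nonzero.\<close>
  define h where "h x = 2 * (indicator (cball 0 1) x * ennreal (norm x powr (- 2 * \<beta>)) + indicator (cball 0 R) x)" for x :: 'a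
  have [measurable]: "cball (0::'a) r \<in> sets borel" for r by simp
  have [measurable]: "m \<in> borel_measurable borel" unfolding m_def by measurable
  have [measurable]: "h \<in> borel_measurable borel" unfolding h_def by measurable
  have ps: "0 < p * s" "p * s < p" using p s by auto
  have mfin: "(\<integral>\<^sup>+z. m z \<partial>lborel) < \<infinity>"
    using nn_integral_norm_powr_near_0[of "?N + p * s - p", where ?'a='a] nn_integral_norm_powr_far[of "?N + p * s", where ?'a='a] ps p
    unfolding m_def by (simp add: nn_integral_add nn_integral_cmult ennreal_mult_less_top)
  have hfin: "(\<integral>\<^sup>+z. h z \<partial>lborel) < \<infinity>"
    using weight_near_0 emeasure_bounded_finite[of "cball (0::'a) R"]
    unfolding h_def by (simp add: nn_integral_add nn_integral_cmult ennreal_mult_less_top)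
  have kernel: "ennreal (norm d powr (- (?N + p * s)) * \<bar>t\<bar> powr p) \<le> m d"
    if "\<bar>t\<bar> \<le> L * norm d" "\<bar>t\<bar> \<le> 2 * C" for d :: 'a and t
  proof (cases "norm d \<le> 1")
    case True
    have "\<bar>t\<bar> powr p \<le> (L * norm d) powr p" using that p0 by (intro powr_mono2) auto
    also have "\<dots> = L powr p * norm d powr p" using L by (simp add: powr_mult)
    finally have "norm d powr (- (?N + p * s)) * \<bar>t\<bar> powr p \<le> norm d powr (- (?N + p * s)) * (L powr p * norm d powr p)"
      by (intro mult_left_mono) auto
    also have "\<dots> = L powr p * norm d powr (- (?N + p * s - p))"
      by (simp add: powr_add[symmetric] mult.left_commute) (simp add: algebra_simps)
    finally show ?thesis using True by (simp add: m_def ennreal_leI ennreal_mult[symmetric])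
  next
    case False
    have "\<bar>t\<bar> powr p \<le> (2 * C) powr p" using that p0 by (intro powr_mono2) auto
    then have "norm d powr (- (?N + p * s)) * \<bar>t\<bar> powr p \<le> (2 * C) powr p * norm d powr (- (?N + p * s))"
      by (simp add: mult.commute mult_right_mono)
    then show ?thesis using False by (simp add: m_def ennreal_leI ennreal_mult[symmetric])
  qed
  have pt: "ennreal (wt z) * ennreal (\<bar>gap \<phi> z\<bar> powr p) \<le> m (fst z - snd z) * (h (fst z) + h (snd z))" for z
  proof -
    obtain x y where z: "z = (x, y)" by (cases z)
    show ?thesis
    proof (cases "x \<in> cball 0 R \<or> y \<in> cball 0 R")
      case False
      then have "\<phi> x = 0" "\<phi> y = 0" using False R test_fun_outside[OF assms, of x] test_fun_outside[OF assms, of y] by blast+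
      then show ?thesis by (simp add: z gap_def)
    next
      case True
      define a where "a = norm x powr (- \<beta>)"
      define b where "b = norm y powr (- \<beta>)"
      have wt: "wt z = norm (x - y) powr (- (?N + p * s)) * (a * b)"
        unfolding wt_def a_def b_def z powr_minus_divide dist_norm by simp
      have ab: "a * b \<le> a\<^sup>2 + b\<^sup>2"
        using sum_squares_bound[of a b] zero_le_power2[of a] zero_le_power2[of b] by linarith
      have sq: "a\<^sup>2 = norm x powr (- 2 * \<beta>)" "b\<^sup>2 = norm y powr (- 2 * \<beta>)"
        unfolding a_def b_def power2_eq_square by (simp_all add: powr_add[symmetric])
      have hh: "ennreal (a * b) \<le> h x + h y"
      proof -
        define A where "A t = indicator (cball 0 1) t * norm t powr (- 2 * \<beta>)" for t :: 'a
        have hA: "h t = ennreal (2 * A t + 2 * indicator (cball 0 R) t)" for t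
          unfolding h_def A_def by (simp add: indicator_def ennreal_mult distrib_left)
        have "a * b \<le> (A x + 1) + (A y + 1)"
          using ab sq weight_le[of x] weight_le[of y] unfolding A_def by linarith
        also have "\<dots> \<le> (2 * A x + 2 * indicator (cball 0 R) x) + (2 * A y + 2 * indicator (cball 0 R) y)"
        proof -
          have "0 \<le> A x" "0 \<le> A y" by (auto simp: A_def)
          moreover have "1 \<le> indicator (cball 0 R) x + (indicator (cball 0 R) y :: real)" using True by (auto simp: indicator_def)
          ultimately show ?thesis by linarith
        qed
        finally have "ennreal (a * b) \<le> ennreal ((2 * A x + 2 * indicator (cball 0 R) x) + (2 * A y + 2 * indicator (cball 0 R) y))"
          by (rule ennreal_leI)
        then show ?thesis unfolding hA by (subst (asm) ennreal_plus) (auto simp: A_def)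
      qed
      have "\<bar>\<phi> x - \<phi> y\<bar> \<le> 2 * C" using C(2)[of x] C(2)[of y] by linarith
      from mult_mono[OF kernel[OF L(2)[of x y] this] hh]
      have "ennreal (norm (x - y) powr (- (?N + p * s)) * \<bar>\<phi> x - \<phi> y\<bar> powr p) * ennreal (a * b) \<le> m (x - y) * (h x + h y)"
        by simp
      moreover have "ennreal (wt z) * ennreal (\<bar>gap \<phi> z\<bar> powr p)
          = ennreal (norm (x - y) powr (- (?N + p * s)) * \<bar>\<phi> x - \<phi> y\<bar> powr p) * ennreal (a * b)"
        unfolding wt by (simp add: gap_def z ennreal_mult[symmetric] a_def b_def mult_ac)
      ultimately show ?thesis by (simp add: z)
    qed
  qed
  have "(\<integral>\<^sup>+z. ennreal (\<bar>gap \<phi> z\<bar> powr p) \<partial>\<nu>) = (\<integral>\<^sup>+z. ennreal (wt z) * ennreal (\<bar>gap \<phi> z\<bar> powr p) \<partial>L2)"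
    unfolding nu_eq by (subst nn_integral_density) auto
  also have "\<dots> \<le> (\<integral>\<^sup>+z. m (fst z - snd z) * (h (fst z) + h (snd z)) \<partial>L2)"
    by (rule nn_integral_mono) (rule pt)
  also have "\<dots> < \<infinity>"
    by (rule nn_integral_convolution_finite[OF _ _ _ mfin hfin]) (auto simp: m_def indicator_def)
  finally show ?thesis by (intro integrableI_nonneg) (auto simp: less_top)
qed

end

section \<open>The function space\<close>

text \<open>Dyadic convex combinations of the tail from \<open>n\<close> on. Closure under midpoints
  replaces full convexity because the uniform convexity inequality involves midpoints only.\<close>

inductive midpoint_hull :: "(nat \<Rightarrow> 'a \<Rightarrow> real) \<Rightarrow> nat \<Rightarrow> ('a \<Rightarrow> real) \<Rightarrow> bool" for v n where
  base: "n \<le> k \<Longrightarrow> midpoint_hull v n (v k)"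
| mid: "midpoint_hull v n a \<Longrightarrow> midpoint_hull v n b \<Longrightarrow> midpoint_hull v n (\<lambda>x. (a x + b x) / 2)"

lemma midpoint_hull_mono: "midpoint_hull v n c \<Longrightarrow> m \<le> n \<Longrightarrow> midpoint_hull v m c"
  by (induction rule: midpoint_hull.induct) (auto intro: midpoint_hull.intros)

lemma ennreal_add_leD: "(a::ennreal) + b \<le> c \<Longrightarrow> a \<le> c \<and> b \<le> c"
  using order_trans[of a "a + b" c] order_trans[of b "a + b" c] by simp

context weighted_domain
begin

text \<open>Restricting the measures instead of the integrands lets the general facts about
  integrals of p-th powers apply directly to the norm of \<open>W\<close>.\<close>

definition muD :: "'a measure" where "muD = density \<mu> (indicator \<Omega>)"
definition nuD :: "('a \<times> 'a) measure" where "nuD = density \<nu> (indicator (\<Omega> \<times> \<Omega>))"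

lemma sets_muD [measurable_cong, simp]: "sets muD = sets lebesgue" by (simp add: muD_def)
lemma space_muD: "space muD = UNIV" using sets_eq_imp_space_eq[OF sets_muD] by simp
lemma sets_nuD [measurable_cong, simp]: "sets nuD = sets L2" by (simp add: nuD_def)

lemma domain_sq_measurable [measurable]: "\<Omega> \<times> \<Omega> \<in> sets L2" by auto

lemma nn_integral_muD: "f \<in> borel_measurable lebesgue \<Longrightarrow> (\<integral>\<^sup>+x. f x \<partial>muD) = (\<integral>\<^sup>+x. indicator \<Omega> x * f x \<partial>\<mu>)"
  unfolding muD_def by (subst nn_integral_density) auto

lemma nn_integral_nuD: "f \<in> borel_measurable L2 \<Longrightarrow> (\<integral>\<^sup>+z. f z \<partial>nuD) = (\<integral>\<^sup>+z. indicator (\<Omega> \<times> \<Omega>) z * f z \<partial>\<nu>)"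
  unfolding nuD_def by (subst nn_integral_density) auto

lemma nn_integral_nuD_le: "f \<in> borel_measurable L2 \<Longrightarrow> (\<integral>\<^sup>+z. f z \<partial>nuD) \<le> (\<integral>\<^sup>+z. f z \<partial>\<nu>)"
  by (subst nn_integral_nuD) (auto intro!: nn_integral_mono simp: indicator_def)

lemma AE_nuD: "AE z in \<nu>. P z \<Longrightarrow> AE z in nuD. P z"
  unfolding nuD_def by (subst AE_density) auto

lemma AE_muD_iff: "(AE x in muD. P x) \<longleftrightarrow> (AE x in lebesgue. x \<in> \<Omega> \<longrightarrow> P x)"
proof -
  have "(AE x in muD. P x) \<longleftrightarrow> (AE x in \<mu>. x \<in> \<Omega> \<longrightarrow> P x)"
    unfolding muD_def by (subst AE_density) (auto simp: indicator_def)
  then show ?thesis by (simp add: AE_mu_iff)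
qed

lemma integrable_nuD: "f \<in> borel_measurable L2 \<Longrightarrow> integrable \<nu> f \<Longrightarrow> integrable nuD f" for f :: "'a \<times> 'a \<Rightarrow> real"
  unfolding integrable_iff_bounded using nn_integral_nuD_le[of "\<lambda>z. ennreal (norm (f z))"]
  by (auto intro: le_less_trans)

lemma emeasure_muD_UNIV: "emeasure muD UNIV < \<infinity>"
proof -
  have "emeasure muD UNIV = (\<integral>\<^sup>+x. 1 \<partial>muD)" using nn_integral_indicator[of UNIV muD] by simp
  also have "\<dots> = emeasure \<mu> \<Omega>" by (subst nn_integral_muD) auto
  finally show ?thesis using emeasure_mu_domain by simp
qed

text \<open>A sum of p-th powers rather than the norm itself: only its smallness matters, and a
  triangle inequality up to the factor \<open>2 powr p\<close> is enough.\<close>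

definition nrm :: "('a \<Rightarrow> real) \<Rightarrow> ennreal" where
  "nrm f = (\<integral>\<^sup>+x. ennreal (\<bar>f x\<bar> powr p) \<partial>muD) + (\<integral>\<^sup>+z. ennreal (\<bar>gap f z\<bar> powr p) \<partial>nuD)"

lemma nrm_diff:
  "nrm (\<lambda>x. f x - g x) = (\<integral>\<^sup>+x. ennreal (\<bar>f x - g x\<bar> powr p) \<partial>muD) + (\<integral>\<^sup>+z. ennreal (\<bar>gap f z - gap g z\<bar> powr p) \<partial>nuD)"
proof -
  have "gap (\<lambda>x. f x - g x) z = gap f z - gap g z" for z by (simp add: gap_def)
  then show ?thesis by (simp add: nrm_def)
qed

lemma nrm_add:
  assumes [measurable]: "f \<in> borel_measurable lebesgue" "g \<in> borel_measurable lebesgue"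
  shows "nrm (\<lambda>x. f x + g x) \<le> ennreal (2 powr p) * (nrm f + nrm g)"
proof -
  have "gap (\<lambda>x. f x + g x) z = gap f z + gap g z" for z by (simp add: gap_def)
  then have "nrm (\<lambda>x. f x + g x) = (\<integral>\<^sup>+x. ennreal (\<bar>f x + g x\<bar> powr p) \<partial>muD) + (\<integral>\<^sup>+z. ennreal (\<bar>gap f z + gap g z\<bar> powr p) \<partial>nuD)"
    by (simp add: nrm_def)
  also have "\<dots> \<le> ennreal (2 powr p) * ((\<integral>\<^sup>+x. ennreal (\<bar>f x\<bar> powr p) \<partial>muD) + (\<integral>\<^sup>+x. ennreal (\<bar>g x\<bar> powr p) \<partial>muD))
     + ennreal (2 powr p) * ((\<integral>\<^sup>+x. ennreal (\<bar>gap f x\<bar> powr p) \<partial>nuD) + (\<integral>\<^sup>+x. ennreal (\<bar>gap g x\<bar> powr p) \<partial>nuD))"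
    by (intro add_mono nn_integral_abs_powr_add[OF p0]) auto
  also have "\<dots> = ennreal (2 powr p) * (nrm f + nrm g)" by (simp add: nrm_def distrib_left add_ac)
  finally show ?thesis .
qed

lemma nrm_cmult:
  assumes [measurable]: "f \<in> borel_measurable lebesgue"
  shows "nrm (\<lambda>x. c * f x) = ennreal (\<bar>c\<bar> powr p) * nrm f"
proof -
  have "gap (\<lambda>x. c * f x) z = c * gap f z" for z by (simp add: gap_def right_diff_distrib)
  then show ?thesis unfolding nrm_def
    by (simp add: abs_mult powr_mult ennreal_mult nn_integral_cmult distrib_left)
qed

lemma test_fun_lebesgue: "test_fun \<Omega> \<phi> \<Longrightarrow> \<phi> \<in> borel_measurable lebesgue"
  using measurable_completion[of \<phi> lborel borel] test_fun_measurable[of \<Omega> \<phi>] by simp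

lemma W_iff: "W v \<longleftrightarrow> v \<in> borel_measurable lebesgue \<and> (\<forall>x. x \<notin> \<Omega> \<longrightarrow> v x = 0) \<and>
   (\<forall>e>0. \<exists>\<phi>. test_fun \<Omega> \<phi> \<and> nrm (\<lambda>x. v x - \<phi> x) \<le> ennreal e)"
proof (cases "v \<in> borel_measurable lebesgue")
  case True
  note [measurable] = True
  have n1: "(\<integral>\<^sup>+ x. indicator \<Omega> x * ennreal (\<bar>v x - \<phi> x\<bar> powr p) \<partial>\<mu>) = (\<integral>\<^sup>+x. ennreal (\<bar>v x - \<phi> x\<bar> powr p) \<partial>muD)"
    (is "?A1 \<phi> = ?A \<phi>") if "test_fun \<Omega> \<phi>" for \<phi>
  proof -
    note [measurable] = test_fun_lebesgue[OF that]
    show ?thesis by (subst nn_integral_muD) auto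
  qed
  have n2: "(\<integral>\<^sup>+ z. indicator (\<Omega> \<times> \<Omega>) z * ennreal (\<bar>(v (fst z) - \<phi> (fst z)) - (v (snd z) - \<phi> (snd z))\<bar> powr p) \<partial>\<nu>)
      = (\<integral>\<^sup>+z. ennreal (\<bar>gap v z - gap \<phi> z\<bar> powr p) \<partial>nuD)"
    (is "?B1 \<phi> = ?B \<phi>") if "test_fun \<Omega> \<phi>" for \<phi>
  proof -
    note [measurable] = test_fun_lebesgue[OF that]
    have "gap v z - gap \<phi> z = (v (fst z) - \<phi> (fst z)) - (v (snd z) - \<phi> (snd z))" for z by (simp add: gap_def)
    then show ?thesis by (subst nn_integral_nuD) auto
  qed
  have "(\<exists>\<phi>::nat \<Rightarrow> 'a \<Rightarrow> real. (\<forall>n. test_fun \<Omega> (\<phi> n)) \<and> (\<lambda>n. ?A1 (\<phi> n)) \<longlonglongrightarrow> 0 \<and> (\<lambda>n. ?B1 (\<phi> n)) \<longlonglongrightarrow> 0)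
      \<longleftrightarrow> (\<forall>e>0. \<exists>\<phi>. test_fun \<Omega> \<phi> \<and> nrm (\<lambda>x. v x - \<phi> x) \<le> ennreal e)" (is "?L \<longleftrightarrow> ?R")
  proof
    assume ?L
    then obtain \<phi> :: "nat \<Rightarrow> 'a \<Rightarrow> real" where
      \<phi>: "\<And>n. test_fun \<Omega> (\<phi> n)" "(\<lambda>n. ?A1 (\<phi> n)) \<longlonglongrightarrow> 0" "(\<lambda>n. ?B1 (\<phi> n)) \<longlonglongrightarrow> 0"
      by auto
    have "(\<lambda>n. ?A1 (\<phi> n) + ?B1 (\<phi> n)) \<longlonglongrightarrow> 0 + 0" by (intro tendsto_add \<phi>)
    then have lim: "(\<lambda>n. nrm (\<lambda>x. v x - \<phi> n x)) \<longlonglongrightarrow> 0" unfolding nrm_diff n1[OF \<phi>(1)] n2[OF \<phi>(1)] by simp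
    show ?R
    proof (intro allI impI)
      fix e :: real assume "0 < e"
      then have "\<forall>\<^sub>F n in sequentially. nrm (\<lambda>x. v x - \<phi> n x) < ennreal e"
        using lim by (intro order_tendstoD) auto
      then obtain n where "nrm (\<lambda>x. v x - \<phi> n x) < ennreal e" by (auto dest!: eventually_happens'[OF sequentially_bot])
      then show "\<exists>\<phi>. test_fun \<Omega> \<phi> \<and> nrm (\<lambda>x. v x - \<phi> x) \<le> ennreal e" using \<phi>(1)[of n] by (intro exI[of _ "\<phi> n"]) simp
    qed
  next
    assume R: ?R
    have "\<forall>n::nat. \<exists>\<phi>. test_fun \<Omega> \<phi> \<and> nrm (\<lambda>x. v x - \<phi> x) \<le> ennreal (1 / real (Suc n))"
      using R by simp
    then obtain \<phi> where \<phi>: "\<And>n::nat. test_fun \<Omega> (\<phi> n)" "\<And>n. nrm (\<lambda>x. v x - \<phi> n x) \<le> ennreal (1 / real (Suc n))"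
      by metis
    have z: "(\<lambda>n. ennreal (1 / real (Suc n))) \<longlonglongrightarrow> 0"
      using tendsto_ennrealI[OF LIMSEQ_inverse_real_of_nat] by (simp add: inverse_eq_divide)
    have "?A (\<phi> n) \<le> ennreal (1 / real (Suc n))" "?B (\<phi> n) \<le> ennreal (1 / real (Suc n))" for n
      using \<phi>(2)[of n] unfolding nrm_diff by (auto dest: ennreal_add_leD)
    then have "(\<lambda>n. ?A (\<phi> n)) \<longlonglongrightarrow> 0" "(\<lambda>n. ?B (\<phi> n)) \<longlonglongrightarrow> 0"
      by (auto intro: tendsto_sandwich[OF _ _ tendsto_const z])
    then show ?L using n1 n2 \<phi>(1) by (intro exI[of _ \<phi>]) simp
  qed
  then show ?thesis unfolding W_space_def using True by simp
qed (simp add: W_space_def)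

lemma W_measurable: "W v \<Longrightarrow> v \<in> borel_measurable lebesgue"
  by (simp add: W_iff)

lemma W_outside: "W v \<Longrightarrow> x \<notin> \<Omega> \<Longrightarrow> v x = 0"
  by (simp add: W_iff)

lemma W_test: "test_fun \<Omega> \<phi> \<Longrightarrow> W \<phi>"
  unfolding W_iff using test_fun_lebesgue test_fun_outside
  by (auto intro!: exI[of _ \<phi>] simp: nrm_def gap_def)

lemma W_approx:
  assumes v: "v \<in> borel_measurable lebesgue" "\<And>x. x \<notin> \<Omega> \<Longrightarrow> v x = 0"
    and ap: "\<And>e. 0 < e \<Longrightarrow> \<exists>u. W u \<and> nrm (\<lambda>x. v x - u x) \<le> ennreal e"
  shows "W v"
  unfolding W_iff
proof (intro conjI allI impI)
  fix e :: real assume "0 < e"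
  define d where "d = e / (2 * 2 powr p)"
  have d: "0 < d" using \<open>0 < e\<close> by (simp add: d_def)
  obtain u where u: "W u" "nrm (\<lambda>x. v x - u x) \<le> ennreal d" using ap[OF d] by blast
  obtain \<phi> where \<phi>: "test_fun \<Omega> \<phi>" "nrm (\<lambda>x. u x - \<phi> x) \<le> ennreal d"
    using u(1) d unfolding W_iff by metis
  have "nrm (\<lambda>x. v x - \<phi> x) = nrm (\<lambda>x. (v x - u x) + (u x - \<phi> x))" by simp
  also have "\<dots> \<le> ennreal (2 powr p) * (nrm (\<lambda>x. v x - u x) + nrm (\<lambda>x. u x - \<phi> x))"
    using v u(1) test_fun_lebesgue[OF \<phi>(1)] W_measurable by (intro nrm_add) auto
  also have "\<dots> \<le> ennreal (2 powr p) * (ennreal d + ennreal d)"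
    by (intro mult_left_mono add_mono u \<phi>) auto
  also have "\<dots> = ennreal e"
    using d by (simp add: ennreal_plus[symmetric] ennreal_mult[symmetric] d_def del: ennreal_plus)
  finally show "\<exists>\<phi>. test_fun \<Omega> \<phi> \<and> nrm (\<lambda>x. v x - \<phi> x) \<le> ennreal e" using \<phi>(1) by blast
qed (use v in auto)

lemma W_cmult: assumes "W v" shows "W (\<lambda>x. c * v x)"
proof (cases "c = 0")
  case True then show ?thesis using W_test[OF test_fun_zero] by simp
next
  case False
  show ?thesis unfolding W_iff
  proof (intro conjI allI impI)
    fix e :: real assume "0 < e"
    define d where "d = e / \<bar>c\<bar> powr p"
    have d: "0 < d" using \<open>0 < e\<close> False by (simp add: d_def)
    obtain \<phi> where \<phi>: "test_fun \<Omega> \<phi>" "nrm (\<lambda>x. v x - \<phi> x) \<le> ennreal d"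
      using assms d unfolding W_iff by metis
    have "nrm (\<lambda>x. c * v x - c * \<phi> x) = ennreal (\<bar>c\<bar> powr p) * nrm (\<lambda>x. v x - \<phi> x)"
      using nrm_cmult[of "\<lambda>x. v x - \<phi> x" c] W_measurable[OF assms] test_fun_lebesgue[OF \<phi>(1)]
      by (simp add: right_diff_distrib)
    also have "\<dots> \<le> ennreal (\<bar>c\<bar> powr p) * ennreal d" by (intro mult_left_mono \<phi>) auto
    also have "\<dots> = ennreal e" using d False by (simp add: ennreal_mult[symmetric] d_def)
    finally show "\<exists>\<phi>. test_fun \<Omega> \<phi> \<and> nrm (\<lambda>x. c * v x - \<phi> x) \<le> ennreal e"
      using test_fun_cmult[OF \<phi>(1), of c] by blast
  qed (use assms in \<open>auto simp: W_iff\<close>)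
qed

lemma W_add: assumes "W u" "W v" shows "W (\<lambda>x. u x + v x)"
  unfolding W_iff
proof (intro conjI allI impI)
  fix e :: real assume "0 < e"
  define d where "d = e / (2 * 2 powr p)"
  have d: "0 < d" using \<open>0 < e\<close> by (simp add: d_def)
  obtain \<phi> where \<phi>: "test_fun \<Omega> \<phi>" "nrm (\<lambda>x. u x - \<phi> x) \<le> ennreal d"
    using assms(1) d unfolding W_iff by metis
  obtain \<psi> where \<psi>: "test_fun \<Omega> \<psi>" "nrm (\<lambda>x. v x - \<psi> x) \<le> ennreal d"
    using assms(2) d unfolding W_iff by metis
  have "nrm (\<lambda>x. (u x + v x) - (\<phi> x + \<psi> x)) = nrm (\<lambda>x. (u x - \<phi> x) + (v x - \<psi> x))"
    by (simp add: algebra_simps)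
  also have "\<dots> \<le> ennreal (2 powr p) * (nrm (\<lambda>x. u x - \<phi> x) + nrm (\<lambda>x. v x - \<psi> x))"
    using assms test_fun_lebesgue[OF \<phi>(1)] test_fun_lebesgue[OF \<psi>(1)] W_measurable by (intro nrm_add) auto
  also have "\<dots> \<le> ennreal (2 powr p) * (ennreal d + ennreal d)"
    by (intro mult_left_mono add_mono \<phi> \<psi>) auto
  also have "\<dots> = ennreal e"
    using d by (simp add: ennreal_plus[symmetric] ennreal_mult[symmetric] d_def del: ennreal_plus)
  finally show "\<exists>\<phi>. test_fun \<Omega> \<phi> \<and> nrm (\<lambda>x. u x + v x - \<phi> x) \<le> ennreal e"
    using test_fun_add[OF \<phi>(1) \<psi>(1)] by blast
qed (use assms in \<open>auto simp: W_iff\<close>)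

lemma W_diff: "W u \<Longrightarrow> W v \<Longrightarrow> W (\<lambda>x. u x - v x)"
  using W_add[of u "\<lambda>x. (-1) * v x"] W_cmult[of v "-1"] by simp

text \<open>A test function at distance at most 1 has finite energy by
  \<open>test_fun_energy\<close>. The conclusion stops at \<open>nuD\<close>, since the norm gives
  no information on pairs that leave \<Omega>.\<close>

lemma W_energy:
  assumes "W v" shows "integrable nuD (\<lambda>z. \<bar>gap v z\<bar> powr p)"
proof -
  have "(0::real) < 1" by simp
  then obtain \<phi> where \<phi>: "test_fun \<Omega> \<phi>" "nrm (\<lambda>x. v x - \<phi> x) \<le> ennreal 1"
    using assms unfolding W_iff by metis
  note [measurable] = W_measurable[OF assms] test_fun_lebesgue[OF \<phi>(1)]
  have "(\<integral>\<^sup>+z. ennreal (\<bar>gap v z - gap \<phi> z\<bar> powr p) \<partial>nuD) \<le> 1"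
    using \<phi>(2) unfolding nrm_diff by (auto dest: ennreal_add_leD)
  then have "integrable nuD (\<lambda>z. \<bar>gap v z - gap \<phi> z\<bar> powr p)"
    by (intro integrableI_nonneg) (auto intro: le_less_trans)
  moreover have "integrable nuD (\<lambda>z. \<bar>gap \<phi> z\<bar> powr p)"
    by (rule integrable_nuD[OF _ test_fun_energy[OF \<phi>(1)]]) measurable
  ultimately have "integrable nuD (\<lambda>z. \<bar>(gap v z - gap \<phi> z) + gap \<phi> z\<bar> powr p)"
    by (intro integrable_abs_powr_add[OF p0]) auto
  then show ?thesis by simp
qed

text \<open>The closure is also closed under limits in the weighted \<open>L\<^sup>p\<close> norm of sequences of bounded energy
  (Mazur's lemma): almost energy-minimising elements of the midpoint hulls of the tails form a
  Cauchy sequence, by uniform convexity.\<close>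

lemma W_weak_closure:
  assumes W: "\<And>n. W (vs n)" and v: "v \<in> borel_measurable lebesgue" "\<And>x. x \<notin> \<Omega> \<Longrightarrow> v x = 0"
    and lim: "(\<lambda>n. \<integral>\<^sup>+x. ennreal (\<bar>vs n x - v x\<bar> powr p) \<partial>muD) \<longlonglongrightarrow> 0"
    and bd: "\<And>n. (\<integral>z. \<bar>gap (vs n) z\<bar> powr p \<partial>nuD) \<le> C"
  shows "W v"
proof -
  define E where "E c = (\<integral>z. \<bar>gap c z\<bar> powr p \<partial>nuD)" for c
  note [measurable] = v(1)
  have E0: "0 \<le> E c" for c unfolding E_def by simp
  have gmid: "gap (\<lambda>x. (a x + b x) / 2) z = (gap a z + gap b z) / 2" for a b :: "'a \<Rightarrow> real" and z
    by (simp add: gap_def field_simps)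
  have W_mid: "W (\<lambda>x. (a x + b x) / 2)" if "W a" "W b" for a b
    using W_cmult[OF W_add[OF that], of "1/2"] by simp
  have hull: "W c \<and> E c \<le> C" if "midpoint_hull vs n c" for n c
    using that
  proof induction
    case (mid a b)
    have i: "integrable nuD (\<lambda>z. (\<bar>gap a z\<bar> powr p + \<bar>gap b z\<bar> powr p) / 2)"
      using W_energy mid.IH by auto
    have "E (\<lambda>x. (a x + b x) / 2) \<le> (\<integral>z. (\<bar>gap a z\<bar> powr p + \<bar>gap b z\<bar> powr p) / 2 \<partial>nuD)"
      unfolding E_def using W_energy[OF W_mid[of a b]] mid.IH i abs_powr_midpoint[OF p(1)]
      by (intro integral_mono) (auto simp: gmid)
    also have "\<dots> = (E a + E b) / 2" unfolding E_def using W_energy mid.IH by simp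
    finally show ?case using mid.IH W_mid by auto
  qed (use W bd in \<open>auto simp: E_def\<close>)
  define A where "A c = (\<integral>\<^sup>+x. ennreal (\<bar>c x - v x\<bar> powr p) \<partial>muD)" for c
  \<comment> \<open>\<open>A\<close> is convex in \<open>c\<close>, so a bound for the tail passes
    to its hull: convergence to \<open>v\<close> survives the replacement of the sequence by
    elements of the hulls.\<close>
  have hullA: "A c \<le> ennreal e" if "midpoint_hull vs n c" "\<And>k. n \<le> k \<Longrightarrow> A (vs k) \<le> ennreal e" "0 \<le> e" for n c e
    using that(1)
  proof induction
    case (mid a b)
    note [measurable] = hull[THEN conjunct1, THEN W_measurable, OF mid.hyps(1)] hull[THEN conjunct1, THEN W_measurable, OF mid.hyps(2)]
    have "A (\<lambda>x. (a x + b x) / 2) \<le> (\<integral>\<^sup>+x. ennreal (1/2) * (ennreal (\<bar>a x - v x\<bar> powr p) + ennreal (\<bar>b x - v x\<bar> powr p)) \<partial>muD)"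
      unfolding A_def
    proof (rule nn_integral_mono)
      fix x
      have eq: "(a x + b x) / 2 - v x = ((a x - v x) + (b x - v x)) / 2" by (simp add: field_simps)
      have "\<bar>(a x + b x) / 2 - v x\<bar> powr p \<le> (\<bar>a x - v x\<bar> powr p + \<bar>b x - v x\<bar> powr p) / 2"
        unfolding eq by (rule abs_powr_midpoint[OF p(1)])
      then have "ennreal (\<bar>(a x + b x) / 2 - v x\<bar> powr p) \<le> ennreal (1/2 * (\<bar>a x - v x\<bar> powr p + \<bar>b x - v x\<bar> powr p))"
        by (intro ennreal_leI) simp
      also have "\<dots> = ennreal (1/2) * (ennreal (\<bar>a x - v x\<bar> powr p) + ennreal (\<bar>b x - v x\<bar> powr p))"
        by (subst ennreal_mult) (auto simp: ennreal_plus)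
      finally show "ennreal (\<bar>(a x + b x) / 2 - v x\<bar> powr p) \<le> ennreal (1/2) * (ennreal (\<bar>a x - v x\<bar> powr p) + ennreal (\<bar>b x - v x\<bar> powr p))" .
    qed
    also have "\<dots> = ennreal (1/2) * (A a + A b)"
      unfolding A_def by (simp add: nn_integral_cmult nn_integral_add)
    also have "\<dots> \<le> ennreal (1/2) * (ennreal e + ennreal e)"
      by (intro mult_left_mono add_mono mid.IH) auto
    also have "\<dots> = ennreal (1/2 * (e + e))"
    proof -
      have "0 \<le> (1/2 :: real)" "0 \<le> e + e" using that(3) by auto
      then show ?thesis by (simp only: ennreal_mult ennreal_plus[OF that(3) that(3)])
    qed
    also have "\<dots> = ennreal e" by simp
    finally show ?case .
  qed (use that(2) in auto)
  \<comment> \<open>The hulls shrink with \<open>n\<close>, so \<open>I\<close> increases, and it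
    converges because it is bounded by \<open>C\<close>. Near-minimisers \<open>c m\<close> and
    \<open>c n\<close> with \<open>m, n \<ge> N\<close> have a midpoint in the hull of the tail from
    \<open>N\<close>, whose energy is at least \<open>I N\<close>; as \<open>I N\<close> approaches
    the limit, the midpoint defect becomes small.\<close>
  define I where "I n = Inf {E c |c. midpoint_hull vs n c}" for n
  have bb: "bdd_below {E c |c. midpoint_hull vs n c}" for n
    by (rule bdd_belowI[of _ 0]) (use E0 in auto)
  have ne: "{E c |c. midpoint_hull vs n c} \<noteq> {}" for n
    using midpoint_hull.base[of n n vs] by blast
  have I_le: "I n \<le> E c" if "midpoint_hull vs n c" for n c
    unfolding I_def by (rule cInf_lower[OF _ bb]) (use that in auto)
  have I_mono: "I m \<le> I n" if "m \<le> n" for m n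
    unfolding I_def by (rule cInf_superset_mono[OF ne bb]) (use midpoint_hull_mono[OF _ that] in blast)
  have I_C: "I n \<le> C" for n
    using I_le[OF midpoint_hull.base[of n n vs]] hull[OF midpoint_hull.base[of n n vs]] by simp
  obtain l where l: "I \<longlonglongrightarrow> l" "\<And>n. I n \<le> l"
    using incseq_convergent[of I C] I_mono I_C by (auto simp: incseq_def)
  have "\<exists>c. midpoint_hull vs n c \<and> E c < I n + 1 / real (Suc n)" for n
    using cInf_lessD[OF ne, of n "I n + 1 / real (Suc n)"] unfolding I_def by auto
  then obtain c where c: "\<And>n. midpoint_hull vs n (c n)" "\<And>n. E (c n) < I n + 1 / real (Suc n)" by metis
  have Wc: "W (c n)" for n using hull c(1) by blast
  note [measurable] = W_measurable[OF Wc]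
  have defect: "\<exists>N. \<forall>m\<ge>N. \<forall>n\<ge>N. (E (c m) + E (c n)) / 2 - (\<integral>z. \<bar>(gap (c m) z + gap (c n) z) / 2\<bar> powr p \<partial>nuD) < d"
    if "0 < d" for d
  proof -
    have "(\<lambda>n. l - I n + 1 / real (Suc n)) \<longlonglongrightarrow> l - l + 0"
      by (intro tendsto_add tendsto_diff tendsto_const l(1)) (use LIMSEQ_inverse_real_of_nat in \<open>simp add: inverse_eq_divide\<close>)
    then have "\<forall>\<^sub>F n in sequentially. l - I n + 1 / real (Suc n) < d"
      using that by (intro order_tendstoD) auto
    then obtain N where N: "l - I N + 1 / real (Suc N) < d" by (auto dest!: eventually_happens'[OF sequentially_bot])
    have "(E (c m) + E (c n)) / 2 - (\<integral>z. \<bar>(gap (c m) z + gap (c n) z) / 2\<bar> powr p \<partial>nuD) < d" if "m \<ge> N" "n \<ge> N" for m n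
    proof -
      have "midpoint_hull vs N (\<lambda>x. (c m x + c n x) / 2)"
        using c(1) that by (intro midpoint_hull.mid) (auto intro: midpoint_hull_mono)
      from I_le[OF this] have IN: "I N \<le> (\<integral>z. \<bar>(gap (c m) z + gap (c n) z) / 2\<bar> powr p \<partial>nuD)"
        by (simp add: E_def gmid)
      have Ek: "E (c k) < l + 1 / real (Suc N)" if "k \<ge> N" for k
      proof -
        have "1 / real (Suc k) \<le> 1 / real (Suc N)" using that by (intro divide_left_mono) auto
        then show ?thesis using c(2)[of k] l(2)[of k] by linarith
      qed
      have "(x + y) / 2 - J < d" if "l - i + t < d" "i \<le> J" "x < l + t" "y < l + t" for x y i t J :: real
        using that by (simp add: field_simps)
      from this[OF N IN Ek[OF \<open>m \<ge> N\<close>] Ek[OF \<open>n \<ge> N\<close>]] show ?thesis .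
    qed
    then show ?thesis by blast
  qed
  have cauchy: "\<exists>N. \<forall>m\<ge>N. \<forall>n\<ge>N. (\<integral>z. \<bar>gap (c m) z - gap (c n) z\<bar> powr p \<partial>nuD) < d" if "0 < d" for d
    by (rule uniformly_convex_imp_Cauchy[where a="\<lambda>n. gap (c n)", OF p(1) _ W_energy[OF Wc] _ _ that, of C])
       (use defect hull[OF c(1)] in \<open>auto simp: E_def\<close>)
  have Alim: "\<forall>\<^sub>F n in sequentially. A (c n) \<le> ennreal e" if "0 < e" for e
  proof -
    have "\<forall>\<^sub>F n in sequentially. A (vs n) < ennreal e"
      using lim that unfolding A_def by (intro order_tendstoD) auto
    then obtain N where "\<And>k. N \<le> k \<Longrightarrow> A (vs k) \<le> ennreal e"
      unfolding eventually_sequentially by (auto intro: less_imp_le)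
    then have "A (c n) \<le> ennreal e" if "n \<ge> N" for n
      using hullA[OF c(1)[of n]] that \<open>0 < e\<close> by auto
    then show ?thesis unfolding eventually_sequentially by blast
  qed
  have "(\<lambda>n. A (c n)) \<longlonglongrightarrow> 0"
  proof (rule order_tendstoI)
    fix y :: ennreal assume "0 < y"
    obtain e where "0 < e" "ennreal e < y"
    proof (cases y)
      case (real r)
      then show ?thesis using that[of "r / 2"] \<open>0 < y\<close> by (simp add: ennreal_less_iff)
    next
      case top
      then show ?thesis using that[of 1] by simp
    qed
    then show "\<forall>\<^sub>F n in sequentially. A (c n) < y"
      using Alim[of e] by (auto elim!: eventually_mono intro: le_less_trans)
  qed simp
  then obtain r where r: "strict_mono r" "AE x in muD. (\<lambda>n. ennreal (\<bar>c (r n) x - v x\<bar> powr p)) \<longlonglongrightarrow> 0"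
    unfolding A_def by (rule nn_integral_tendsto_0_AE_subseq[rotated]) auto
  have "AE x in lebesgue. (\<lambda>n. c (r n) x) \<longlonglongrightarrow> v x"
    using r(2) unfolding AE_muD_iff
  proof eventually_elim
    case (elim x)
    show ?case
    proof (cases "x \<in> \<Omega>")
      case True
      then have "(\<lambda>n. \<bar>c (r n) x - v x\<bar> powr p) \<longlonglongrightarrow> 0"
        using elim tendsto_ennreal_iff[of "\<lambda>n. \<bar>c (r n) x - v x\<bar> powr p" sequentially 0] by simp
      then have "(\<lambda>n. (\<bar>c (r n) x - v x\<bar> powr p) powr (1 / p)) \<longlonglongrightarrow> 0 powr (1 / p)"
        using p0 by (intro tendsto_powr' tendsto_const) auto
      then have "(\<lambda>n. \<bar>c (r n) x - v x\<bar>) \<longlonglongrightarrow> 0" using p0 by (simp add: powr_powr)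
      then show ?thesis by (simp add: LIM_zero_iff tendsto_rabs_zero_iff)
    next
      case False
      then show ?thesis using W_outside[OF Wc] v(2) by simp
    qed
  qed
  from AE_nu_pair[OF this] have "AE z in \<nu>. (\<lambda>n. gap (c (r n)) z) \<longlonglongrightarrow> gap v z"
    by eventually_elim (auto simp: gap_def intro: tendsto_diff)
  then have ae: "AE z in nuD. (\<lambda>n. gap (c (r n)) z) \<longlonglongrightarrow> gap v z" by (rule AE_nuD)
  show ?thesis
  proof (rule W_approx[OF v])
    fix e :: real assume "0 < e"
    then have e2: "0 < e / 2" by simp
    obtain N where N: "\<And>n. n \<ge> N \<Longrightarrow> (\<integral>\<^sup>+z. ennreal (\<bar>gap (c n) z - gap v z\<bar> powr p) \<partial>nuD) \<le> ennreal (e / 2)"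
      using Cauchy_AE_limit(2)[where a="\<lambda>n. gap (c n)", OF p(1) _ _ W_energy[OF Wc] cauchy r(1) ae e2] by auto
    obtain N' where N': "\<And>n. n \<ge> N' \<Longrightarrow> A (c n) \<le> ennreal (e / 2)"
      using Alim[OF e2] unfolding eventually_sequentially by blast
    define n where "n = max N N'"
    have "nrm (\<lambda>x. v x - c n x) = A (c n) + (\<integral>\<^sup>+z. ennreal (\<bar>gap (c n) z - gap v z\<bar> powr p) \<partial>nuD)"
      unfolding nrm_diff A_def by (simp add: abs_minus_commute)
    also have "\<dots> \<le> ennreal (e / 2) + ennreal (e / 2)"
      by (intro add_mono N N') (auto simp: n_def)
    also have "\<dots> = ennreal e" using \<open>0 < e\<close> by (simp add: ennreal_plus[symmetric] del: ennreal_plus)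
    finally show "\<exists>u. W u \<and> nrm (\<lambda>x. v x - u x) \<le> ennreal e" using Wc by blast
  qed
qed

section \<open>Truncations and lattice operations in the closure\<close>

lemma gap_lipschitz_comp:
  assumes "\<And>a b. \<bar>h a - h b\<bar> \<le> \<bar>a - b\<bar>" shows "\<bar>gap (\<lambda>x. h (v x)) z\<bar> \<le> \<bar>gap v z\<bar>"
  using assms by (simp add: gap_def)

text \<open>The smoothed absolute values of approximating test functions have bounded energy and
  converge in the weighted \<open>L\<^sup>p\<close> norm. Their convergence in energy is not
  evident, which is why the closure under bounded energy is used. Subtracting
  \<open>\<bar>a\<bar>\<close> gives the value 0 outside \<Omega>; the shift \<open>a\<close> is
  what yields truncations, each a combination of two such functions.\<close>

lemma W_abs_shift:
  assumes "W v" shows "W (\<lambda>x. \<bar>v x - a\<bar> - \<bar>a\<bar>)"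
proof -
  have "\<forall>n::nat. \<exists>\<phi>. test_fun \<Omega> \<phi> \<and> nrm (\<lambda>x. v x - \<phi> x) \<le> ennreal (1 / real (Suc n))"
    using assms unfolding W_iff by simp
  then obtain \<phi> where \<phi>: "\<And>n::nat. test_fun \<Omega> (\<phi> n)" "\<And>n. nrm (\<lambda>x. v x - \<phi> n x) \<le> ennreal (1 / real (Suc n))"
    by metis
  define e where "e n = 1 / real (Suc n)" for n
  have e: "0 < e n" for n by (simp add: e_def)
  have e_lim: "e \<longlonglongrightarrow> 0" unfolding e_def using LIMSEQ_inverse_real_of_nat by (simp add: inverse_eq_divide)
  define vs where "vs n x = sqrt ((\<phi> n x - a)\<^sup>2 + (e n)\<^sup>2) - sqrt (a\<^sup>2 + (e n)\<^sup>2)" for n x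
  have tv: "test_fun \<Omega> (vs n)" for n unfolding vs_def by (rule test_fun_smooth_abs[OF \<phi>(1) e])
  note [measurable] = W_measurable[OF assms] test_fun_lebesgue[OF \<phi>(1)] test_fun_lebesgue[OF tv]
  have n1: "(\<integral>\<^sup>+x. ennreal (\<bar>v x - \<phi> n x\<bar> powr p) \<partial>muD) \<le> ennreal (e n)"
    and n2: "(\<integral>\<^sup>+z. ennreal (\<bar>gap v z - gap (\<phi> n) z\<bar> powr p) \<partial>nuD) \<le> ennreal (e n)" for n
    using \<phi>(2)[of n] unfolding nrm_diff e_def[symmetric] by (auto dest: ennreal_add_leD)
  show ?thesis
  proof (rule W_weak_closure[where vs=vs and C="2 powr p * ((\<integral>z. \<bar>gap v z\<bar> powr p \<partial>nuD) + 1)"])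
    show "W (vs n)" for n by (rule W_test[OF tv])
    show "\<bar>v x - a\<bar> - \<bar>a\<bar> = 0" if "x \<notin> \<Omega>" for x using W_outside[OF assms that] by simp
    show "(\<lambda>n. \<integral>\<^sup>+x. ennreal (\<bar>vs n x - (\<bar>v x - a\<bar> - \<bar>a\<bar>)\<bar> powr p) \<partial>muD) \<longlonglongrightarrow> 0"
    proof (rule tendsto_sandwich[OF _ _ tendsto_const])
      define M where "M = emeasure muD UNIV"
      have M: "M < \<infinity>" using emeasure_muD_UNIV by (simp add: M_def)
      have pt: "\<bar>vs n x - (\<bar>v x - a\<bar> - \<bar>a\<bar>)\<bar> \<le> \<bar>v x - \<phi> n x\<bar> + 2 * e n" for n x
      proof -
        have "\<bar>sqrt ((\<phi> n x - a)\<^sup>2 + (e n)\<^sup>2) - \<bar>\<phi> n x - a\<bar>\<bar> \<le> e n" "\<bar>sqrt (a\<^sup>2 + (e n)\<^sup>2) - \<bar>a\<bar>\<bar> \<le> e n"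
          using e[of n] sqrt_shift_approx[of "e n" "\<phi> n x - a"] sqrt_shift_approx[of "e n" a] by linarith+
        then show ?thesis unfolding vs_def by linarith
      qed
      have "(\<integral>\<^sup>+x. ennreal (\<bar>vs n x - (\<bar>v x - a\<bar> - \<bar>a\<bar>)\<bar> powr p) \<partial>muD) \<le> ennreal (2 powr p) * (ennreal (e n) + ennreal ((2 * e n) powr p) * M)" for n
      proof -
        have "(\<integral>\<^sup>+x. ennreal (\<bar>vs n x - (\<bar>v x - a\<bar> - \<bar>a\<bar>)\<bar> powr p) \<partial>muD)
           \<le> (\<integral>\<^sup>+x. ennreal (\<bar>\<bar>v x - \<phi> n x\<bar> + 2 * e n\<bar> powr p) \<partial>muD)"
          using pt e[of n] by (intro nn_integral_mono ennreal_leI abs_powr_mono) (auto simp: p0 less_imp_le)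
        also have "\<dots> \<le> ennreal (2 powr p) * ((\<integral>\<^sup>+x. ennreal (\<bar>\<bar>v x - \<phi> n x\<bar>\<bar> powr p) \<partial>muD) + (\<integral>\<^sup>+x. ennreal (\<bar>2 * e n\<bar> powr p) \<partial>muD))"
          by (rule nn_integral_abs_powr_add[OF p0]) auto
        also have "(\<integral>\<^sup>+x. ennreal (\<bar>2 * e n\<bar> powr p) \<partial>muD) = ennreal ((2 * e n) powr p) * M"
          using e[of n] by (simp add: M_def space_muD)
        also have "(\<integral>\<^sup>+x. ennreal (\<bar>\<bar>v x - \<phi> n x\<bar>\<bar> powr p) \<partial>muD) \<le> ennreal (e n)" using n1[of n] by simp
        finally show ?thesis by (simp add: mult_left_mono add_right_mono)
      qed
      then show "\<forall>\<^sub>F n in sequentially. (\<integral>\<^sup>+x. ennreal (\<bar>vs n x - (\<bar>v x - a\<bar> - \<bar>a\<bar>)\<bar> powr p) \<partial>muD)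
         \<le> ennreal (2 powr p) * (ennreal (e n) + ennreal ((2 * e n) powr p) * M)" by simp
      have "(\<lambda>n. (2 * e n) powr p) \<longlonglongrightarrow> (2 * 0) powr p"
        using p0 e by (intro tendsto_powr' tendsto_mult tendsto_const e_lim) (auto simp: less_imp_le)
      then have "(\<lambda>n. ennreal (2 powr p) * (ennreal (e n) + ennreal ((2 * e n) powr p) * M)) \<longlonglongrightarrow> ennreal (2 powr p) * (ennreal 0 + ennreal ((2 * 0) powr p) * M)"
        using M by (intro ennreal_tendsto_cmult tendsto_add tendsto_ennrealI e_lim tendsto_mult_ennreal tendsto_const) auto
      then show "(\<lambda>n. ennreal (2 powr p) * (ennreal (e n) + ennreal ((2 * e n) powr p) * M)) \<longlonglongrightarrow> 0" by simp
    qed simp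
    show "(\<integral>z. \<bar>gap (vs n) z\<bar> powr p \<partial>nuD) \<le> 2 powr p * ((\<integral>z. \<bar>gap v z\<bar> powr p \<partial>nuD) + 1)" for n
    proof -
      have ie: "integrable nuD (\<lambda>z. \<bar>gap v z - gap (\<phi> n) z\<bar> powr p)"
        using W_energy[OF W_diff[OF assms W_test[OF \<phi>(1)[of n]]]] by (simp add: gap_def algebra_simps)
      have "ennreal (\<integral>z. \<bar>gap v z - gap (\<phi> n) z\<bar> powr p \<partial>nuD) \<le> ennreal (e n)"
        using n2[of n] nn_integral_eq_integral[OF ie] by simp
      then have le1: "(\<integral>z. \<bar>gap v z - gap (\<phi> n) z\<bar> powr p \<partial>nuD) \<le> 1"
        using e[of n] by (simp add: e_def) (smt (verit) divide_le_eq_1 of_nat_0_le_iff)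
      have "\<bar>gap (vs n) z\<bar> \<le> \<bar>gap (\<phi> n) z\<bar>" for z
        unfolding vs_def gap_def using sqrt_shift_lipschitz[of "\<phi> n (fst z) - a" "e n" "\<phi> n (snd z) - a"] by simp
      then have "(\<integral>z. \<bar>gap (vs n) z\<bar> powr p \<partial>nuD) \<le> (\<integral>z. 2 powr p * (\<bar>gap v z\<bar> powr p + \<bar>gap v z - gap (\<phi> n) z\<bar> powr p) \<partial>nuD)"
      proof (intro integral_mono)
        fix z
        have "\<bar>gap (vs n) z\<bar> powr p \<le> \<bar>gap (\<phi> n) z\<bar> powr p" using \<open>\<And>z. \<bar>gap (vs n) z\<bar> \<le> _ z\<close> p0 by (simp add: abs_powr_mono)
        also have "\<dots> \<le> 2 powr p * (\<bar>gap v z\<bar> powr p + \<bar>gap v z - gap (\<phi> n) z\<bar> powr p)"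
          using abs_powr_diff_le[OF p0, of "gap v z" "gap v z - gap (\<phi> n) z"] by simp
        finally show "\<bar>gap (vs n) z\<bar> powr p \<le> 2 powr p * (\<bar>gap v z\<bar> powr p + \<bar>gap v z - gap (\<phi> n) z\<bar> powr p)" .
      qed (use W_energy[OF W_test[OF tv]] W_energy[OF assms] ie in auto)
      also have "\<dots> = 2 powr p * ((\<integral>z. \<bar>gap v z\<bar> powr p \<partial>nuD) + (\<integral>z. \<bar>gap v z - gap (\<phi> n) z\<bar> powr p \<partial>nuD))"
        using W_energy[OF assms] ie by simp
      also have "\<dots> \<le> 2 powr p * ((\<integral>z. \<bar>gap v z\<bar> powr p \<partial>nuD) + 1)" using le1 by simp
      finally show ?thesis .
    qed
  qed measurable
qed

lemma W_abs: "W v \<Longrightarrow> W (\<lambda>x. \<bar>v x\<bar>)"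
  using W_abs_shift[of v 0] by simp

lemma W_trunc: assumes "W v" "0 \<le> k" shows "W (\<lambda>x. trunc k (v x))"
proof -
  have "W (\<lambda>x. 1/2 * ((\<bar>v x - (- k)\<bar> - \<bar>- k\<bar>) - (\<bar>v x - k\<bar> - \<bar>k\<bar>)))"
    by (intro W_cmult W_diff W_abs_shift assms)
  moreover have "1/2 * ((\<bar>v x - (- k)\<bar> - \<bar>- k\<bar>) - (\<bar>v x - k\<bar> - \<bar>k\<bar>)) = trunc k (v x)" for x
    using assms(2) by (auto simp: trunc_def max_def min_def)
  ultimately show ?thesis by simp
qed

lemma W_max: assumes "W u" "W v" shows "W (\<lambda>x. max (u x) (v x))"
proof -
  have "W (\<lambda>x. 1/2 * ((u x + v x) + \<bar>u x - v x\<bar>))"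
    by (intro W_cmult W_add W_abs W_diff assms)
  moreover have "1/2 * ((u x + v x) + \<bar>u x - v x\<bar>) = max (u x) (v x)" for x by (simp add: max_def)
  ultimately show ?thesis by simp
qed

lemma W_min: assumes "W u" "W v" shows "W (\<lambda>x. min (u x) (v x))"
proof -
  have "W (\<lambda>x. (u x + v x) - max (u x) (v x))" by (intro W_diff W_add W_max assms)
  moreover have "(u x + v x) - max (u x) (v x) = min (u x) (v x)" for x by (simp add: max_def min_def)
  ultimately show ?thesis by simp
qed

end

section \<open>The obstacle problem\<close>

text \<open>Dividing the p-th powers by \<open>q k\<close> before summing turns decay of the
  integrals into the pointwise bound \<open>(1/2) ^ k\<close> for all late increments, which makes
  the telescoping series converge a.e.\<close>

lemma Cauchy_powr_AE_subseq:
  fixes a :: "nat \<Rightarrow> 'b \<Rightarrow> real"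
  assumes p: "0 < p" and [measurable]: "\<And>n. a n \<in> borel_measurable M"
    and cauchy: "\<And>d. 0 < d \<Longrightarrow> \<exists>N. \<forall>m\<ge>N. \<forall>n\<ge>N. (\<integral>\<^sup>+x. ennreal (\<bar>a m x - a n x\<bar> powr p) \<partial>M) \<le> ennreal d"
  obtains r where "strict_mono r" "AE x in M. convergent (\<lambda>k. a (r k) x)"
proof -
  define q where "q k = ((1/2) ^ k) powr p" for k :: nat
  have q: "0 < q k" for k by (simp add: q_def)
  have "\<exists>N. \<forall>m\<ge>N. \<forall>n\<ge>N. (\<integral>\<^sup>+x. ennreal (\<bar>a m x - a n x\<bar> powr p) \<partial>M) \<le> ennreal ((1/2) ^ k * q k)" for k
    by (rule cauchy) (simp add: q)
  then obtain N where N: "\<And>k m n. N k \<le> m \<Longrightarrow> N k \<le> n \<Longrightarrow>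
      (\<integral>\<^sup>+x. ennreal (\<bar>a m x - a n x\<bar> powr p) \<partial>M) \<le> ennreal ((1/2) ^ k * q k)" by metis
  \<comment> \<open>The sum dominates every \<open>N j\<close> with \<open>j \<le> k\<close>, and
    the summand \<open>k\<close> makes the sequence strictly increasing.\<close>
  define r where "r k = (\<Sum>j\<le>k. N j) + k" for k
  have r: "strict_mono r" by (simp add: strict_mono_Suc_iff r_def)
  have Nr: "N k \<le> r k" "N k \<le> r (Suc k)" for k
    using member_le_sum[of k "{..k}" N] by (auto simp: r_def)
  define g where "g k x = ennreal (\<bar>a (r (Suc k)) x - a (r k) x\<bar> powr p / q k)" for k x
  have [measurable]: "g k \<in> borel_measurable M" for k unfolding g_def by measurable
  have gi: "(\<integral>\<^sup>+x. g k x \<partial>M) \<le> ennreal ((1/2) ^ k)" for k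
  proof -
    have "(\<integral>\<^sup>+x. g k x \<partial>M) = (\<integral>\<^sup>+x. ennreal (1 / q k) * ennreal (\<bar>a (r (Suc k)) x - a (r k) x\<bar> powr p) \<partial>M)"
      using q[of k] by (intro nn_integral_cong) (simp add: g_def ennreal_mult[symmetric])
    also have "\<dots> = ennreal (1 / q k) * (\<integral>\<^sup>+x. ennreal (\<bar>a (r (Suc k)) x - a (r k) x\<bar> powr p) \<partial>M)"
      by (rule nn_integral_cmult) measurable
    also have "\<dots> \<le> ennreal (1 / q k) * ennreal ((1/2) ^ k * q k)"
      using Nr by (intro mult_left_mono N) auto
    also have "\<dots> = ennreal ((1/2) ^ k)" using q[of k] by (simp add: ennreal_mult[symmetric])
    finally show ?thesis .
  qed
  have "(\<integral>\<^sup>+x. (\<Sum>k. g k x) \<partial>M) = (\<Sum>k. \<integral>\<^sup>+x. g k x \<partial>M)" by (rule nn_integral_suminf) simp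
  also have "\<dots> \<le> (\<Sum>k. ennreal ((1/2) ^ k))" by (intro suminf_le gi) auto
  also have "\<dots> = ennreal (\<Sum>k. (1/2) ^ k)" by (rule suminf_ennreal2) (auto simp: summable_geometric)
  also have "\<dots> < \<infinity>" by simp
  finally have "AE x in M. (\<Sum>k. g k x) \<noteq> \<infinity>" by (intro nn_integral_noteq_infinite) auto
  then have "AE x in M. convergent (\<lambda>k. a (r k) x)"
  proof eventually_elim
    case (elim x)
    have "summable (\<lambda>k. \<bar>a (r (Suc k)) x - a (r k) x\<bar> powr p / q k)"
      using elim q unfolding g_def by (intro summable_suminf_not_top) (auto simp: less_imp_le)
    then have "(\<lambda>k. \<bar>a (r (Suc k)) x - a (r k) x\<bar> powr p / q k) \<longlonglongrightarrow> 0" by (rule summable_LIMSEQ_zero)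
    then have "\<forall>\<^sub>F k in sequentially. \<bar>a (r (Suc k)) x - a (r k) x\<bar> powr p / q k < 1"
      by (rule order_tendstoD) simp
    then have "\<forall>\<^sub>F k in sequentially. norm (a (r (Suc k)) x - a (r k) x) \<le> (1/2) ^ k"
    proof eventually_elim
      case (elim k)
      then have "\<bar>a (r (Suc k)) x - a (r k) x\<bar> powr p < ((1/2) ^ k) powr p"
        using q[of k] by (simp add: q_def)
      then have "\<bar>a (r (Suc k)) x - a (r k) x\<bar> < (1/2) ^ k"
        using p powr_mono2[of p "(1/2) ^ k" "\<bar>a (r (Suc k)) x - a (r k) x\<bar>"] by fastforce
      then show ?case by simp
    qed
    then have "summable (\<lambda>k. a (r (Suc k)) x - a (r k) x)"
      by (rule summable_comparison_test_ev) (simp add: summable_geometric)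
    then have "convergent (\<lambda>n. \<Sum>k<n. a (r (Suc k)) x - a (r k) x)"
      by (simp add: summable_iff_convergent)
    then have "convergent (\<lambda>n. a (r n) x - a (r 0) x)"
      using sum_lessThan_telescope[of "\<lambda>n. a (r n) x"] by simp
    from convergent_add[OF this convergent_const[of "a (r 0) x"]] show ?case by simp
  qed
  then show ?thesis using r that by blast
qed

context weighted_domain
begin

text \<open>The second conjunct asks for finite energy over all pairs, including those across the
  boundary of \<Omega>. It makes the pairing of fluxes with increments integrable, by Young's
  inequality.\<close>

definition X :: "('a \<Rightarrow> real) \<Rightarrow> bool" where
  "X v \<longleftrightarrow> W v \<and> integrable \<nu> (\<lambda>z. \<bar>gap v z\<bar> powr p)"

definition energy :: "('a \<Rightarrow> real) \<Rightarrow> real" where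
  "energy v = (\<integral>z. \<bar>gap v z\<bar> powr p \<partial>\<nu>)"

lemma X_W: "X v \<Longrightarrow> W v" by (simp add: X_def)
lemma X_measurable: "X v \<Longrightarrow> v \<in> borel_measurable lebesgue" by (simp add: X_def W_measurable)
lemma X_outside: "X v \<Longrightarrow> x \<notin> \<Omega> \<Longrightarrow> v x = 0" by (simp add: X_def W_outside)
lemma X_energy: "X v \<Longrightarrow> integrable \<nu> (\<lambda>z. \<bar>gap v z\<bar> powr p)" by (simp add: X_def)

lemma gap_add: "gap (\<lambda>x. u x + v x) z = gap u z + gap v z" by (simp add: gap_def)
lemma gap_diff: "gap (\<lambda>x. u x - v x) z = gap u z - gap v z" by (simp add: gap_def)
lemma gap_cmult: "gap (\<lambda>x. c * v x) z = c * gap v z" by (simp add: gap_def right_diff_distrib)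

lemma gap_measurable_nu: "v \<in> borel_measurable lebesgue \<Longrightarrow> gap v \<in> borel_measurable \<nu>"
  by (subst measurable_cong_sets[OF sets_nu refl]) (rule gap_measurable)

lemma X_mono:
  assumes "W v" "X a" "X b" "\<And>z. \<bar>gap v z\<bar> \<le> \<bar>gap a z\<bar> + \<bar>gap b z\<bar>"
  shows "X v"
proof -
  note m = gap_measurable_nu[OF X_measurable[OF assms(2)]] gap_measurable_nu[OF X_measurable[OF assms(3)]]
  have "integrable \<nu> (\<lambda>z. \<bar>\<bar>gap a z\<bar> + \<bar>gap b z\<bar>\<bar> powr p)"
    using m X_energy[OF assms(2)] X_energy[OF assms(3)] by (intro integrable_abs_powr_add[OF p0]) auto
  then have "integrable \<nu> (\<lambda>z. \<bar>gap v z\<bar> powr p)"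
    using assms(4) gap_measurable_nu[OF W_measurable[OF assms(1)]]
    by (intro integrable_abs_powr_mono[OF p0, of "gap v" \<nu> "\<lambda>z. \<bar>gap a z\<bar> + \<bar>gap b z\<bar>"]) auto
  then show ?thesis using assms(1) by (simp add: X_def)
qed

lemma X_zero: "X (\<lambda>x. 0)"
  using W_test[OF test_fun_zero] by (simp add: X_def gap_def)

lemma X_test: "test_fun \<Omega> \<phi> \<Longrightarrow> X \<phi>"
  by (simp add: X_def W_test test_fun_energy)

lemma X_cmult: "X v \<Longrightarrow> X (\<lambda>x. c * v x)"
  unfolding X_def gap_cmult by (auto intro: W_cmult integrable_abs_powr_cmult)

lemma X_add: "X u \<Longrightarrow> X v \<Longrightarrow> X (\<lambda>x. u x + v x)"
  by (rule X_mono[of _ u v]) (auto simp: gap_add X_W W_add)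

lemma X_diff: "X u \<Longrightarrow> X v \<Longrightarrow> X (\<lambda>x. u x - v x)"
  by (rule X_mono[of _ u v]) (auto simp: gap_diff X_W W_diff)

lemma X_max: "X u \<Longrightarrow> X v \<Longrightarrow> X (\<lambda>x. max (u x) (v x))"
  by (rule X_mono[OF W_max[OF X_W X_W], of u v u v]) (auto simp: gap_def max_def)

lemma X_trunc: assumes "X v" "0 \<le> k" shows "X (\<lambda>x. trunc k (v x))"
proof (rule X_mono[OF W_trunc[OF X_W[OF assms(1)] assms(2)] assms(1) X_zero])
  show "\<bar>gap (\<lambda>x. trunc k (v x)) z\<bar> \<le> \<bar>gap v z\<bar> + \<bar>gap (\<lambda>x. 0) z\<bar>" for z
    using gap_lipschitz_comp[OF trunc_lipschitz, of k v z] by linarith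
qed

lemma integral_nuD_le:
  fixes f :: "'a \<times> 'a \<Rightarrow> real"
  assumes "f \<in> borel_measurable L2" "\<And>z. 0 \<le> f z" "integrable \<nu> f"
  shows "(\<integral>z. f z \<partial>nuD) \<le> (\<integral>z. f z \<partial>\<nu>)"
proof -
  have "ennreal (\<integral>z. f z \<partial>nuD) = (\<integral>\<^sup>+z. ennreal (f z) \<partial>nuD)"
    using assms by (intro nn_integral_eq_integral[symmetric] integrable_nuD) auto
  also have "\<dots> \<le> (\<integral>\<^sup>+z. ennreal (f z) \<partial>\<nu>)" using assms(1) by (intro nn_integral_nuD_le) measurable
  also have "\<dots> = ennreal (\<integral>z. f z \<partial>\<nu>)" using assms by (intro nn_integral_eq_integral) auto
  finally show ?thesis using assms(2) by simp
qed

text \<open>As \<open>muD\<close> is finite, a uniform bound turns a.e. convergence into convergence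
  of the weighted \<open>L\<^sup>p\<close> integrals, and the closure property of \<open>W\<close>
  applies; Fatou's lemma handles the energy. The eventual bound \<open>b\<close> may be smaller than
  \<open>C\<close>, which gives lower semicontinuity along minimising sequences.\<close>

lemma X_bounded_limit:
  assumes X: "\<And>n. X (vs n)" and M: "\<And>n x. \<bar>vs n x\<bar> \<le> M" "\<And>x. \<bar>v x\<bar> \<le> M"
    and v: "v \<in> borel_measurable lebesgue" "\<And>x. x \<notin> \<Omega> \<Longrightarrow> v x = 0"
    and lim: "AE x in lebesgue. (\<lambda>n. vs n x) \<longlonglongrightarrow> v x"
    and bd: "\<And>n. energy (vs n) \<le> C"
  shows "X v" and "\<forall>\<^sub>F n in sequentially. energy (vs n) \<le> b \<Longrightarrow> energy v \<le> b"
proof -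
  note [measurable] = v(1) X_measurable[OF X]
  have "W v"
  proof (rule W_weak_closure[OF X_W[OF X] v])
    have "(\<lambda>n. \<integral>\<^sup>+x. ennreal (\<bar>vs n x - v x\<bar> powr p) \<partial>muD) \<longlonglongrightarrow> (\<integral>\<^sup>+x. 0 \<partial>muD)"
    proof (rule nn_integral_dominated_convergence[where w="\<lambda>_. ennreal ((2 * M) powr p)"])
      show "AE x in muD. ennreal (\<bar>vs n x - v x\<bar> powr p) \<le> ennreal ((2 * M) powr p)" for n
      proof (rule AE_I2, rule ennreal_leI, rule powr_mono2)
        show "\<bar>vs n x - v x\<bar> \<le> 2 * M" for x using M(1)[of n x] M(2)[of x] by linarith
      qed (use p0 in auto)
      show "(\<integral>\<^sup>+x. ennreal ((2 * M) powr p) \<partial>muD) < \<infinity>"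
        using emeasure_muD_UNIV by (simp add: space_muD ennreal_mult_less_top)
      show "AE x in muD. (\<lambda>n. ennreal (\<bar>vs n x - v x\<bar> powr p)) \<longlonglongrightarrow> 0"
        unfolding AE_muD_iff using lim
      proof eventually_elim
        case (elim x)
        have "(\<lambda>n. ennreal (\<bar>vs n x - v x\<bar> powr p)) \<longlonglongrightarrow> ennreal (\<bar>v x - v x\<bar> powr p)"
          by (intro tendsto_ennrealI tendsto_abs_powr p0 tendsto_intros elim)
        then show ?case by simp
      qed
    qed auto
    then show "(\<lambda>n. \<integral>\<^sup>+x. ennreal (\<bar>vs n x - v x\<bar> powr p) \<partial>muD) \<longlonglongrightarrow> 0" by simp
    show "(\<integral>z. \<bar>gap (vs n) z\<bar> powr p \<partial>nuD) \<le> C" for n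
      using integral_nuD_le[OF _ _ X_energy[OF X], of n] bd[of n] unfolding energy_def by simp
  qed
  from AE_nu_pair[OF lim] have ae: "AE z in \<nu>. (\<lambda>n. gap (vs n) z) \<longlonglongrightarrow> gap v z"
    by eventually_elim (auto simp: gap_def intro: tendsto_diff)
  have C0: "0 \<le> energy u" for u unfolding energy_def by simp
  have fat: "(\<integral>\<^sup>+z. ennreal (\<bar>gap v z\<bar> powr p) \<partial>\<nu>) \<le> ennreal b" if ev: "\<forall>\<^sub>F n in sequentially. energy (vs n) \<le> b" for b
  proof -
    have "(\<integral>\<^sup>+z. ennreal (\<bar>gap v z\<bar> powr p) \<partial>\<nu>) = (\<integral>\<^sup>+z. liminf (\<lambda>n. ennreal (\<bar>gap (vs n) z\<bar> powr p)) \<partial>\<nu>)"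
    proof (rule nn_integral_cong_AE)
      show "AE z in \<nu>. ennreal (\<bar>gap v z\<bar> powr p) = liminf (\<lambda>n. ennreal (\<bar>gap (vs n) z\<bar> powr p))"
        using ae
      proof eventually_elim
        case (elim z)
        have "(\<lambda>n. ennreal (\<bar>gap (vs n) z\<bar> powr p)) \<longlonglongrightarrow> ennreal (\<bar>gap v z\<bar> powr p)"
          by (intro tendsto_ennrealI tendsto_abs_powr p0 elim)
        then show ?case by (metis lim_imp_Liminf sequentially_bot)
      qed
    qed
    also have "\<dots> \<le> liminf (\<lambda>n. \<integral>\<^sup>+z. ennreal (\<bar>gap (vs n) z\<bar> powr p) \<partial>\<nu>)"
      by (rule nn_integral_liminf) measurable
    also have "\<dots> \<le> ennreal b"
    proof (rule Liminf_le)
      show "\<forall>\<^sub>F n in sequentially. (\<integral>\<^sup>+z. ennreal (\<bar>gap (vs n) z\<bar> powr p) \<partial>\<nu>) \<le> ennreal b"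
        using ev
      proof eventually_elim
        case (elim n)
        have "(\<integral>\<^sup>+z. ennreal (\<bar>gap (vs n) z\<bar> powr p) \<partial>\<nu>) = ennreal (energy (vs n))"
          unfolding energy_def by (rule nn_integral_eq_integral[OF X_energy[OF X]]) simp
        then show ?case using elim by (simp add: ennreal_leI)
      qed
    qed simp
    finally show ?thesis .
  qed
  have "(\<integral>\<^sup>+z. ennreal (\<bar>gap v z\<bar> powr p) \<partial>\<nu>) \<le> ennreal C" by (rule fat) (simp add: bd)
  then have "integrable \<nu> (\<lambda>z. \<bar>gap v z\<bar> powr p)"
    by (intro integrableI_nonneg) (auto intro: le_less_trans)
  then show Xv: "X v" using \<open>W v\<close> by (simp add: X_def)
  show "energy v \<le> b" if ev: "\<forall>\<^sub>F n in sequentially. energy (vs n) \<le> b"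
  proof -
    obtain n where "energy (vs n) \<le> b" using eventually_happens'[OF sequentially_bot ev] by blast
    then have "0 \<le> b" using C0[of "vs n"] by linarith
    have "(\<integral>\<^sup>+z. ennreal (\<bar>gap v z\<bar> powr p) \<partial>\<nu>) = ennreal (energy v)"
      unfolding energy_def by (rule nn_integral_eq_integral[OF X_energy[OF Xv]]) simp
    then show ?thesis using fat[OF ev] \<open>0 \<le> b\<close> by simp
  qed
qed

text \<open>A Poincare inequality is immediate here, because functions vanish outside the bounded set
  \<open>\<Omega>\<close> and the kernel is bounded below on \<open>\<Omega> \<times> B\<close> for a ball \<open>B\<close> away from \<open>\<Omega>\<close>.\<close>

lemma cross_lower:
  "\<exists>c>0. \<forall>g G. g \<in> borel_measurable lebesgue \<longrightarrow> G \<in> borel_measurable L2 \<longrightarrow>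
    (\<forall>x y. x \<in> \<Omega> \<longrightarrow> y \<notin> \<Omega> \<longrightarrow> g x \<le> G (x, y)) \<longrightarrow>
    ennreal c * (\<integral>\<^sup>+x. indicator \<Omega> x * g x \<partial>lebesgue) \<le> (\<integral>\<^sup>+z. G z \<partial>\<nu>)"
proof -
  interpret L: sigma_finite_measure "lebesgue :: 'a measure" by (rule sigma_finite_lebesgue)
  obtain R0 where "\<Omega> \<subseteq> cball 0 R0" using domain_subset_cball .
  define R where "R = max R0 0"
  have R: "\<Omega> \<subseteq> cball 0 R" "0 \<le> R" using \<open>\<Omega> \<subseteq> cball 0 R0\<close> by (auto simp: R_def)
  obtain i :: 'a where i: "i \<in> Basis" using nonempty_Basis by blast
  \<comment> \<open>The unit ball around this point misses \<open>cball 0 R\<close> and hence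
    \<Omega>, and its points have norm at most \<open>R + 3\<close>. The constant
    \<open>K = 2 * R + 3\<close> below then bounds the distance and both norms.\<close>
  define b where "b = (R + 2) *\<^sub>R i"
  define B where "B = ball b 1"
  have B: "R < norm y" "norm y \<le> R + 3" if "y \<in> B" for y
  proof -
    have "norm b = R + 2" using R i by (simp add: b_def norm_Basis)
    moreover have "norm (b - y) < 1" using that by (simp add: B_def dist_norm)
    ultimately show "R < norm y" "norm y \<le> R + 3"
      using norm_triangle_ineq2[of b y] norm_triangle_ineq3[of b y] by linarith+
  qed
  have [measurable]: "B \<in> sets lebesgue" by (simp add: B_def)
  define K where "K = 2 * R + 3"
  define k0 where "k0 = 1 / (K powr (real DIM('a) + p * s) * K powr \<beta> * K powr \<beta>)"
  have K: "0 < K" using R by (simp add: K_def)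
  then have k0: "0 < k0" by (simp add: k0_def)
  \<comment> \<open>At \<open>x = 0\<close> the convention \<open>1 / 0 = 0\<close> makes the kernel
    vanish, so the lower bound holds only off the origin.\<close>
  have wt: "k0 \<le> wt (x, y)" if "x \<in> \<Omega>" "y \<in> B" "x \<noteq> 0" for x y
  proof -
    have n: "norm x \<le> R" using that R by auto
    have "x \<noteq> y" using B(1)[OF that(2)] n by auto
    moreover have "dist x y \<le> K" using norm_triangle_ineq4[of x y] n B(2)[OF that(2)] by (simp add: dist_norm K_def)
    moreover have "norm x \<le> K" "norm y \<le> K" "0 < norm y" using n B[OF that(2)] R by (auto simp: K_def)
    moreover have "0 < p * s" using p s by simp
    ultimately show ?thesis unfolding k0_def wt_def fst_conv snd_conv using that beta K
      by (intro divide_left_mono mult_mono powr_mono2 mult_pos_pos) auto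
  qed
  define c where "c = k0 * measure lebesgue B"
  have mB: "0 < measure lebesgue B" by (simp add: B_def)
  have eB: "emeasure lebesgue B = ennreal (measure lebesgue B)"
    by (rule emeasure_eq_ennreal_measure) (use emeasure_bounded_finite[of B] in \<open>simp add: B_def emeasure_completion\<close>)
  show ?thesis
  proof (intro exI[of _ c] conjI allI impI)
    show "0 < c" using k0 mB by (simp add: c_def)
    fix g :: "'a \<Rightarrow> ennreal" and G :: "'a \<times> 'a \<Rightarrow> ennreal"
    assume [measurable]: "g \<in> borel_measurable lebesgue" "G \<in> borel_measurable L2"
      and le: "\<forall>x y. x \<in> \<Omega> \<longrightarrow> y \<notin> \<Omega> \<longrightarrow> g x \<le> G (x, y)"
    have gm: "(\<lambda>z. g (fst z)) \<in> borel_measurable L2" by (rule measurable_compose[OF measurable_fst]) simp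
    have im: "(\<lambda>z. indicator \<Omega> (fst z) :: ennreal) \<in> borel_measurable L2" "(\<lambda>z. indicator B (snd z) :: ennreal) \<in> borel_measurable L2"
      by (rule measurable_compose[OF measurable_fst], simp) (rule measurable_compose[OF measurable_snd], simp)
    note [measurable] = gm im
    have "ennreal c * (\<integral>\<^sup>+x. indicator \<Omega> x * g x \<partial>lebesgue)
        = ennreal k0 * ((\<integral>\<^sup>+x. indicator \<Omega> x * g x \<partial>lebesgue) * emeasure lebesgue B)"
      unfolding eB c_def using k0 by (simp add: ennreal_mult mult_ac)
    also have "\<dots> = ennreal k0 * (\<integral>\<^sup>+x. indicator \<Omega> x * g x * emeasure lebesgue B \<partial>lebesgue)"
      by (subst nn_integral_multc) auto
    also have "\<dots> = ennreal k0 * (\<integral>\<^sup>+x. \<integral>\<^sup>+y. indicator \<Omega> x * g x * indicator B y \<partial>lebesgue \<partial>lebesgue)"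
      by (simp add: nn_integral_cmult)
    also have "\<dots> = ennreal k0 * (\<integral>\<^sup>+z. indicator \<Omega> (fst z) * g (fst z) * indicator B (snd z) \<partial>L2)"
      by (subst L.nn_integral_fst[symmetric]) auto
    also have "\<dots> = (\<integral>\<^sup>+z. ennreal k0 * (indicator \<Omega> (fst z) * g (fst z) * indicator B (snd z)) \<partial>L2)"
      by (subst nn_integral_cmult) auto
    also have "\<dots> \<le> (\<integral>\<^sup>+z. ennreal (wt z) * G z \<partial>L2)"
    proof (rule nn_integral_mono_AE)
      show "AE z in L2. ennreal k0 * (indicator \<Omega> (fst z) * g (fst z) * indicator B (snd z)) \<le> ennreal (wt z) * G z"
        using AE_fst_snd_lebesgue[OF AE_nonzero]
      proof eventually_elim
        case (elim z)
        obtain x y where z: "z = (x, y)" by (cases z)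
        show ?case
        proof (cases "x \<in> \<Omega> \<and> y \<in> B")
          case True
          have "y \<notin> \<Omega>" using B(1)[of y] True R by auto
          then have "g x \<le> G (x, y)" using le True by blast
          moreover have "ennreal k0 \<le> ennreal (wt (x, y))" using wt True elim by (intro ennreal_leI) (auto simp: z)
          ultimately show ?thesis using True by (simp add: z mult_mono)
        qed (auto simp: z)
      qed
    qed
    also have "\<dots> = (\<integral>\<^sup>+z. G z \<partial>\<nu>)" unfolding nu_eq by (subst nn_integral_density) auto
    finally show "ennreal c * (\<integral>\<^sup>+x. indicator \<Omega> x * g x \<partial>lebesgue) \<le> (\<integral>\<^sup>+z. G z \<partial>\<nu>)" .
  qed
qed

lemma integrable_flux:
  assumes "X u" "X v" shows "integrable \<nu> (\<lambda>z. flux p (gap u z) * gap v z)"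
proof (rule Bochner_Integration.integrable_bound)
  note [measurable] = gap_measurable_nu[OF X_measurable[OF assms(1)]] gap_measurable_nu[OF X_measurable[OF assms(2)]]
  show "integrable \<nu> (\<lambda>z. \<bar>gap u z\<bar> powr p + \<bar>gap v z\<bar> powr p)" using assms by (auto intro: X_energy)
  show "AE z in \<nu>. norm (flux p (gap u z) * gap v z) \<le> norm (\<bar>gap u z\<bar> powr p + \<bar>gap v z\<bar> powr p)"
    using abs_flux_mult_le[OF p(1)] by auto
  show "(\<lambda>z. flux p (gap u z) * gap v z) \<in> borel_measurable \<nu>" by measurable
qed

text \<open>The obstacle problem with obstacles \<open>\<plusminus> M\<close>: for bounded competitors a datum in \<open>L\<^sup>1\<close> is harmless,
  and \<open>z - trunc k (z - \<phi>)\<close> is an admissible competitor whenever \<open>\<bar>\<phi>\<bar> \<le> M\<close>.\<close>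

definition obstacle_sol :: "real \<Rightarrow> ('a \<Rightarrow> real) \<Rightarrow> ('a \<Rightarrow> real) \<Rightarrow> bool" where
  "obstacle_sol M F z \<longleftrightarrow> X z \<and> (\<forall>x. \<bar>z x\<bar> \<le> M) \<and>
     (\<forall>v. X v \<and> (\<forall>x. \<bar>v x\<bar> \<le> M) \<longrightarrow>
        (\<integral>x. F x * (v x - z x) \<partial>lebesgue) \<le> 1/2 * (\<integral>t. flux p (gap z t) * (gap v t - gap z t) \<partial>\<nu>))"

text \<open>The direct method. Near-minimisers are Cauchy in energy by uniform convexity, and then
  in \<open>L\<^sup>p\<close> by the Poincare estimate, which yields an a.e. limit; lower
  semicontinuity makes it a minimiser, and one-sided variation gives the inequality.\<close>

lemma obstacle_sol_exists:
  assumes F: "integrable lebesgue F" and M: "0 \<le> M"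
  obtains z where "obstacle_sol M F z"
proof -
  define K where "K = {v. X v \<and> (\<forall>x. \<bar>v x\<bar> \<le> M)}"
  define l where "l v = (\<integral>x. F x * v x \<partial>lebesgue)" for v
  \<comment> \<open>The factor \<open>1 / (2 * p)\<close> cancels the \<open>p\<close> from
    differentiating the power and leaves the \<open>1/2\<close> of the entropy inequality.\<close>
  define J where "J v = energy v / (2 * p) - l v" for v
  have Fi: "integrable lebesgue (\<lambda>x. F x * v x)" if "v \<in> K" for v
    using that F X_measurable by (intro integrable_mult_bounded[of _ _ _ M]) (auto simp: K_def)
  define A where "A = M * (\<integral>x. \<bar>F x\<bar> \<partial>lebesgue)"
  have l_le: "\<bar>l v\<bar> \<le> A" if "v \<in> K" for v
  proof -
    have "\<bar>l v\<bar> \<le> (\<integral>x. \<bar>F x * v x\<bar> \<partial>lebesgue)" unfolding l_def by (rule integral_abs_bound)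
    also have "\<dots> \<le> (\<integral>x. M * \<bar>F x\<bar> \<partial>lebesgue)"
    proof (rule integral_mono)
      show "\<bar>F x * v x\<bar> \<le> M * \<bar>F x\<bar>" for x
        using that mult_right_mono[of "\<bar>v x\<bar>" M "\<bar>F x\<bar>"] by (simp add: K_def abs_mult mult.commute)
      show "integrable lebesgue (\<lambda>x. \<bar>F x * v x\<bar>)" using Fi[OF that] by (rule integrable_abs)
    qed (use F in auto)
    finally show ?thesis by (simp add: A_def)
  qed
  have e0: "0 \<le> energy v" for v by (simp add: energy_def)
  have J_low: "- A \<le> J v" if "v \<in> K" for v
  proof -
    have "0 \<le> energy v / (2 * p)" using e0[of v] p0 by simp
    then show ?thesis using l_le[OF that] by (simp add: J_def)
  qed
  have K0: "(\<lambda>x. 0) \<in> K" using X_zero M by (simp add: K_def)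
  have bb: "bdd_below (J ` K)" using J_low by (intro bdd_belowI[of _ "- A"]) auto
  define m where "m = Inf (J ` K)"
  have m_le: "m \<le> J v" if "v \<in> K" for v unfolding m_def by (rule cInf_lower[OF _ bb]) (use that in auto)
  have "\<exists>v\<in>K. J v < m + 1 / real (Suc n)" for n
    using cInf_lessD[of "J ` K" "m + 1 / real (Suc n)"] K0 unfolding m_def by auto
  then obtain vs where vs: "\<And>n. vs n \<in> K" "\<And>n. J (vs n) < m + 1 / real (Suc n)" by metis
  have Xv: "X (vs n)" and Mv: "\<bar>vs n x\<bar> \<le> M" for n x using vs(1) by (auto simp: K_def)
  note [measurable] = X_measurable[OF Xv] gap_measurable_nu[OF X_measurable[OF Xv]]
  have mid: "(\<lambda>x. (a x + b x) / 2) \<in> K" if "a \<in> K" "b \<in> K" for a b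
  proof -
    have "X (\<lambda>x. 1/2 * (a x + b x))" using that by (intro X_cmult X_add) (auto simp: K_def)
    moreover have "\<bar>(a x + b x) / 2\<bar> \<le> M" for x
    proof -
      have "\<bar>a x\<bar> \<le> M" "\<bar>b x\<bar> \<le> M" using that by (auto simp: K_def)
      then show ?thesis using abs_triangle_ineq[of "a x" "b x"] by simp
    qed
    ultimately show ?thesis by (simp add: K_def)
  qed
  define C where "C = 2 * p * (m + 1 + A)"
  have C: "energy (vs n) \<le> C" for n
  proof -
    have "1 / real (Suc n) \<le> 1" by simp
    then have "energy (vs n) / (2 * p) \<le> m + 1 + A"
      using vs(2)[of n] l_le[OF vs(1)[of n]] unfolding J_def by linarith
    then show ?thesis using p0 unfolding C_def by (simp add: field_simps)
  qed
  \<comment> \<open>The linear part of \<open>J\<close> cancels in the midpoint defect. Two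
    near-minimisers, whose midpoint has value at least \<open>m\<close>, therefore have a small
    energy defect.\<close>
  have defect: "\<exists>N. \<forall>i\<ge>N. \<forall>j\<ge>N. (energy (vs i) + energy (vs j)) / 2 - (\<integral>z. \<bar>(gap (vs i) z + gap (vs j) z) / 2\<bar> powr p \<partial>\<nu>) < d"
    if "0 < d" for d
  proof -
    have d2: "0 < d / (2 * p)" using that p0 by simp
    obtain N where N: "1 / real (Suc N) < d / (2 * p)" using nat_approx_posE[OF d2] .
    have "(energy (vs i) + energy (vs j)) / 2 - (\<integral>z. \<bar>(gap (vs i) z + gap (vs j) z) / 2\<bar> powr p \<partial>\<nu>) < d"
      if ij: "i \<ge> N" "j \<ge> N" for i j
    proof -
      let ?c = "\<lambda>x. (vs i x + vs j x) / 2"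
      have ec: "(\<integral>z. \<bar>(gap (vs i) z + gap (vs j) z) / 2\<bar> powr p \<partial>\<nu>) = energy ?c"
      proof -
        have "gap ?c z = (gap (vs i) z + gap (vs j) z) / 2" for z by (simp add: gap_def field_simps)
        then show ?thesis by (simp only: energy_def)
      qed
      have lc: "l ?c = (l (vs i) + l (vs j)) / 2"
      proof -
        have "l ?c = (\<integral>x. (F x * vs i x + F x * vs j x) / 2 \<partial>lebesgue)"
          unfolding l_def by (intro Bochner_Integration.integral_cong) (auto simp: field_simps)
        then show ?thesis using Fi[OF vs(1)[of i]] Fi[OF vs(1)[of j]] by (simp add: l_def)
      qed
      have "J (vs k) < m + 1 / real (Suc N)" if "k \<ge> N" for k
      proof -
        have "1 / real (Suc k) \<le> 1 / real (Suc N)" using that by (intro divide_left_mono) auto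
        then show ?thesis using vs(2)[of k] by linarith
      qed
      moreover have "(x + y) / 2 - w < t" if "x < m + t" "y < m + t" "m \<le> w" for x y w t :: real
        using that by (simp add: field_simps)
      ultimately have "(J (vs i) + J (vs j)) / 2 - J ?c < 1 / real (Suc N)"
        using ij m_le[OF mid[OF vs(1) vs(1), of i j]] by blast
      moreover have "(J (vs i) + J (vs j)) / 2 - J ?c = ((energy (vs i) + energy (vs j)) / 2 - energy ?c) / (2 * p)"
        unfolding J_def lc using p0 by (simp add: field_simps)
      ultimately have "((energy (vs i) + energy (vs j)) / 2 - energy ?c) / (2 * p) < d / (2 * p)" using N by linarith
      then show ?thesis unfolding ec using p0 by (simp add: divide_less_cancel)
    qed
    then show ?thesis by blast
  qed
  have cauchy: "\<exists>N. \<forall>i\<ge>N. \<forall>j\<ge>N. (\<integral>z. \<bar>gap (vs i) z - gap (vs j) z\<bar> powr p \<partial>\<nu>) < d" if "0 < d" for d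
    by (rule uniformly_convex_imp_Cauchy[where a="\<lambda>n. gap (vs n)", OF p(1) _ X_energy[OF Xv] _ _ that, of C])
       (use defect C in \<open>auto simp: energy_def\<close>)
  obtain c where c: "0 < c" "\<forall>g G. g \<in> borel_measurable lebesgue \<longrightarrow> G \<in> borel_measurable L2 \<longrightarrow>
    (\<forall>x y. x \<in> \<Omega> \<longrightarrow> y \<notin> \<Omega> \<longrightarrow> g x \<le> G (x, y)) \<longrightarrow>
    ennreal c * (\<integral>\<^sup>+x. indicator \<Omega> x * g x \<partial>lebesgue) \<le> (\<integral>\<^sup>+z. G z \<partial>\<nu>)"
    using cross_lower by blast
  \<comment> \<open>When the second point lies outside \<Omega>, an increment is the value at the
    first point, so \<open>cross_lower\<close> bounds the integral of the p-th power of the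
    difference by its energy.\<close>
  have cauchy': "\<exists>N. \<forall>i\<ge>N. \<forall>j\<ge>N. (\<integral>\<^sup>+x. ennreal (\<bar>vs i x - vs j x\<bar> powr p) \<partial>lebesgue) \<le> ennreal d" if "0 < d" for d
  proof -
    have "0 < c * d" using c that by simp
    then obtain N where N: "\<And>i j. i \<ge> N \<Longrightarrow> j \<ge> N \<Longrightarrow> (\<integral>z. \<bar>gap (vs i) z - gap (vs j) z\<bar> powr p \<partial>\<nu>) < c * d"
      using cauchy by blast
    have "(\<integral>\<^sup>+x. ennreal (\<bar>vs i x - vs j x\<bar> powr p) \<partial>lebesgue) \<le> ennreal d" if "i \<ge> N" "j \<ge> N" for i j
    proof -
      have "(\<integral>\<^sup>+x. ennreal (\<bar>vs i x - vs j x\<bar> powr p) \<partial>lebesgue)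
          = (\<integral>\<^sup>+x. indicator \<Omega> x * ennreal (\<bar>vs i x - vs j x\<bar> powr p) \<partial>lebesgue)"
        using X_outside[OF Xv] by (intro nn_integral_cong) (auto simp: indicator_def)
      moreover have "ennreal c * (\<integral>\<^sup>+x. indicator \<Omega> x * ennreal (\<bar>vs i x - vs j x\<bar> powr p) \<partial>lebesgue)
          \<le> (\<integral>\<^sup>+z. ennreal (\<bar>gap (vs i) z - gap (vs j) z\<bar> powr p) \<partial>\<nu>)"
        by (rule c(2)[rule_format]) (auto simp: gap_def X_outside[OF Xv])
      moreover have "(\<integral>\<^sup>+z. ennreal (\<bar>gap (vs i) z - gap (vs j) z\<bar> powr p) \<partial>\<nu>)
          = ennreal (\<integral>z. \<bar>gap (vs i) z - gap (vs j) z\<bar> powr p \<partial>\<nu>)"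
        by (intro nn_integral_eq_integral integrable_abs_powr_diff[OF p0] X_energy[OF Xv]) auto
      moreover have "ennreal (\<integral>z. \<bar>gap (vs i) z - gap (vs j) z\<bar> powr p \<partial>\<nu>) \<le> ennreal (c * d)"
        using N[OF that] by (intro ennreal_leI) simp
      ultimately have "ennreal c * (\<integral>\<^sup>+x. ennreal (\<bar>vs i x - vs j x\<bar> powr p) \<partial>lebesgue) \<le> ennreal c * ennreal d"
        using c(1) \<open>0 < d\<close> by (simp add: ennreal_mult)
      then show ?thesis using c(1) ennreal_mult_le_mult_iff[of "ennreal c"] by simp
    qed
    then show ?thesis by blast
  qed
  obtain r where r: "strict_mono r" "AE x in lebesgue. convergent (\<lambda>k. vs (r k) x)"
    by (rule Cauchy_powr_AE_subseq[of p vs lebesgue, OF p0 _ cauchy']) auto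
  \<comment> \<open>The truncation changes the limit only on a null set; it secures the bound
    \<open>M\<close> at every point, as the obstacle problem demands, also where the subsequence
    diverges.\<close>
  define z where "z x = trunc M (lim (\<lambda>k. vs (r k) x))" for x
  have [measurable]: "z \<in> borel_measurable lebesgue" unfolding z_def by measurable
  have zM: "\<bar>z x\<bar> \<le> M" for x using M by (simp add: z_def abs_trunc_le)
  have zo: "z x = 0" if "x \<notin> \<Omega>" for x using X_outside[OF Xv that] M by (simp add: z_def lim_const)
  have zl: "AE x in lebesgue. (\<lambda>k. vs (r k) x) \<longlonglongrightarrow> z x"
    using r(2)
  proof eventually_elim
    case (elim x)
    then have l: "(\<lambda>k. vs (r k) x) \<longlonglongrightarrow> lim (\<lambda>k. vs (r k) x)" by (simp add: convergent_LIMSEQ_iff)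
    have "\<bar>lim (\<lambda>k. vs (r k) x)\<bar> \<le> M"
      by (rule LIMSEQ_le_const2[OF tendsto_rabs[OF l]]) (use Mv in auto)
    then show ?case using l by (simp add: z_def trunc_id)
  qed
  note lims = X_bounded_limit[of "\<lambda>k. vs (r k)" M z C, OF Xv Mv zM _ zo zl C]
  have Xz: "X z" by (rule lims) auto
  have zK: "z \<in> K" using Xz zM by (simp add: K_def)
  have ll: "(\<lambda>k. l (vs (r k))) \<longlonglongrightarrow> l z" unfolding l_def
  proof (rule integral_dominated_convergence[where w="\<lambda>x. M * \<bar>F x\<bar>"])
    show "AE x in lebesgue. (\<lambda>k. F x * vs (r k) x) \<longlonglongrightarrow> F x * z x"
      using zl by eventually_elim (intro tendsto_intros)
    show "AE x in lebesgue. norm (F x * vs (r k) x) \<le> M * \<bar>F x\<bar>" for k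
    proof (rule AE_I2)
      show "norm (F x * vs (r k) x) \<le> M * \<bar>F x\<bar>" for x
        using mult_right_mono[OF Mv[of "r k" x], of "\<bar>F x\<bar>"] by (simp add: abs_mult mult.commute)
    qed
  qed (use F borel_measurable_integrable[OF F] in auto)
  have Jz: "J z \<le> m"
  proof -
    \<comment> \<open>Only constant bounds pass to the limit energy, so the convergent bound is
      first replaced by its limit plus \<open>e\<close>.\<close>
    have "energy z \<le> 2 * p * (m + l z) + e" if "0 < e" for e
    proof (rule lims(2))
      have "(\<lambda>k. 2 * p * (m + 1 / real (Suc (r k)) + l (vs (r k)))) \<longlonglongrightarrow> 2 * p * (m + 0 + l z)"
      proof (intro tendsto_intros ll)
        have "(\<lambda>n. 1 / real (Suc n)) \<longlonglongrightarrow> 0" using LIMSEQ_inverse_real_of_nat by (simp add: inverse_eq_divide)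
        from LIMSEQ_subseq_LIMSEQ[OF this r(1)] show "(\<lambda>k. 1 / real (Suc (r k))) \<longlonglongrightarrow> 0" by (simp add: o_def)
      qed
      then have "\<forall>\<^sub>F k in sequentially. 2 * p * (m + 1 / real (Suc (r k)) + l (vs (r k))) < 2 * p * (m + l z) + e"
        using that by (intro order_tendstoD) auto
      then show "\<forall>\<^sub>F k in sequentially. energy (vs (r k)) \<le> 2 * p * (m + l z) + e"
      proof eventually_elim
        case (elim k)
        have "energy (vs (r k)) / (2 * p) \<le> m + 1 / real (Suc (r k)) + l (vs (r k))"
          using vs(2)[of "r k"] unfolding J_def by linarith
        then have "energy (vs (r k)) \<le> 2 * p * (m + 1 / real (Suc (r k)) + l (vs (r k)))"
          using p0 by (simp add: pos_divide_le_eq mult.commute)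
        then show ?case using elim by linarith
      qed
    qed simp
    then have "energy z \<le> 2 * p * (m + l z)" by (rule field_le_epsilon)
    then have "energy z / (2 * p) \<le> m + l z" using p0 by (simp add: pos_divide_le_eq mult.commute)
    then show ?thesis by (simp add: J_def)
  qed
  have "obstacle_sol M F z"
    unfolding obstacle_sol_def
  proof (intro conjI allI impI Xz zM)
    fix v assume v: "X v \<and> (\<forall>x. \<bar>v x\<bar> \<le> M)"
    then have vK: "v \<in> K" by (simp add: K_def)
    define h where "h x = v x - z x" for x
    have Xh: "X h" unfolding h_def using v Xz by (intro X_diff) auto
    note [measurable] = gap_measurable_nu[OF X_measurable[OF Xz]] gap_measurable_nu[OF X_measurable[OF Xh]]
    define t where "t n = 1 / real (Suc n)" for n
    have t: "0 < t n" "t n \<le> 1" for n by (auto simp: t_def)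
    have tl: "t \<longlonglongrightarrow> 0" unfolding t_def using LIMSEQ_inverse_real_of_nat by (simp add: inverse_eq_divide)
    have ih: "integrable lebesgue (\<lambda>x. F x * h x)"
      using Bochner_Integration.integrable_diff[OF Fi[OF vK] Fi[OF zK]] by (simp add: h_def right_diff_distrib)
    have dom: "\<bar>flux p (gap z y + t n * gap h y) * gap h y\<bar> \<le> 2 powr p * (\<bar>gap z y\<bar> powr p + \<bar>gap h y\<bar> powr p) + \<bar>gap h y\<bar> powr p" for n y
    proof -
      have "\<bar>flux p (gap z y + t n * gap h y) * gap h y\<bar> \<le> \<bar>gap z y + t n * gap h y\<bar> powr p + \<bar>gap h y\<bar> powr p"
        by (rule abs_flux_mult_le[OF p(1)])
      moreover have "\<bar>gap z y + t n * gap h y\<bar> powr p \<le> 2 powr p * (\<bar>gap z y\<bar> powr p + \<bar>t n * gap h y\<bar> powr p)"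
        by (rule abs_powr_add_le[OF p0])
      moreover have "\<bar>t n * gap h y\<bar> powr p \<le> \<bar>gap h y\<bar> powr p"
        using t[of n] p0 by (intro abs_powr_mono) (auto simp: abs_mult mult_left_le_one_le)
      ultimately show ?thesis by (smt (verit) mult_left_mono powr_ge_zero)
    qed
    have di: "integrable \<nu> (\<lambda>y. 2 powr p * (\<bar>gap z y\<bar> powr p + \<bar>gap h y\<bar> powr p) + \<bar>gap h y\<bar> powr p)"
      using X_energy[OF Xz] X_energy[OF Xh] by auto
    have step: "l h \<le> 1/2 * (\<integral>y. flux p (gap z y + t n * gap h y) * gap h y \<partial>\<nu>)" for n
    proof -
      let ?u = "\<lambda>x. z x + t n * h x"
      have Xu: "X ?u" by (intro X_add Xz X_cmult Xh)
      have "\<bar>?u x\<bar> \<le> M" for x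
      proof -
        have "?u x = (1 - t n) * z x + t n * v x" by (simp add: h_def algebra_simps)
        also have "\<bar>\<dots>\<bar> \<le> (1 - t n) * \<bar>z x\<bar> + t n * \<bar>v x\<bar>"
          using t[of n] by (intro order_trans[OF abs_triangle_ineq]) (simp add: abs_mult)
        also have "\<dots> \<le> (1 - t n) * M + t n * M"
          using t[of n] zM v by (intro add_mono mult_left_mono) auto
        finally show ?thesis by (simp add: algebra_simps)
      qed
      then have uK: "?u \<in> K" using Xu by (simp add: K_def)
      have gu: "gap ?u y = gap z y + t n * gap h y" for y by (simp add: gap_def algebra_simps)
      have lu: "l ?u = l z + t n * l h"
      proof -
        have "l ?u = (\<integral>x. F x * z x + t n * (F x * h x) \<partial>lebesgue)" unfolding l_def by (simp add: algebra_simps)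
        then show ?thesis using Fi[OF zK] ih by (simp add: l_def)
      qed
      have "J z \<le> J ?u" using Jz m_le[OF uK] by linarith
      then have 1: "t n * l h \<le> (energy ?u - energy z) / (2 * p)" unfolding J_def lu by (simp add: diff_divide_distrib)
      have fi: "integrable \<nu> (\<lambda>y. flux p (gap z y + t n * gap h y) * gap h y)"
        using integrable_flux[OF Xu Xh] by (simp add: gu)
      \<comment> \<open>The tangent is taken at the displaced point \<open>?u\<close>, so convexity
        bounds the difference quotient from above by a flux term. The passage \<open>t n\<close> to
        0 then needs only dominated convergence, and no differentiation under the integral.\<close>
      have "energy ?u - energy z = (\<integral>y. \<bar>gap ?u y\<bar> powr p - \<bar>gap z y\<bar> powr p \<partial>\<nu>)"
        unfolding energy_def using X_energy[OF Xu] X_energy[OF Xz] by simp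
      also have "\<dots> \<le> (\<integral>y. (p * t n) * (flux p (gap z y + t n * gap h y) * gap h y) \<partial>\<nu>)"
      proof (rule integral_mono)
        show "\<bar>gap ?u y\<bar> powr p - \<bar>gap z y\<bar> powr p \<le> (p * t n) * (flux p (gap z y + t n * gap h y) * gap h y)" for y
          unfolding gu using abs_powr_tangent[OF p(1), of "gap z y + t n * gap h y" "gap z y"] by (simp add: algebra_simps)
      qed (use X_energy[OF Xu] X_energy[OF Xz] fi in auto)
      also have "\<dots> = (p * t n) * (\<integral>y. flux p (gap z y + t n * gap h y) * gap h y \<partial>\<nu>)" by simp
      finally have "(energy ?u - energy z) / (2 * p) \<le> t n * (1/2 * (\<integral>y. flux p (gap z y + t n * gap h y) * gap h y \<partial>\<nu>))"
        using p0 by (simp add: field_simps)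
      then have "t n * l h \<le> t n * (1/2 * (\<integral>y. flux p (gap z y + t n * gap h y) * gap h y \<partial>\<nu>))" using 1 by linarith
      then show ?thesis using t(1)[of n] by simp
    qed
    have "(\<lambda>n. \<integral>y. flux p (gap z y + t n * gap h y) * gap h y \<partial>\<nu>) \<longlonglongrightarrow> (\<integral>y. flux p (gap z y) * gap h y \<partial>\<nu>)"
    proof (rule integral_dominated_convergence[OF _ _ di])
      show "AE y in \<nu>. (\<lambda>n. flux p (gap z y + t n * gap h y) * gap h y) \<longlonglongrightarrow> flux p (gap z y) * gap h y"
      proof (rule AE_I2)
        fix y
        have "(\<lambda>n. gap z y + t n * gap h y) \<longlonglongrightarrow> gap z y + 0 * gap h y" by (intro tendsto_intros tl)
        then show "(\<lambda>n. flux p (gap z y + t n * gap h y) * gap h y) \<longlonglongrightarrow> flux p (gap z y) * gap h y"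
          by (intro tendsto_mult tendsto_const tendsto_flux p) simp
      qed
    qed (use dom in auto)
    then have "(\<lambda>n. 1/2 * (\<integral>y. flux p (gap z y + t n * gap h y) * gap h y \<partial>\<nu>)) \<longlonglongrightarrow> 1/2 * (\<integral>y. flux p (gap z y) * gap h y \<partial>\<nu>)"
      by (intro tendsto_intros)
    then have "l h \<le> 1/2 * (\<integral>y. flux p (gap z y) * gap h y \<partial>\<nu>)"
      by (rule LIMSEQ_le_const) (use step in auto)
    then show "(\<integral>x. F x * (v x - z x) \<partial>lebesgue) \<le> 1/2 * (\<integral>y. flux p (gap z y) * (gap v y - gap z y) \<partial>\<nu>)"
      by (simp add: l_def h_def[abs_def] gap_diff)
  qed
  then show ?thesis using that by blast
qed

end

section \<open>Comparison\<close>

lemma flux_cmult: "0 \<le> c \<Longrightarrow> flux p (c * t) = c powr (p - 1) * flux p t"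
proof (cases "c = 0")
  case False
  assume "0 \<le> c"
  then have "c powr (p - 2) * c = c powr (p - 1)" using flux_pos[of c p] by (simp add: flux_def)
  moreover have "flux p (c * t) = (c powr (p - 2) * c) * flux p t"
    using \<open>0 \<le> c\<close> by (simp add: flux_def abs_mult powr_mult)
  ultimately show ?thesis by simp
qed simp

lemma trunc_cmult: "0 < c \<Longrightarrow> trunc k (c * a) = c * trunc (k / c) a"
  by (auto simp: trunc_def max_def min_def field_simps)

text \<open>For pairs with one point outside \<Omega>, where increments are plain values:
  \<open>a\<close> is the minimal solution, \<open>b\<close> the supersolution, \<open>c\<close> an
  approximate test function and \<open>d\<close> the given one. As \<open>a\<close> is nonnegative,
  the truncation is at least \<open>- \<bar>trunc k d\<bar>\<close>, and by subadditivity this is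
  paid by the integrands of \<open>b\<close> for the test functions 0 and \<open>d\<close>.\<close>

lemma flux_cross_lower:
  assumes p: "1 < p" and "0 \<le> k" "0 \<le> a" "a \<le> b" "\<bar>c\<bar> \<le> \<bar>d\<bar>"
  shows "- (\<bar>flux p b * trunc k b\<bar> + \<bar>flux p b * trunc k (b - d)\<bar>) \<le> flux p a * trunc k (a - c)"
proof -
  have fl: "0 \<le> flux p a" "flux p a \<le> flux p b"
    using assms flux_mono[OF p, of 0 a] flux_mono[OF p, of a b] by auto
  have "- \<bar>trunc k d\<bar> \<le> trunc k (a - c)"
    using assms by (auto simp: trunc_def max_def min_def)
  then have "flux p a * (- \<bar>trunc k d\<bar>) \<le> flux p a * trunc k (a - c)" using fl by (intro mult_left_mono)
  moreover have "flux p a * \<bar>trunc k d\<bar> \<le> flux p b * \<bar>trunc k d\<bar>" using fl by (intro mult_right_mono) auto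
  moreover have "flux p b * \<bar>trunc k d\<bar> \<le> flux p b * (\<bar>trunc k b\<bar> + \<bar>trunc k (b - d)\<bar>)"
    using fl assms by (intro mult_left_mono abs_trunc_diff_le) auto
  ultimately show ?thesis using fl by (simp add: abs_mult distrib_left)
qed

context weighted_domain
begin

text \<open>Monotonicity of the flux makes \<open>D\<close> nonnegative, and \<open>le\<close>
  forces its integral to vanish. On pairs with second point outside \<Omega>, \<open>D\<close>
  reduces to the difference of the fluxes of the values times \<open>A\<close>, which is strictly
  positive where \<open>z\<close> exceeds \<open>v\<close>; \<open>cross_lower\<close> then shows
  that this happens on a null set only. Only products of fluxes with \<open>gap A\<close> are
  integrated, so \<open>v\<close> may have infinite energy.\<close>

lemma compare_core:
  assumes meas: "z \<in> borel_measurable lebesgue" "v \<in> borel_measurable lebesgue" "A \<in> borel_measurable lebesgue"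
    and out: "\<And>x. x \<notin> \<Omega> \<Longrightarrow> z x = 0 \<and> v x = 0 \<and> A x = 0"
    and A: "AE x in lebesgue. A x = max (z x - v x) 0"
    and int: "integrable \<nu> (\<lambda>t. flux p (gap z t) * gap A t)" "integrable \<nu> (\<lambda>t. flux p (gap v t) * gap A t)"
    and le: "(\<integral>t. flux p (gap z t) * gap A t \<partial>\<nu>) \<le> (\<integral>t. flux p (gap v t) * gap A t \<partial>\<nu>)"
  shows "AE x in lebesgue. z x \<le> v x"
proof -
  note [measurable] = meas gap_measurable[OF meas(1)] gap_measurable[OF meas(2)] gap_measurable[OF meas(3)]
  define D where "D t = (flux p (gap z t) - flux p (gap v t)) * gap A t" for t
  have [measurable]: "D \<in> borel_measurable L2" unfolding D_def by measurable
  have D0: "AE t in \<nu>. 0 \<le> D t"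
    using AE_nu_pair[OF A]
  proof eventually_elim
    case (elim t)
    have "0 \<le> (flux p (gap z t) - flux p (gap v t)) * gap A t"
      by (rule flux_diff_mult_nonneg[OF p(1)]) (use elim in \<open>auto simp: gap_def\<close>)
    then show ?case by (simp add: D_def)
  qed
  have Di: "integrable \<nu> D" using Bochner_Integration.integrable_diff[OF int] by (simp add: D_def[abs_def] left_diff_distrib)
  have "(\<integral>t. D t \<partial>\<nu>) = (\<integral>t. flux p (gap z t) * gap A t \<partial>\<nu>) - (\<integral>t. flux p (gap v t) * gap A t \<partial>\<nu>)"
    unfolding D_def left_diff_distrib using int by simp
  then have "(\<integral>t. D t \<partial>\<nu>) \<le> 0" using le by simp
  moreover have "(\<integral>\<^sup>+t. ennreal (D t) \<partial>\<nu>) = ennreal (\<integral>t. D t \<partial>\<nu>)" by (rule nn_integral_eq_integral[OF Di D0])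
  ultimately have D_zero: "(\<integral>\<^sup>+t. ennreal (D t) \<partial>\<nu>) = 0" by (simp add: ennreal_neg)
  define g where "g x = ennreal ((flux p (z x) - flux p (v x)) * A x)" for x
  have [measurable]: "g \<in> borel_measurable lebesgue" unfolding g_def by measurable
  obtain c where c: "0 < c" "\<forall>g G. g \<in> borel_measurable lebesgue \<longrightarrow> G \<in> borel_measurable L2 \<longrightarrow>
    (\<forall>x y. x \<in> \<Omega> \<longrightarrow> y \<notin> \<Omega> \<longrightarrow> g x \<le> G (x, y)) \<longrightarrow>
    ennreal c * (\<integral>\<^sup>+x. indicator \<Omega> x * g x \<partial>lebesgue) \<le> (\<integral>\<^sup>+z. G z \<partial>\<nu>)"
    using cross_lower by blast
  have "ennreal c * (\<integral>\<^sup>+x. indicator \<Omega> x * g x \<partial>lebesgue) \<le> (\<integral>\<^sup>+t. ennreal (D t) \<partial>\<nu>)"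
    by (rule c(2)[rule_format]) (auto simp: g_def D_def gap_def out)
  then have "(\<integral>\<^sup>+x. indicator \<Omega> x * g x \<partial>lebesgue) = 0" using D_zero c(1) by simp
  then have "AE x in lebesgue. indicator \<Omega> x * g x = 0" by (subst (asm) nn_integral_0_iff_AE) auto
  then show ?thesis using A
  proof eventually_elim
    case (elim x)
    show ?case
    proof (rule ccontr)
      assume "\<not> z x \<le> v x"
      then have "v x < z x" "0 < A x" "x \<in> \<Omega>" using elim out[of x] by auto
      then have "0 < (flux p (z x) - flux p (v x)) * A x" using flux_mono_strict[OF p(1)] by simp
      then have "0 < g x" unfolding g_def by simp
      moreover have "g x = 0" using elim(1) \<open>x \<in> \<Omega>\<close> by simp
      ultimately show False by simp
    qed
  qed
qed

section \<open>The entropy inequality and its scaling\<close>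

definition ent :: "('a \<Rightarrow> real) \<Rightarrow> real \<Rightarrow> ('a \<Rightarrow> real) \<Rightarrow> 'a \<times> 'a \<Rightarrow> real" where
  "ent u k \<phi> t = flux p (gap u t) * gap (\<lambda>x. trunc k (u x - \<phi> x)) t"

text \<open>The inequality separated from the condition on the tails. Integration is over all pairs,
  because the integrand vanishes when both points lie outside \<Omega>, and likewise the bound on
  \<phi> is global, because \<open>W\<close> vanishes there.\<close>

definition entropy_ineq :: "('a \<Rightarrow> real) \<Rightarrow> ('a \<Rightarrow> real) \<Rightarrow> bool" where
  "entropy_ineq f u \<longleftrightarrow> u \<in> borel_measurable lebesgue \<and> (\<forall>x. x \<notin> \<Omega> \<longrightarrow> u x = 0) \<and>
     (\<forall>k>0. W (\<lambda>x. trunc k (u x))) \<and>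
     (\<forall>k>0. \<forall>\<phi> C. W \<phi> \<and> (AE x in lebesgue. \<bar>\<phi> x\<bar> \<le> C) \<longrightarrow> integrable \<nu> (ent u k \<phi>) \<and>
        1/2 * (\<integral>t. ent u k \<phi> t \<partial>\<nu>) \<le> (\<integral>x. (indicator \<Omega> x * f x) * trunc k (u x - \<phi> x) \<partial>lebesgue))"

lemma entropy_solution_iff:
  "entropy_solution s p \<beta> \<Omega> f u \<longleftrightarrow> entropy_ineq f u \<and>
     ((\<lambda>h. \<integral>\<^sup>+ z. indicator (R_set u h) z * ennreal (\<bar>u (fst z) - u (snd z)\<bar> powr (p - 1)) \<partial>\<nu>) \<longlongrightarrow> 0) at_top"
proof (cases "\<forall>x. x \<notin> \<Omega> \<longrightarrow> u x = 0")
  case True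
  have eq: "indicator (D_set \<Omega>) z * (\<bar>u (fst z) - u (snd z)\<bar> powr (p - 2) * (u (fst z) - u (snd z)) *
      (trunc k (u (fst z) - \<phi> (fst z)) - trunc k (u (snd z) - \<phi> (snd z)))) = ent u k \<phi> z" if "W \<phi>" for k \<phi> z
    using True W_outside[OF that] by (cases z) (auto simp: ent_def flux_def gap_def indicator_def D_set_def)
  have bd: "(\<exists>C. AE x in lebesgue. x \<in> \<Omega> \<longrightarrow> \<bar>\<phi> x\<bar> \<le> C) \<longleftrightarrow> (\<exists>C. AE x in lebesgue. \<bar>\<phi> x\<bar> \<le> C)" if "W \<phi>" for \<phi>
  proof
    assume "\<exists>C. AE x in lebesgue. x \<in> \<Omega> \<longrightarrow> \<bar>\<phi> x\<bar> \<le> C"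
    then obtain C where "AE x in lebesgue. x \<in> \<Omega> \<longrightarrow> \<bar>\<phi> x\<bar> \<le> C" by blast
    then have "AE x in lebesgue. \<bar>\<phi> x\<bar> \<le> max C 0"
    proof eventually_elim
      case (elim x)
      then show ?case using W_outside[OF that, of x] by (cases "x \<in> \<Omega>") auto
    qed
    then show "\<exists>C. AE x in lebesgue. \<bar>\<phi> x\<bar> \<le> C" by blast
  next
    assume "\<exists>C. AE x in lebesgue. \<bar>\<phi> x\<bar> \<le> C"
    then show "\<exists>C. AE x in lebesgue. x \<in> \<Omega> \<longrightarrow> \<bar>\<phi> x\<bar> \<le> C" by (auto elim: eventually_mono)
  qed
  have "(\<forall>k>0. \<forall>\<phi>. W \<phi> \<and> (\<exists>C. AE x in lebesgue. x \<in> \<Omega> \<longrightarrow> \<bar>\<phi> x\<bar> \<le> C) \<longrightarrow>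
        (let F = (\<lambda>z. \<bar>u (fst z) - u (snd z)\<bar> powr (p - 2) * (u (fst z) - u (snd z)) *
                   (trunc k (u (fst z) - \<phi> (fst z)) - trunc k (u (snd z) - \<phi> (snd z))))
         in set_integrable \<nu> (D_set \<Omega>) F \<and>
            (1/2) * (\<integral>z\<in>D_set \<Omega>. F z \<partial>\<nu>) \<le> (\<integral>x\<in>\<Omega>. f x * trunc k (u x - \<phi> x) \<partial>lebesgue)))
    \<longleftrightarrow> (\<forall>k>0. \<forall>\<phi>. W \<phi> \<and> (\<exists>C. AE x in lebesgue. \<bar>\<phi> x\<bar> \<le> C) \<longrightarrow> integrable \<nu> (ent u k \<phi>) \<and>
        1/2 * (\<integral>t. ent u k \<phi> t \<partial>\<nu>) \<le> (\<integral>x. (indicator \<Omega> x * f x) * trunc k (u x - \<phi> x) \<partial>lebesgue))"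
    using eq bd unfolding Let_def set_integrable_def set_lebesgue_integral_def real_scaleR_def
    by (simp add: mult.assoc cong: conj_cong)
  then show ?thesis unfolding entropy_solution_def entropy_ineq_def by auto
next
  case False
  then show ?thesis unfolding entropy_solution_def entropy_ineq_def by blast
qed

lemma entropy_ineq_measurable: "entropy_ineq f u \<Longrightarrow> u \<in> borel_measurable lebesgue"
  by (simp add: entropy_ineq_def)

lemma entropy_ineq_outside: "entropy_ineq f u \<Longrightarrow> x \<notin> \<Omega> \<Longrightarrow> u x = 0"
  by (simp add: entropy_ineq_def)

lemma entropy_ineqD:
  assumes "entropy_ineq f u" "0 < k" "W \<phi>" "AE x in lebesgue. \<bar>\<phi> x\<bar> \<le> C"
  shows "integrable \<nu> (ent u k \<phi>)"
    and "1/2 * (\<integral>t. ent u k \<phi> t \<partial>\<nu>) \<le> (\<integral>x. (indicator \<Omega> x * f x) * trunc k (u x - \<phi> x) \<partial>lebesgue)"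
  using assms unfolding entropy_ineq_def by blast+

text \<open>The integrand for the test function 0 is integrable over all pairs by definition and
  dominates the p-th power of the increment of the truncation.\<close>

lemma entropy_ineq_trunc_X:
  assumes "entropy_ineq f u" "0 < k" shows "X (\<lambda>x. trunc k (u x))"
proof -
  have Wt: "W (\<lambda>x. trunc k (u x))" using assms by (simp add: entropy_ineq_def)
  have i: "integrable \<nu> (ent u k (\<lambda>x. 0))"
    by (rule entropy_ineqD(1)[OF assms X_W[OF X_zero], of 0]) simp
  have "integrable \<nu> (\<lambda>t. \<bar>gap (\<lambda>x. trunc k (u x)) t\<bar> powr p)"
  proof (rule Bochner_Integration.integrable_bound[OF i])
    note [measurable] = gap_measurable_nu[OF W_measurable[OF Wt]]
    show "(\<lambda>t. \<bar>gap (\<lambda>x. trunc k (u x)) t\<bar> powr p) \<in> borel_measurable \<nu>" by measurable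
    show "AE t in \<nu>. norm (\<bar>gap (\<lambda>x. trunc k (u x)) t\<bar> powr p) \<le> norm (ent u k (\<lambda>x. 0) t)"
    proof (rule AE_I2)
      fix t
      show "norm (\<bar>gap (\<lambda>x. trunc k (u x)) t\<bar> powr p) \<le> norm (ent u k (\<lambda>x. 0) t)"
        using flux_trunc_lower[OF p(1), of k "u (fst t)" "u (snd t)"] assms(2) by (simp add: ent_def gap_def)
    qed
  qed
  then show ?thesis using Wt by (simp add: X_def)
qed

text \<open>Testing \<open>c * u\<close> with \<phi> at level \<open>k\<close> is testing
  \<open>u\<close> with \<open>\<phi> / c\<close> at level \<open>k / c\<close>. The flux
  contributes \<open>c powr (p - 1)\<close>, which moves into the datum; the factor \<open>c\<close>
  of the truncation appears on both sides.\<close>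

lemma entropy_ineq_scale:
  assumes "entropy_ineq f u" "0 < c"
  shows "entropy_ineq (\<lambda>x. c powr (p - 1) * f x) (\<lambda>x. c * u x)"
  unfolding entropy_ineq_def
proof (intro conjI allI impI)
  note [measurable] = entropy_ineq_measurable[OF assms(1)]
  show "(\<lambda>x. c * u x) \<in> borel_measurable lebesgue" by measurable
  show "c * u x = 0" if "x \<notin> \<Omega>" for x using entropy_ineq_outside[OF assms(1) that] by simp
  show "W (\<lambda>x. trunc k (c * u x))" if "0 < k" for k
  proof -
    have "W (\<lambda>x. c * trunc (k / c) (u x))" using assms that by (intro W_cmult) (simp add: entropy_ineq_def)
    then show ?thesis using assms by (simp add: trunc_cmult)
  qed
  fix k :: real and \<phi> C assume k: "0 < k" and \<phi>: "W \<phi> \<and> (AE x in lebesgue. \<bar>\<phi> x\<bar> \<le> C)"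
  define \<psi> where "\<psi> x = 1 / c * \<phi> x" for x
  have W\<psi>: "W \<psi>" unfolding \<psi>_def using \<phi> by (intro W_cmult) simp
  have b\<psi>: "AE x in lebesgue. \<bar>\<psi> x\<bar> \<le> C / c"
    using \<phi>[THEN conjunct2] by eventually_elim (use assms in \<open>simp add: \<psi>_def abs_mult divide_right_mono\<close>)
  have kc: "0 < k / c" using k assms by simp
  note D = entropy_ineqD[OF assms(1) kc W\<psi> b\<psi>]
  have tr: "trunc k (c * u x - \<phi> x) = c * trunc (k / c) (u x - \<psi> x)" for x
    using trunc_cmult[OF assms(2), of k "u x - \<psi> x"] assms(2) by (simp add: \<psi>_def right_diff_distrib)
  have ge: "ent (\<lambda>x. c * u x) k \<phi> t = (c powr (p - 1) * c) * ent u (k / c) \<psi> t" for t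
    unfolding ent_def tr gap_cmult using assms(2) by (simp add: flux_cmult)
  show "integrable \<nu> (ent (\<lambda>x. c * u x) k \<phi>)" unfolding ge[abs_def] using D(1) by simp
  have "1/2 * (\<integral>t. ent (\<lambda>x. c * u x) k \<phi> t \<partial>\<nu>) = (c powr (p - 1) * c) * (1/2 * (\<integral>t. ent u (k / c) \<psi> t \<partial>\<nu>))"
    unfolding ge by simp
  also have "\<dots> \<le> (c powr (p - 1) * c) * (\<integral>x. (indicator \<Omega> x * f x) * trunc (k / c) (u x - \<psi> x) \<partial>lebesgue)"
    using D(2) assms(2) by (intro mult_left_mono) auto
  also have "\<dots> = (\<integral>x. (c powr (p - 1) * c) * ((indicator \<Omega> x * f x) * trunc (k / c) (u x - \<psi> x)) \<partial>lebesgue)"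
    by simp
  also have "\<dots> = (\<integral>x. (indicator \<Omega> x * (c powr (p - 1) * f x)) * trunc k (c * u x - \<phi> x) \<partial>lebesgue)"
    unfolding tr by (intro Bochner_Integration.integral_cong) (auto simp: mult_ac)
  finally show "1/2 * (\<integral>t. ent (\<lambda>x. c * u x) k \<phi> t \<partial>\<nu>)
    \<le> (\<integral>x. (indicator \<Omega> x * (c powr (p - 1) * f x)) * trunc k (c * u x - \<phi> x) \<partial>lebesgue)" .
qed

section \<open>Comparison principles for obstacle solutions\<close>

lemma obstacle_solD:
  assumes "obstacle_sol M F z"
  shows "X z" "\<bar>z x\<bar> \<le> M"
    "X v \<Longrightarrow> (\<And>x. \<bar>v x\<bar> \<le> M) \<Longrightarrow>
       (\<integral>x. F x * (v x - z x) \<partial>lebesgue) \<le> 1/2 * (\<integral>t. flux p (gap z t) * (gap v t - gap z t) \<partial>\<nu>)"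
  using assms unfolding obstacle_sol_def by auto

text \<open>The competitor is \<open>z - A\<close>; the next lemma uses \<open>z + A\<close> and
  obtains the reverse inequality. The obstacle problem thus behaves like an equation in every
  direction that stays between the obstacles.\<close>

lemma obstacle_sol_sub:
  assumes "obstacle_sol M F z" "X A" "\<And>x. \<bar>z x - A x\<bar> \<le> M"
  shows "1/2 * (\<integral>t. flux p (gap z t) * gap A t \<partial>\<nu>) \<le> (\<integral>x. F x * A x \<partial>lebesgue)"
  using obstacle_solD(3)[OF assms(1) X_diff[OF obstacle_solD(1)[OF assms(1)] assms(2)] assms(3)]
  by (simp add: gap_diff)

lemma obstacle_sol_super:
  assumes "obstacle_sol M F z" "X A" "\<And>x. \<bar>z x + A x\<bar> \<le> M"
  shows "(\<integral>x. F x * A x \<partial>lebesgue) \<le> 1/2 * (\<integral>t. flux p (gap z t) * gap A t \<partial>\<nu>)"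
  using obstacle_solD(3)[OF assms(1) X_add[OF obstacle_solD(1)[OF assms(1)] assms(2)] assms(3)]
  by (simp add: gap_add)

text \<open>With \<open>A\<close> the negative part of \<open>z\<close>, the competitor
  \<open>z + A\<close> is the positive part of \<open>z\<close> and hence admissible; the comparison
  is with the zero function.\<close>

lemma obstacle_sol_nonneg_exists:
  assumes F: "integrable lebesgue F" "AE x in lebesgue. 0 \<le> F x" and M: "0 \<le> M"
  shows "\<exists>z. obstacle_sol M F z \<and> (\<forall>x. 0 \<le> z x)"
proof -
  obtain z where z: "obstacle_sol M F z" using obstacle_sol_exists[OF F(1) M] .
  note Xz = obstacle_solD(1)[OF z]
  define A where "A x = max (0 - z x) 0" for x
  have XA: "X A" unfolding A_def by (intro X_max X_diff X_zero Xz)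
  note [measurable] = X_measurable[OF Xz] X_measurable[OF XA]
  have bd: "\<bar>z x + A x\<bar> \<le> M" for x using obstacle_solD(2)[OF z, of x] by (auto simp: A_def max_def)
  have "0 \<le> (\<integral>x. F x * A x \<partial>lebesgue)"
    by (rule integral_nonneg_AE) (use F(2) in eventually_elim, simp add: A_def)
  also have "\<dots> \<le> 1/2 * (\<integral>t. flux p (gap z t) * gap A t \<partial>\<nu>)" by (rule obstacle_sol_super[OF z XA bd])
  finally have le: "0 \<le> (\<integral>t. flux p (gap z t) * gap A t \<partial>\<nu>)" by simp
  have pos: "AE x in lebesgue. 0 \<le> z x"
    by (rule compare_core[of "\<lambda>x. 0" z A])
       (use le X_outside[OF Xz] X_outside[OF XA] integrable_flux[OF Xz XA] integrable_flux[OF X_zero XA] in \<open>auto simp: A_def gap_def\<close>)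
  \<comment> \<open>Comparison gives positivity a.e. only; the positive part is a version that is
    nonnegative at every point, so that later pointwise bounds need no exceptional sets.\<close>
  define z' where "z' x = max (z x) 0" for x
  have Xz': "X z'" unfolding z'_def by (intro X_max X_zero Xz)
  note [measurable] = X_measurable[OF Xz']
  have eq: "AE x in lebesgue. z' x = z x" using pos by eventually_elim (simp add: z'_def)
  from AE_nu_pair[OF eq] have geq: "AE t in \<nu>. gap z' t = gap z t" by eventually_elim (simp add: gap_def)
  have "obstacle_sol M F z'"
    unfolding obstacle_sol_def
  proof (intro conjI allI impI Xz')
    show "\<bar>z' x\<bar> \<le> M" for x using obstacle_solD(2)[OF z, of x] M by (simp add: z'_def)
    fix v assume v: "X v \<and> (\<forall>x. \<bar>v x\<bar> \<le> M)"
    note [measurable] = X_measurable[OF v[THEN conjunct1]] borel_measurable_integrable[OF F(1)]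
      gap_measurable_nu[OF X_measurable[OF v[THEN conjunct1]]] gap_measurable_nu[OF X_measurable[OF Xz]] gap_measurable_nu[OF X_measurable[OF Xz']]
    have "(\<integral>x. F x * (v x - z' x) \<partial>lebesgue) = (\<integral>x. F x * (v x - z x) \<partial>lebesgue)"
      by (rule integral_cong_AE) (auto intro: eventually_mono[OF eq])
    moreover have "(\<integral>t. flux p (gap z' t) * (gap v t - gap z' t) \<partial>\<nu>) = (\<integral>t. flux p (gap z t) * (gap v t - gap z t) \<partial>\<nu>)"
      by (rule integral_cong_AE) (auto intro: eventually_mono[OF geq])
    ultimately show "(\<integral>x. F x * (v x - z' x) \<partial>lebesgue) \<le> 1/2 * (\<integral>t. flux p (gap z' t) * (gap v t - gap z' t) \<partial>\<nu>)"
      using obstacle_solD(3)[OF z] v by simp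
  qed
  then show ?thesis by (intro exI[of _ z']) (simp add: z'_def)
qed

text \<open>The test function is the positive part of \<open>z1 - z2\<close>. Then
  \<open>z1 - A\<close> is the minimum and \<open>z2 + A\<close> the maximum of the two solutions;
  both are admissible because \<open>M1 \<le> M2\<close> and \<open>z2\<close> is
  nonnegative.\<close>

lemma obstacle_sol_mono:
  assumes z1: "obstacle_sol M1 F1 z1" and z2: "obstacle_sol M2 F2 z2" and M: "M1 \<le> M2"
    and nn: "\<And>x. 0 \<le> z2 x"
    and F: "integrable lebesgue F1" "integrable lebesgue F2" "AE x in lebesgue. F1 x \<le> F2 x"
  shows "AE x in lebesgue. z1 x \<le> z2 x"
proof -
  note X1 = obstacle_solD(1)[OF z1] and X2 = obstacle_solD(1)[OF z2]
  define A where "A x = max (z1 x - z2 x) 0" for x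
  have XA: "X A" unfolding A_def by (intro X_max X_diff X_zero X1 X2)
  have b1: "\<bar>z1 x - A x\<bar> \<le> M1" for x
    using obstacle_solD(2)[OF z1, of x] nn[of x] by (auto simp: A_def max_def)
  have b2: "\<bar>z2 x + A x\<bar> \<le> M2" for x
    using obstacle_solD(2)[OF z2, of x] obstacle_solD(2)[OF z1, of x] M by (auto simp: A_def max_def)
  have A_bd: "AE x in lebesgue. \<bar>A x\<bar> \<le> M1"
    using obstacle_solD(2)[OF z1] nn by (intro AE_I2) (smt (verit) A_def)
  have "1/2 * (\<integral>t. flux p (gap z1 t) * gap A t \<partial>\<nu>) \<le> (\<integral>x. F1 x * A x \<partial>lebesgue)"
    by (rule obstacle_sol_sub[OF z1 XA b1])
  also have "\<dots> \<le> (\<integral>x. F2 x * A x \<partial>lebesgue)"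
  proof (rule integral_mono_AE)
    show "AE x in lebesgue. F1 x * A x \<le> F2 x * A x"
      using F(3) by eventually_elim (intro mult_right_mono, auto simp: A_def)
  qed (intro integrable_mult_bounded[OF F(1) X_measurable[OF XA] A_bd] integrable_mult_bounded[OF F(2) X_measurable[OF XA] A_bd])+
  also have "\<dots> \<le> 1/2 * (\<integral>t. flux p (gap z2 t) * gap A t \<partial>\<nu>)" by (rule obstacle_sol_super[OF z2 XA b2])
  finally show ?thesis
    by (intro compare_core[of z1 z2 A] X_measurable X1 X2 XA integrable_flux)
       (auto simp: X_outside[OF X1] X_outside[OF X2] A_def)
qed

text \<open>Testing the entropy inequality of \<open>v\<close> with \<open>max z (trunc h v)\<close> produces \<open>- (z - v)\<^sup>+\<close> plus
  a term of nonnegative energy that is supported where \<open>v > h\<close>.\<close>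

lemma obstacle_sol_le_entropy:
  assumes z: "obstacle_sol M F z" and M: "0 < M" and F: "integrable lebesgue F"
    and v: "entropy_ineq f v" "AE x in lebesgue. 0 \<le> v x"
    and f: "integrable lebesgue (\<lambda>x. indicator \<Omega> x * f x)"
    and le: "AE x in lebesgue. F x \<le> indicator \<Omega> x * f x"
  shows "AE x in lebesgue. z x \<le> v x"
proof -
  note Xz = obstacle_solD(1)[OF z] and zM = obstacle_solD(2)[OF z]
  define fO where "fO x = indicator \<Omega> x * f x" for x
  \<comment> \<open>The truncation puts \<open>A\<close> into \<open>X\<close>, although
    \<open>v\<close> itself may have infinite energy. As \<open>z\<close> is at most
    \<open>M\<close> and \<open>v\<close> is nonnegative, \<open>A\<close> still equals the positive
    part of \<open>z - v\<close> a.e.\<close>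
  define A where "A x = max (z x - trunc M (v x)) 0" for x
  have XA: "X A" unfolding A_def using M by (intro X_max X_diff X_zero Xz entropy_ineq_trunc_X[OF v(1)])
  note [measurable] = entropy_ineq_measurable[OF v(1)] X_measurable[OF Xz] X_measurable[OF XA]
    gap_measurable_nu[OF entropy_ineq_measurable[OF v(1)]] gap_measurable_nu[OF X_measurable[OF XA]]
  have A_eq: "AE x in lebesgue. A x = max (z x - v x) 0"
    using v(2)
  proof eventually_elim
    case (elim x)
    then show ?case using zM[of x] M by (auto simp: A_def trunc_def max_def min_def)
  qed
  have A_bd: "\<bar>A x\<bar> \<le> 2 * M" for x
    using zM[of x] abs_trunc_le[of M "v x"] M by (auto simp: A_def max_def)
  define \<phi> where "\<phi> h x = max (z x) (trunc h (v x))" for h x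
  have tW: "W (\<lambda>x. trunc h (v x))" if "0 < h" for h using v(1) that by (simp add: entropy_ineq_def)
  have \<phi>W: "W (\<phi> h)" if "0 < h" for h unfolding \<phi>_def using tW[OF that] X_W[OF Xz] by (rule W_max[rotated])
  have \<phi>b: "AE x in lebesgue. \<bar>\<phi> h x\<bar> \<le> M + h" if "0 < h" for h
  proof (rule AE_I2)
    show "\<bar>\<phi> h x\<bar> \<le> M + h" for x
      using zM[of x] abs_trunc_le[of h "v x"] that M by (auto simp: \<phi>_def max_def)
  qed
  have tb: "AE x in lebesgue. \<bar>trunc h (v x)\<bar> \<le> h" if "0 < h" for h using that by (simp add: abs_trunc_le)
  \<comment> \<open>Where \<open>z\<close> is above \<open>trunc h v\<close>,
    \<open>v < z \<le> M \<le> h\<close>, and \<open>v - z\<close> lies between \<open>- M\<close>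
    and 0, so the truncation at level \<open>M\<close> leaves it intact; elsewhere \<open>A\<close>
    vanishes and \<phi> is \<open>trunc h v\<close>.\<close>
  have split: "AE x in lebesgue. trunc M (v x - \<phi> h x) = trunc M (v x - trunc h (v x)) - A x" if "M \<le> h" for h
    using v(2)
  proof eventually_elim
    case (elim x)
    then show ?case using zM[of x] M that by (auto simp: A_def \<phi>_def trunc_def max_def min_def)
  qed
  have ent_split: "AE t in \<nu>. ent v M (\<phi> h) t = ent v M (\<lambda>x. trunc h (v x)) t - flux p (gap v t) * gap A t" if "M \<le> h" for h
    using AE_nu_pair[OF split[OF that]]
  proof eventually_elim
    case (elim t)
    then have "gap (\<lambda>x. trunc M (v x - \<phi> h x)) t = gap (\<lambda>x. trunc M (v x - trunc h (v x))) t - gap A t"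
      unfolding gap_def by linarith
    then show ?case by (simp add: ent_def right_diff_distrib)
  qed
  have i1: "integrable \<nu> (ent v M (\<phi> h))" "integrable \<nu> (ent v M (\<lambda>x. trunc h (v x)))" if "0 < h" for h
    using entropy_ineqD(1)[OF v(1) M \<phi>W[OF that] \<phi>b[OF that]] entropy_ineqD(1)[OF v(1) M tW[OF that] tb[OF that]] by auto
  have iA: "integrable \<nu> (\<lambda>t. flux p (gap v t) * gap A t)"
  proof (rule integrable_cong_AE_imp)
    show "integrable \<nu> (\<lambda>t. ent v M (\<lambda>x. trunc M (v x)) t - ent v M (\<phi> M) t)" using i1[OF M] by simp
    show "AE t in \<nu>. ent v M (\<lambda>x. trunc M (v x)) t - ent v M (\<phi> M) t = flux p (gap v t) * gap A t"
      using ent_split[of M] by auto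
  qed measurable
  have ent_nn: "0 \<le> ent v M (\<lambda>x. trunc h (v x)) t" if "0 < h" for h t
    unfolding ent_def
  proof (rule flux_mult_nonneg[OF p(1)])
    have mono: "trunc M (a - trunc h a) \<le> trunc M (b - trunc h b)" if "a \<le> b" for a b
      by (rule trunc_mono) (use that \<open>0 < h\<close> in \<open>auto simp: trunc_def max_def min_def\<close>)
    show "gap v t \<le> 0 \<longrightarrow> gap (\<lambda>x. trunc M (v x - trunc h (v x))) t \<le> 0"
      "0 \<le> gap v t \<longrightarrow> 0 \<le> gap (\<lambda>x. trunc M (v x - trunc h (v x))) t"
      using mono by (auto simp: gap_def)
  qed
  have step: "- (1/2 * (\<integral>t. flux p (gap v t) * gap A t \<partial>\<nu>)) \<le> (\<integral>x. fO x * trunc M (v x - \<phi> h x) \<partial>lebesgue)" if "M \<le> h" for h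
  proof -
    have h: "0 < h" using that M by simp
    have "(\<integral>t. ent v M (\<phi> h) t \<partial>\<nu>) = (\<integral>t. ent v M (\<lambda>x. trunc h (v x)) t - flux p (gap v t) * gap A t \<partial>\<nu>)"
      using ent_split[OF that] i1[OF h] iA by (intro integral_cong_AE) auto
    also have "\<dots> = (\<integral>t. ent v M (\<lambda>x. trunc h (v x)) t \<partial>\<nu>) - (\<integral>t. flux p (gap v t) * gap A t \<partial>\<nu>)"
      using i1[OF h] iA by simp
    also have "\<dots> \<ge> - (\<integral>t. flux p (gap v t) * gap A t \<partial>\<nu>)"
      using ent_nn[OF h] by simp
    finally have "- (1/2 * (\<integral>t. flux p (gap v t) * gap A t \<partial>\<nu>)) \<le> 1/2 * (\<integral>t. ent v M (\<phi> h) t \<partial>\<nu>)" by simp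
    also have "\<dots> \<le> (\<integral>x. fO x * trunc M (v x - \<phi> h x) \<partial>lebesgue)"
      unfolding fO_def by (rule entropy_ineqD(2)[OF v(1) M \<phi>W[OF h] \<phi>b[OF h]])
    finally show ?thesis .
  qed
  have fOi: "integrable lebesgue fO" using f by (simp add: fO_def[abs_def])
  note [measurable] = borel_measurable_integrable[OF fOi]
  \<comment> \<open>At a fixed point \<open>trunc h (v x) = v x\<close> once \<open>h\<close> is at
    least \<open>\<bar>v x\<bar>\<close>, so the extra term disappears pointwise, under the
    integrable bound \<open>M * \<bar>fO x\<bar>\<close>.\<close>
  have "(\<lambda>n. \<integral>x. fO x * trunc M (v x - \<phi> (M + real n) x) \<partial>lebesgue) \<longlonglongrightarrow> (\<integral>x. fO x * (- A x) \<partial>lebesgue)"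
  proof (rule integral_dominated_convergence[where w="\<lambda>x. M * \<bar>fO x\<bar>"])
    have "AE x in lebesgue. \<forall>n. trunc M (v x - \<phi> (M + real n) x) = trunc M (v x - trunc (M + real n) (v x)) - A x"
      unfolding AE_all_countable by (intro allI split) simp
    then show "AE x in lebesgue. (\<lambda>n. fO x * trunc M (v x - \<phi> (M + real n) x)) \<longlonglongrightarrow> fO x * (- A x)"
    proof eventually_elim
      case (elim x)
      obtain N where N: "\<bar>v x\<bar> \<le> real N" using real_arch_simple by blast
      have "\<forall>\<^sub>F n in sequentially. fO x * trunc M (v x - \<phi> (M + real n) x) = fO x * (- A x)"
        using eventually_ge_at_top[of N]
      proof eventually_elim
        case (elim n)
        then have "\<bar>v x\<bar> \<le> M + real n" using N M by linarith
        then have "trunc (M + real n) (v x) = v x" by (rule trunc_id)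
        then show ?case using \<open>\<forall>n. trunc M (v x - \<phi> (M + real n) x) = _ n\<close> M by simp
      qed
      then show ?case by (rule tendsto_eventually)
    qed
    show "AE x in lebesgue. norm (fO x * trunc M (v x - \<phi> (M + real n) x)) \<le> M * \<bar>fO x\<bar>" for n
    proof (rule AE_I2)
      show "norm (fO x * trunc M (v x - \<phi> (M + real n) x)) \<le> M * \<bar>fO x\<bar>" for x
        using mult_right_mono[OF abs_trunc_le[of M "v x - \<phi> (M + real n) x"], of "\<bar>fO x\<bar>"] M
        by (simp add: abs_mult mult.commute)
    qed
    show "(\<lambda>x. fO x * trunc M (v x - \<phi> (M + real n) x)) \<in> borel_measurable lebesgue" for n
      unfolding \<phi>_def by measurable
  qed (use fOi in auto)
  then have "- (1/2 * (\<integral>t. flux p (gap v t) * gap A t \<partial>\<nu>)) \<le> (\<integral>x. fO x * (- A x) \<partial>lebesgue)"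
    by (rule LIMSEQ_le_const) (use step in auto)
  then have up: "(\<integral>x. fO x * A x \<partial>lebesgue) \<le> 1/2 * (\<integral>t. flux p (gap v t) * gap A t \<partial>\<nu>)" by simp
  have b1: "\<bar>z x - A x\<bar> \<le> M" for x
    using zM[of x] abs_trunc_le[of M "v x"] M by (auto simp: A_def max_def)
  have "1/2 * (\<integral>t. flux p (gap z t) * gap A t \<partial>\<nu>) \<le> (\<integral>x. F x * A x \<partial>lebesgue)"
    by (rule obstacle_sol_sub[OF z XA b1])
  also have "\<dots> \<le> (\<integral>x. fO x * A x \<partial>lebesgue)"
  proof (rule integral_mono_AE)
    show "AE x in lebesgue. F x * A x \<le> fO x * A x"
      using le by eventually_elim (intro mult_right_mono, auto simp: A_def fO_def)
    show "integrable lebesgue (\<lambda>x. F x * A x)" "integrable lebesgue (\<lambda>x. fO x * A x)"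
      using A_bd by (auto intro!: integrable_mult_bounded[where M="2 * M"] F fOi)
  qed
  also note up
  finally show ?thesis
    using A_eq iA integrable_flux[OF Xz XA]
    by (intro compare_core[of z v A]) (auto simp: X_outside[OF Xz] X_outside[OF XA] entropy_ineq_outside[OF v(1)])
qed

lemma obstacle_sol_entropy:
  assumes z: "obstacle_sol M F z" and \<phi>: "X \<phi>" "\<And>x. \<bar>\<phi> x\<bar> \<le> M" and k: "0 \<le> k"
  shows "integrable \<nu> (ent z k \<phi>)"
    and "1/2 * (\<integral>t. ent z k \<phi> t \<partial>\<nu>) \<le> (\<integral>x. F x * trunc k (z x - \<phi> x) \<partial>lebesgue)"
proof -
  have XT: "X (\<lambda>x. trunc k (z x - \<phi> x))" by (intro X_trunc X_diff obstacle_solD(1)[OF z] \<phi> k)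
  show "integrable \<nu> (ent z k \<phi>)"
    using integrable_flux[OF obstacle_solD(1)[OF z] XT] by (simp add: ent_def[abs_def])
  have "\<bar>z x - trunc k (z x - \<phi> x)\<bar> \<le> M" for x
    using obstacle_solD(2)[OF z, of x] \<phi>(2)[of x] k by (auto simp: trunc_def max_def min_def)
  from obstacle_sol_sub[OF z XT this]
  show "1/2 * (\<integral>t. ent z k \<phi> t \<partial>\<nu>) \<le> (\<integral>x. F x * trunc k (z x - \<phi> x) \<partial>lebesgue)" by (simp add: ent_def)
qed

end

section \<open>The minimal solution\<close>

text \<open>Clamping to an interval is 1-Lipschitz in the endpoint and in the argument separately.
  It bounds the increments of a test function clamped between plus and minus the modulus of another
  function.\<close>

lemma clamp_lipschitz:
  fixes a b c d :: real
  shows "\<bar>max (- \<bar>a\<bar>) (min \<bar>a\<bar> c) - max (- \<bar>b\<bar>) (min \<bar>b\<bar> d)\<bar> \<le> \<bar>a - b\<bar> + \<bar>c - d\<bar>"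
proof -
  have "\<bar>max (- m) (min m c) - max (- n) (min n c)\<bar> \<le> \<bar>m - n\<bar>" if "0 \<le> m" "0 \<le> n" for m n :: real
    using that by (auto simp: max_def min_def)
  from this[of "\<bar>a\<bar>" "\<bar>b\<bar>"]
  have 1: "\<bar>max (- \<bar>a\<bar>) (min \<bar>a\<bar> c) - max (- \<bar>b\<bar>) (min \<bar>b\<bar> c)\<bar> \<le> \<bar>a - b\<bar>"
    using abs_triangle_ineq3[of a b] by simp
  have 2: "\<bar>max (- \<bar>b\<bar>) (min \<bar>b\<bar> c) - max (- \<bar>b\<bar>) (min \<bar>b\<bar> d)\<bar> \<le> \<bar>c - d\<bar>"
    by (auto simp: max_def min_def)
  have "\<bar>x - z\<bar> \<le> e + f" if "\<bar>x - y\<bar> \<le> e" "\<bar>y - z\<bar> \<le> f" for x y z e f :: real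
    using that by linarith
  from this[OF 1 2] show ?thesis .
qed

context weighted_domain
begin

lemma ent_lim:
  assumes u: "AE x in lebesgue. (\<lambda>n. un n x) \<longlonglongrightarrow> u x" and \<phi>: "AE x in lebesgue. (\<lambda>n. \<phi>n n x) \<longlonglongrightarrow> \<phi> x"
  shows "AE t in \<nu>. (\<lambda>n. ent (un n) k (\<phi>n n) t) \<longlonglongrightarrow> ent u k \<phi> t"
  using AE_nu_pair[OF u] AE_nu_pair[OF \<phi>]
proof eventually_elim
  case (elim t)
  then show ?case unfolding ent_def gap_def
    by (intro tendsto_mult tendsto_flux p tendsto_diff tendsto_trunc) auto
qed

lemma ent_measurable:
  assumes [measurable]: "u \<in> borel_measurable lebesgue" "\<phi> \<in> borel_measurable lebesgue"
  shows "ent u k \<phi> \<in> borel_measurable \<nu>"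
proof -
  have [measurable]: "(\<lambda>x. trunc k (u x - \<phi> x)) \<in> borel_measurable lebesgue" by measurable
  note [measurable] = gap_measurable_nu[OF assms(1)] gap_measurable_nu[OF this]
  show ?thesis unfolding ent_def[abs_def] by measurable
qed

text \<open>The pointwise bound of \<open>flux_entropy_lower\<close>, split by Young's inequality.
  The weight \<open>e\<close> decides whether the energy of the truncation or that of the test
  function receives the small coefficient; the two passages to the limit below need one choice
  each.\<close>

lemma ent_lower:
  assumes "0 \<le> k" "\<And>x. 0 \<le> u x" "\<And>x. \<bar>\<phi> x\<bar> \<le> C" "0 < e"
  shows "- (e * \<bar>gap (\<lambda>x. trunc (k + C) (u x)) t\<bar> powr p + e powr (1 - p) * \<bar>gap \<phi> t\<bar> powr p) \<le> ent u k \<phi> t"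
proof -
  have "- (\<bar>gap (\<lambda>x. trunc (k + C) (u x)) t\<bar> powr (p - 1) * \<bar>gap \<phi> t\<bar>) \<le> ent u k \<phi> t"
    unfolding ent_def gap_def by (rule flux_entropy_lower[OF p(1) assms(1)]) (use assms in auto)
  moreover have "\<bar>gap (\<lambda>x. trunc (k + C) (u x)) t\<bar> powr (p - 1) * \<bar>gap \<phi> t\<bar>
      \<le> e * \<bar>gap (\<lambda>x. trunc (k + C) (u x)) t\<bar> powr p + e powr (1 - p) * \<bar>gap \<phi> t\<bar> powr p"
    by (rule powr_young[OF p(1) assms(4)]) auto
  ultimately show ?thesis by linarith
qed

lemma integrable_nuD_indicator:
  fixes f :: "'a \<times> 'a \<Rightarrow> real"
  assumes [measurable]: "f \<in> borel_measurable L2" and "\<And>t. 0 \<le> f t" "integrable nuD f"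
  shows "integrable \<nu> (\<lambda>t. indicator (\<Omega> \<times> \<Omega>) t * f t)" and "(\<integral>t. indicator (\<Omega> \<times> \<Omega>) t * f t \<partial>\<nu>) = (\<integral>t. f t \<partial>nuD)"
proof -
  have [measurable]: "f \<in> borel_measurable \<nu>" by measurable
  have eq: "(\<integral>\<^sup>+t. ennreal (indicator (\<Omega> \<times> \<Omega>) t * f t) \<partial>\<nu>) = (\<integral>\<^sup>+t. ennreal (f t) \<partial>nuD)"
    using assms by (subst nn_integral_nuD) (auto intro!: nn_integral_cong simp: indicator_def)
  have fin: "(\<integral>\<^sup>+t. ennreal (f t) \<partial>nuD) = ennreal (\<integral>t. f t \<partial>nuD)"
    using assms by (intro nn_integral_eq_integral) auto
  show i: "integrable \<nu> (\<lambda>t. indicator (\<Omega> \<times> \<Omega>) t * f t)"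
    by (rule integrableI_nonneg) (use assms(2) eq fin in \<open>auto simp: indicator_def\<close>)
  have "ennreal (\<integral>t. indicator (\<Omega> \<times> \<Omega>) t * f t \<partial>\<nu>) = ennreal (\<integral>t. f t \<partial>nuD)"
    using eq fin nn_integral_eq_integral[OF i] assms(2) by (simp add: indicator_def)
  then show "(\<integral>t. indicator (\<Omega> \<times> \<Omega>) t * f t \<partial>\<nu>) = (\<integral>t. f t \<partial>nuD)"
    using assms(2) by (subst (asm) ennreal_inj) (auto intro!: integral_nonneg_AE)
qed

end

text \<open>An arbitrary supersolution \<open>S\<close> with datum \<open>G\<close>. The hypothesis
  that \<open>w powr q\<close> lies below \<open>g\<close> enters only through
  \<open>dominates\<close>, when the locale is instantiated with twice \<open>w\<close>.\<close>

locale supersolution = weighted_domain s p \<beta> \<Omega> for s p \<beta> :: real and \<Omega> :: "'a::euclidean_space set" +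
  fixes q lam :: real and g G S :: "'a \<Rightarrow> real"
  assumes q: "0 < q" and lam: "0 < lam"
    and g_measurable [measurable]: "g \<in> borel_measurable lebesgue"
    and g_integrable: "integrable lebesgue (\<lambda>x. indicator \<Omega> x * g x)"
    and g_nonneg: "AE x in lebesgue. x \<in> \<Omega> \<longrightarrow> 0 \<le> g x"
    and S: "entropy_ineq G S" "AE x in lebesgue. 0 \<le> S x"
    and G_integrable: "integrable lebesgue (\<lambda>x. indicator \<Omega> x * G x)"
    and dominates: "AE x in lebesgue. x \<in> \<Omega> \<longrightarrow> lam * S x powr q + g x \<le> G x"
begin

definition rhs :: "('a \<Rightarrow> real) \<Rightarrow> 'a \<Rightarrow> real" where
  "rhs v x = indicator \<Omega> x * (lam * v x powr q + g x)"

lemma rhs_mono: "0 \<le> v x \<Longrightarrow> v x \<le> w x \<Longrightarrow> rhs v x \<le> rhs w x"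
  unfolding rhs_def using q lam by (intro mult_left_mono add_right_mono powr_mono2) auto

lemma rhs_nonneg: "AE x in lebesgue. 0 \<le> rhs v x"
  using g_nonneg by eventually_elim (use lam in \<open>auto simp: rhs_def indicator_def\<close>)

lemma rhs_measurable [measurable]:
  assumes [measurable]: "v \<in> borel_measurable lebesgue" shows "rhs v \<in> borel_measurable lebesgue"
  unfolding rhs_def[abs_def] by measurable

lemma rhs_integrable:
  assumes [measurable]: "v \<in> borel_measurable lebesgue" and v: "\<And>x. 0 \<le> v x" "\<And>x. v x \<le> M"
  shows "integrable lebesgue (rhs v)"
proof -
  have "integrable lebesgue (\<lambda>x. indicator \<Omega> x :: real)"
    using emeasure_domain by (intro integrable_real_indicator) auto
  then have "integrable lebesgue (\<lambda>x. indicator \<Omega> x * (lam * v x powr q))"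
    by (rule integrable_mult_bounded[where M="lam * M powr q"])
       (use v q lam in \<open>auto intro!: powr_mono2 simp: abs_mult\<close>)
  from Bochner_Integration.integrable_add[OF this g_integrable]
  show ?thesis unfolding rhs_def[abs_def] by (simp add: distrib_left)
qed

text \<open>The obstacle grows with \<open>n\<close>, so every bounded test function eventually
  becomes admissible. Since \<open>Z n\<close> is at most \<open>n\<close> and \<Omega> has finite
  measure, the datum of the next step is integrable and the choice is legitimate.\<close>

primrec Z :: "nat \<Rightarrow> 'a \<Rightarrow> real" where
  "Z 0 = (\<lambda>x. 0)"
| "Z (Suc n) = (SOME z. obstacle_sol (real (Suc n)) (rhs (Z n)) z \<and> (\<forall>x. 0 \<le> z x))"

declare Z.simps(2) [simp del]

lemma Z_basic: "X (Z n) \<and> (\<forall>x. 0 \<le> Z n x \<and> Z n x \<le> real n)"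
  and Z_obstacle: "obstacle_sol (real (Suc n)) (rhs (Z n)) (Z (Suc n))"
proof -
  have step: "obstacle_sol (real (Suc n)) (rhs (Z n)) (Z (Suc n)) \<and> (\<forall>x. 0 \<le> Z (Suc n) x)"
    if "X (Z n) \<and> (\<forall>x. 0 \<le> Z n x \<and> Z n x \<le> real n)" for n
  proof -
    have i: "integrable lebesgue (rhs (Z n))" using that X_measurable by (intro rhs_integrable[of _ "real n"]) auto
    show ?thesis unfolding Z.simps(2)
      using someI_ex[OF obstacle_sol_nonneg_exists[OF i rhs_nonneg, of "real (Suc n)"]] by simp
  qed
  have all: "X (Z n) \<and> (\<forall>x. 0 \<le> Z n x \<and> Z n x \<le> real n)" for n
  proof (induction n)
    case (Suc n)
    have "Z (Suc n) x \<le> real (Suc n)" for x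
      using obstacle_solD(2)[OF step[OF Suc, THEN conjunct1], of x] by linarith
    then show ?case using step[OF Suc] obstacle_solD(1) by blast
  qed (simp add: X_zero)
  show "X (Z n) \<and> (\<forall>x. 0 \<le> Z n x \<and> Z n x \<le> real n)" by (rule all)
  show "obstacle_sol (real (Suc n)) (rhs (Z n)) (Z (Suc n))" using step[OF all] by blast
qed

lemma Z_X: "X (Z n)" and Z_nonneg: "0 \<le> Z n x" and Z_le_n: "Z n x \<le> real n"
  using Z_basic by auto

lemma Z_measurable [measurable]: "Z n \<in> borel_measurable lebesgue"
  by (rule X_measurable[OF Z_X])

lemma rhs_Z_integrable: "integrable lebesgue (rhs (Z n))"
  by (rule rhs_integrable[of _ "real n"]) (auto simp: Z_nonneg Z_le_n)

lemma Z_mono: "AE x in lebesgue. Z n x \<le> Z (Suc n) x"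
proof (induction n)
  case 0
  then show ?case using Z_nonneg[of "Suc 0"] by simp
next
  case (Suc n)
  have "AE x in lebesgue. rhs (Z n) x \<le> rhs (Z (Suc n)) x"
    using Suc by eventually_elim (rule rhs_mono[OF Z_nonneg])
  then show ?case
    by (intro obstacle_sol_mono[OF Z_obstacle Z_obstacle] Z_nonneg rhs_Z_integrable) simp_all
qed

text \<open>Comparison is kept up by induction, since \<open>rhs\<close> is monotone. It serves
  twice: with \<open>S\<close> it bounds the iterates, with a competing solution it gives
  minimality.\<close>

lemma Z_le_super:
  assumes v: "entropy_ineq f v" "AE x in lebesgue. 0 \<le> v x"
    and f: "integrable lebesgue (\<lambda>x. indicator \<Omega> x * f x)"
    and dom: "AE x in lebesgue. x \<in> \<Omega> \<longrightarrow> lam * v x powr q + g x \<le> f x"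
  shows "AE x in lebesgue. Z n x \<le> v x"
proof (induction n)
  case 0
  then show ?case using v(2) by simp
next
  case (Suc n)
  have "AE x in lebesgue. rhs (Z n) x \<le> indicator \<Omega> x * f x"
    using Suc dom
  proof eventually_elim
    case (elim x)
    have "rhs (Z n) x \<le> rhs v x" using elim by (intro rhs_mono Z_nonneg)
    also have "\<dots> \<le> indicator \<Omega> x * f x" using elim by (auto simp: rhs_def indicator_def)
    finally show ?case .
  qed
  then show ?case by (intro obstacle_sol_le_entropy[OF Z_obstacle _ rhs_Z_integrable v f]) simp
qed

text \<open>\<open>lim\<close> is unspecified on the null set of divergence; the maximum with 0
  makes the function nonnegative at every point.\<close>

definition sol :: "'a \<Rightarrow> real" where
  "sol x = max 0 (lim (\<lambda>n. Z n x))"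

lemma sol_nonneg: "0 \<le> sol x" by (simp add: sol_def)

lemma sol_measurable [measurable]: "sol \<in> borel_measurable lebesgue"
  unfolding sol_def[abs_def] by measurable

lemma sol_outside: "x \<notin> \<Omega> \<Longrightarrow> sol x = 0"
  using X_outside[OF Z_X] by (simp add: sol_def lim_const)

lemma Z_lim_below:
  assumes "AE x in lebesgue. \<forall>n. Z n x \<le> v x"
  shows "AE x in lebesgue. (\<lambda>n. Z n x) \<longlonglongrightarrow> sol x \<and> (\<forall>n. Z n x \<le> sol x) \<and> sol x \<le> v x"
proof -
  have "AE x in lebesgue. \<forall>n. Z n x \<le> Z (Suc n) x" unfolding AE_all_countable using Z_mono by blast
  then show ?thesis using assms
  proof eventually_elim
    case (elim x)
    have inc: "incseq (\<lambda>n. Z n x)" using elim by (simp add: incseq_Suc_iff)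
    obtain l where l: "(\<lambda>n. Z n x) \<longlonglongrightarrow> l" "\<And>n. Z n x \<le> l"
      using incseq_convergent[OF inc, of "v x"] elim by auto
    have "0 \<le> l" using l(2)[of 0] by simp
    then have "sol x = l" using limI[OF l(1)] by (simp add: sol_def)
    moreover have "l \<le> v x" using l(1) elim by (intro LIMSEQ_le_const2) auto
    ultimately show ?case using l by simp
  qed
qed

lemma sol_lim: "AE x in lebesgue. (\<lambda>n. Z n x) \<longlonglongrightarrow> sol x \<and> (\<forall>n. Z n x \<le> sol x) \<and> sol x \<le> S x"
  by (rule Z_lim_below) (use Z_le_super[OF S G_integrable dominates] in \<open>simp add: AE_all_countable\<close>)

lemma sol_minimal:
  assumes "entropy_ineq f v" "AE x in lebesgue. 0 \<le> v x"
    "integrable lebesgue (\<lambda>x. indicator \<Omega> x * f x)"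
    "AE x in lebesgue. x \<in> \<Omega> \<longrightarrow> lam * v x powr q + g x \<le> f x"
  shows "AE x in lebesgue. sol x \<le> v x"
proof -
  have "AE x in lebesgue. \<forall>n. Z n x \<le> v x" unfolding AE_all_countable using Z_le_super[OF assms] by blast
  from Z_lim_below[OF this] show ?thesis by eventually_elim simp
qed

lemma rhs_sol_integrable: "integrable lebesgue (rhs sol)"
proof (rule Bochner_Integration.integrable_bound[OF G_integrable])
  show "AE x in lebesgue. norm (rhs sol x) \<le> norm (indicator \<Omega> x * G x)"
    using sol_lim dominates rhs_nonneg[of sol]
  proof eventually_elim
    case (elim x)
    have "rhs sol x \<le> rhs S x" using elim by (intro rhs_mono sol_nonneg) auto
    also have "\<dots> \<le> indicator \<Omega> x * G x" using elim by (auto simp: rhs_def indicator_def)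
    finally show ?case using elim by simp
  qed
qed simp

lemma rhs_Z_lim: "AE x in lebesgue. (\<lambda>n. rhs (Z n) x) \<longlonglongrightarrow> rhs sol x \<and> (\<forall>n. \<bar>rhs (Z n) x\<bar> \<le> rhs sol x)"
proof -
  have "AE x in lebesgue. \<forall>n. 0 \<le> rhs (Z n) x" unfolding AE_all_countable using rhs_nonneg by blast
  then show ?thesis using sol_lim
  proof eventually_elim
    case (elim x)
    have "(\<lambda>n. Z n x powr q) \<longlonglongrightarrow> sol x powr q"
      using elim q Z_nonneg by (intro tendsto_powr' tendsto_const) auto
    then have "(\<lambda>n. rhs (Z n) x) \<longlonglongrightarrow> rhs sol x" unfolding rhs_def by (intro tendsto_mult tendsto_add tendsto_const)
    moreover have "\<bar>rhs (Z n) x\<bar> \<le> rhs sol x" for n using elim rhs_mono[of "Z n" x sol] Z_nonneg[of n x] by simp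
    ultimately show ?case by simp
  qed
qed

section \<open>Uniform energy bounds and passage to the limit\<close>

definition ebound :: "real \<Rightarrow> real" where
  "ebound k = 2 * (k * (\<integral>x. rhs sol x \<partial>lebesgue))"

text \<open>The test function is 0; the truncation is at most \<open>k\<close> and
  \<open>rhs (Z n)\<close> at most \<open>rhs sol\<close>, so the bound does not depend on
  \<open>n\<close>.\<close>

lemma energy_trunc_Z:
  assumes k: "0 \<le> k" shows "energy (\<lambda>x. trunc k (Z (Suc n) x)) \<le> ebound k"
proof -
  have XT: "X (\<lambda>x. trunc k (Z (Suc n) x))" by (intro X_trunc Z_X k)
  note e = obstacle_sol_entropy[OF Z_obstacle X_zero _ k, of n]
  have "energy (\<lambda>x. trunc k (Z (Suc n) x)) \<le> (\<integral>t. ent (Z (Suc n)) k (\<lambda>x. 0) t \<partial>\<nu>)"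
    unfolding energy_def
  proof (rule integral_mono)
    show "\<bar>gap (\<lambda>x. trunc k (Z (Suc n) x)) t\<bar> powr p \<le> ent (Z (Suc n)) k (\<lambda>x. 0) t" for t
      using flux_trunc_lower[OF p(1) k, of "Z (Suc n) (fst t)" "Z (Suc n) (snd t)"] by (simp add: ent_def gap_def)
  qed (use e X_energy[OF XT] in auto)
  also have "\<dots> \<le> 2 * (\<integral>x. rhs (Z n) x * trunc k (Z (Suc n) x - 0) \<partial>lebesgue)" using e(2) by simp
  also have "(\<integral>x. rhs (Z n) x * trunc k (Z (Suc n) x - 0) \<partial>lebesgue) \<le> (\<integral>x. k * rhs sol x \<partial>lebesgue)"
  proof (rule integral_mono_AE)
    show "integrable lebesgue (\<lambda>x. rhs (Z n) x * trunc k (Z (Suc n) x - 0))"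
      using abs_trunc_le[OF k] by (intro integrable_mult_bounded[OF rhs_Z_integrable, of _ k]) auto
    show "AE x in lebesgue. rhs (Z n) x * trunc k (Z (Suc n) x - 0) \<le> k * rhs sol x"
      using rhs_Z_lim
    proof eventually_elim
      case (elim x)
      then show ?case using abs_mult_trunc_le[OF k, of "rhs (Z n) x" "rhs sol x" "Z (Suc n) x - 0"] by auto
    qed
  qed (use rhs_sol_integrable in auto)
  finally show ?thesis by (simp add: ebound_def)
qed

lemma trunc_sol_X: assumes k: "0 \<le> k" shows "X (\<lambda>x. trunc k (sol x))"
proof (rule X_bounded_limit(1)[where vs="\<lambda>n x. trunc k (Z (Suc n) x)" and M=k and C="ebound k"])
  show "AE x in lebesgue. (\<lambda>n. trunc k (Z (Suc n) x)) \<longlonglongrightarrow> trunc k (sol x)"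
    using sol_lim
  proof eventually_elim
    case (elim x)
    then show ?case by (intro tendsto_trunc LIMSEQ_Suc) simp
  qed
qed (auto intro: X_trunc[OF Z_X k] energy_trunc_Z[OF k] simp: abs_trunc_le[OF k] sol_outside k)

text \<open>The negative part of the integrand is bounded by energies of truncated iterates, which
  are bounded but not known to converge, and by the energy of the fixed \<phi>. Young's weight makes
  the former small uniformly in \<open>n\<close>; the latter, with a large coefficient, is a fixed
  integrable function.\<close>

lemma sol_entropy_X:
  assumes \<phi>: "X \<phi>" "\<And>x. \<bar>\<phi> x\<bar> \<le> C" and k: "0 < k"
  shows "integrable \<nu> (ent sol k \<phi>) \<and> (\<integral>t. ent sol k \<phi> t \<partial>\<nu>) \<le> 2 * (\<integral>x. rhs sol x * trunc k (sol x - \<phi> x) \<partial>lebesgue)"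
proof -
  have k0: "0 \<le> k" using k by simp
  have C: "0 \<le> C" using \<phi>(2)[of 0] by (smt (verit) abs_ge_zero)
  \<comment> \<open>The first \<open>m\<close> iterates are dropped, so that \<phi> respects the
    obstacle of every remaining one.\<close>
  obtain m where m: "C \<le> real m" using real_arch_simple by blast
  define zn where "zn n = Z (Suc (n + m))" for n
  have znX: "X (zn n)" for n unfolding zn_def by (rule Z_X)
  have e: "integrable \<nu> (ent (zn n) k \<phi>)" "(\<integral>t. ent (zn n) k \<phi> t \<partial>\<nu>) \<le> 2 * (\<integral>x. rhs (Z (n + m)) x * trunc k (zn n x - \<phi> x) \<partial>lebesgue)" for n
  proof -
    have b: "\<bar>\<phi> x\<bar> \<le> real (Suc (n + m))" for x using \<phi>(2)[of x] m by simp
    show "integrable \<nu> (ent (zn n) k \<phi>)" "(\<integral>t. ent (zn n) k \<phi> t \<partial>\<nu>) \<le> 2 * (\<integral>x. rhs (Z (n + m)) x * trunc k (zn n x - \<phi> x) \<partial>lebesgue)"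
      using obstacle_sol_entropy[OF Z_obstacle \<phi>(1) b k0] unfolding zn_def by auto
  qed
  have zl: "AE x in lebesgue. (\<lambda>n. zn n x) \<longlonglongrightarrow> sol x"
    using sol_lim
  proof eventually_elim
    case (elim x)
    then show ?case unfolding zn_def using LIMSEQ_ignore_initial_segment[of "\<lambda>n. Z n x" "sol x" "Suc m"] by simp
  qed
  note [measurable] = X_measurable[OF \<phi>(1)] X_measurable[OF znX]
  have kC: "0 \<le> k + C" using k C by simp
  show ?thesis
  proof (rule fatou_small_defect[where F="\<lambda>n. ent (zn n) k \<phi>"
      and r="\<lambda>n. 2 * (\<integral>x. rhs (Z (n + m)) x * trunc k (zn n x - \<phi> x) \<partial>lebesgue)"
      and H="\<lambda>t. 1 * \<bar>gap (\<lambda>x. trunc (k + C) (sol x)) t\<bar> powr p + 1 powr (1 - p) * \<bar>gap \<phi> t\<bar> powr p"])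
    show "ent sol k \<phi> \<in> borel_measurable \<nu>" by (rule ent_measurable) measurable
    show "AE t in \<nu>. (\<lambda>n. ent (zn n) k \<phi> t) \<longlonglongrightarrow> ent sol k \<phi> t" by (rule ent_lim[OF zl]) simp
    show "integrable \<nu> (\<lambda>t. 1 * \<bar>gap (\<lambda>x. trunc (k + C) (sol x)) t\<bar> powr p + 1 powr (1 - p) * \<bar>gap \<phi> t\<bar> powr p)"
      using X_energy[OF trunc_sol_X[OF kC]] X_energy[OF \<phi>(1)] by auto
    show "AE t in \<nu>. - (1 * \<bar>gap (\<lambda>x. trunc (k + C) (sol x)) t\<bar> powr p + 1 powr (1 - p) * \<bar>gap \<phi> t\<bar> powr p) \<le> ent sol k \<phi> t"
      by (intro AE_I2 ent_lower k0 sol_nonneg \<phi>(2)) simp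
    show "(\<lambda>n. 2 * (\<integral>x. rhs (Z (n + m)) x * trunc k (zn n x - \<phi> x) \<partial>lebesgue)) \<longlonglongrightarrow> 2 * (\<integral>x. rhs sol x * trunc k (sol x - \<phi> x) \<partial>lebesgue)"
    proof (intro tendsto_mult tendsto_const, rule integral_dominated_convergence[where w="\<lambda>x. k * rhs sol x"])
      show "AE x in lebesgue. (\<lambda>n. rhs (Z (n + m)) x * trunc k (zn n x - \<phi> x)) \<longlonglongrightarrow> rhs sol x * trunc k (sol x - \<phi> x)"
        using rhs_Z_lim zl
      proof eventually_elim
        case (elim x)
        then show ?case
          by (intro tendsto_mult tendsto_trunc tendsto_diff tendsto_const LIMSEQ_ignore_initial_segment) auto
      qed
      show "AE x in lebesgue. norm (rhs (Z (n + m)) x * trunc k (zn n x - \<phi> x)) \<le> k * rhs sol x" for n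
        using rhs_Z_lim by eventually_elim (use abs_mult_trunc_le[OF k0] in auto)
    qed (use rhs_sol_integrable in auto)
    fix d :: real assume d: "0 < d"
    define B where "B = \<bar>ebound (k + C)\<bar>"
    \<comment> \<open>With this weight the energy term has integral at most \<open>d\<close>; the
      summand 1 prevents division by 0.\<close>
    define \<epsilon> where "\<epsilon> = d / (B + 1)"
    have \<epsilon>: "0 < \<epsilon>" using d by (simp add: \<epsilon>_def B_def)
    have XT: "X (\<lambda>x. trunc (k + C) (zn n x))" for n by (rule X_trunc[OF znX kC])
    show "\<exists>G Gn. integrable \<nu> G \<and> (\<forall>n. integrable \<nu> (Gn n) \<and> (\<integral>x. Gn n x \<partial>\<nu>) \<le> d
       \<and> (AE x in \<nu>. 0 \<le> Gn n x) \<and> (AE x in \<nu>. - (G x + Gn n x) \<le> ent (zn n) k \<phi> x))"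
    proof (rule exI[of _ "\<lambda>t. \<epsilon> powr (1 - p) * \<bar>gap \<phi> t\<bar> powr p"], rule exI[of _ "\<lambda>n t. \<epsilon> * \<bar>gap (\<lambda>x. trunc (k + C) (zn n x)) t\<bar> powr p"],
        intro conjI allI)
      show "integrable \<nu> (\<lambda>t. \<epsilon> powr (1 - p) * \<bar>gap \<phi> t\<bar> powr p)" using X_energy[OF \<phi>(1)] by simp
      fix n
      show "integrable \<nu> (\<lambda>t. \<epsilon> * \<bar>gap (\<lambda>x. trunc (k + C) (zn n x)) t\<bar> powr p)" using X_energy[OF XT] by simp
      have "(\<integral>t. \<epsilon> * \<bar>gap (\<lambda>x. trunc (k + C) (zn n x)) t\<bar> powr p \<partial>\<nu>) = \<epsilon> * energy (\<lambda>x. trunc (k + C) (zn n x))"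
        by (simp add: energy_def)
      also have "\<dots> \<le> \<epsilon> * (B + 1)"
        using energy_trunc_Z[OF kC, of "n + m"] \<epsilon> unfolding zn_def B_def by (intro mult_left_mono) auto
      also have "\<dots> = d" by (simp add: \<epsilon>_def B_def)
      finally show "(\<integral>t. \<epsilon> * \<bar>gap (\<lambda>x. trunc (k + C) (zn n x)) t\<bar> powr p \<partial>\<nu>) \<le> d" .
      show "AE t in \<nu>. 0 \<le> \<epsilon> * \<bar>gap (\<lambda>x. trunc (k + C) (zn n x)) t\<bar> powr p" using \<epsilon> by simp
      have "\<And>x. 0 \<le> zn n x" by (simp add: zn_def Z_nonneg)
      from ent_lower[OF k0 this \<phi>(2) \<epsilon>]
      show "AE t in \<nu>. - (\<epsilon> powr (1 - p) * \<bar>gap \<phi> t\<bar> powr p + \<epsilon> * \<bar>gap (\<lambda>x. trunc (k + C) (zn n x)) t\<bar> powr p) \<le> ent (zn n) k \<phi> t"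
        by (intro AE_I2) (simp add: add.commute)
    qed
  qed (use e in auto)
qed

text \<open>With test function \<open>trunc h sol\<close> at level 1, the truncated difference is 0
  for values up to \<open>h\<close> and 1 from \<open>h + 1\<close> on. As \<open>sol\<close> is
  nonnegative, every pair in \<open>R_set\<close> has one value in each range, so there the
  integrand is exactly the power in the tail condition, and it is nonnegative elsewhere. The datum
  side tends to 0 by dominated convergence.\<close>

lemma sol_vanishing_tail:
  "((\<lambda>h. \<integral>\<^sup>+ z. indicator (R_set sol h) z * ennreal (\<bar>sol (fst z) - sol (snd z)\<bar> powr (p - 1)) \<partial>\<nu>) \<longlongrightarrow> 0) at_top"
proof (rule tendsto_sandwich[OF _ _ tendsto_const])
  let ?I = "\<lambda>h. \<integral>x. rhs sol x * trunc 1 (sol x - trunc h (sol x)) \<partial>lebesgue"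
  show "\<forall>\<^sub>F h in at_top. (\<integral>\<^sup>+ z. indicator (R_set sol h) z * ennreal (\<bar>sol (fst z) - sol (snd z)\<bar> powr (p - 1)) \<partial>\<nu>) \<le> ennreal (2 * ?I h)"
    using eventually_gt_at_top[of "0::real"]
  proof eventually_elim
    case (elim h)
    let ?\<phi> = "\<lambda>x. trunc h (sol x)"
    have h0: "0 \<le> h" using elim by simp
    have E: "integrable \<nu> (ent sol 1 ?\<phi>)" "(\<integral>t. ent sol 1 ?\<phi> t \<partial>\<nu>) \<le> 2 * ?I h"
      using sol_entropy_X[of ?\<phi> h 1] trunc_sol_X[OF h0] abs_trunc_le[OF h0] by auto
    have mono: "trunc 1 (a - trunc h a) \<le> trunc 1 (b - trunc h b)" if "a \<le> b" for a b
      by (rule trunc_mono) (use that elim in \<open>auto simp: trunc_def max_def min_def\<close>)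
    have nn: "0 \<le> ent sol 1 ?\<phi> t" for t
      unfolding ent_def by (rule flux_mult_nonneg[OF p(1)]) (use mono in \<open>auto simp: gap_def\<close>)
    have R: "\<bar>sol (fst t) - sol (snd t)\<bar> powr (p - 1) \<le> ent sol 1 ?\<phi> t" if "t \<in> R_set sol h" for t
    proof -
      have lo: "trunc 1 (a - trunc h a) = 0" if "0 \<le> a" "a \<le> h" for a using that by (auto simp: trunc_def)
      have hi: "trunc 1 (a - trunc h a) = 1" if "h + 1 \<le> a" for a using that elim by (auto simp: trunc_def)
      have *: "(a - b) powr (p - 1) \<le> flux p (a - b) * (trunc 1 (a - trunc h a) - trunc 1 (b - trunc h b))"
        if "0 \<le> b" "b \<le> h" "h + 1 \<le> a" for a b
        using that lo[of b] hi[of a] by (simp add: flux_pos)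
      let ?a = "sol (fst t)" and ?b = "sol (snd t)"
      have nns: "0 \<le> ?a" "0 \<le> ?b" by (simp_all add: sol_nonneg)
      have "h + 1 \<le> max ?a ?b" "min ?a ?b \<le> h"
        using that nns unfolding R_set_def by (auto simp: mult_less_0_iff case_prod_beta split: prod.splits)
      then consider "?b \<le> h" "h + 1 \<le> ?a" | "?a \<le> h" "h + 1 \<le> ?b" by (auto simp: max_def min_def split: if_splits)
      then show ?thesis
      proof cases
        case 1
        then show ?thesis using *[OF nns(2), of ?a] by (simp add: ent_def gap_def)
      next
        case 2
        have "flux p (?b - ?a) = - flux p (?a - ?b)" using flux_minus[of p "?a - ?b"] by simp
        then show ?thesis using *[OF nns(1), of ?b] 2 by (simp add: ent_def gap_def algebra_simps)
      qed
    qed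
    have "(\<integral>\<^sup>+ z. indicator (R_set sol h) z * ennreal (\<bar>sol (fst z) - sol (snd z)\<bar> powr (p - 1)) \<partial>\<nu>) \<le> (\<integral>\<^sup>+ t. ennreal (ent sol 1 ?\<phi> t) \<partial>\<nu>)"
      by (rule nn_integral_mono) (auto simp: indicator_def R ennreal_leI)
    also have "\<dots> = ennreal (\<integral>t. ent sol 1 ?\<phi> t \<partial>\<nu>)" using nn by (intro nn_integral_eq_integral E(1)) auto
    also have "\<dots> \<le> ennreal (2 * ?I h)" by (rule ennreal_leI[OF E(2)])
    finally show ?case .
  qed
  have "(?I \<longlongrightarrow> (\<integral>x. 0 \<partial>(lebesgue :: 'a measure))) at_top"
  proof (rule integral_dominated_convergence_at_top[where w="\<lambda>x. rhs sol x"])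
    show "\<forall>\<^sub>F h in at_top. AE x in lebesgue. norm (rhs sol x * trunc 1 (sol x - trunc h (sol x))) \<le> rhs sol x"
    proof (rule always_eventually, rule allI)
      fix h
      show "AE x in lebesgue. norm (rhs sol x * trunc 1 (sol x - trunc h (sol x))) \<le> rhs sol x"
        using rhs_nonneg[of sol]
      proof eventually_elim
        case (elim x)
        then show ?case using abs_mult_trunc_le[of 1 "rhs sol x" "rhs sol x"] by simp
      qed
    qed
    show "AE x in lebesgue. ((\<lambda>h. rhs sol x * trunc 1 (sol x - trunc h (sol x))) \<longlongrightarrow> 0) at_top"
    proof (rule AE_I2)
      fix x
      have "\<forall>\<^sub>F h in at_top. rhs sol x * trunc 1 (sol x - trunc h (sol x)) = 0"
        using eventually_ge_at_top[of "sol x"]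
      proof eventually_elim
        case (elim h)
        then have "trunc h (sol x) = sol x" using sol_nonneg[of x] by (intro trunc_id) simp
        then show ?case by simp
      qed
      then show "((\<lambda>h. rhs sol x * trunc 1 (sol x - trunc h (sol x))) \<longlongrightarrow> 0) at_top" by (rule tendsto_eventually)
    qed
  qed (use rhs_sol_integrable in auto)
  then have "((\<lambda>h. ennreal (2 * ?I h)) \<longlongrightarrow> ennreal (2 * 0)) at_top"
    by (intro tendsto_ennrealI tendsto_mult tendsto_const) simp
  then show "((\<lambda>h. ennreal (2 * ?I h)) \<longlongrightarrow> 0) at_top" by simp
qed simp

text \<open>Test functions in the closure may have infinite energy across the boundary, so the entropy
  inequality is extended from \<open>X\<close> by approximation from below in absolute value. Across the
  boundary the integrands are then controlled by those of the supersolution.\<close>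

lemma sol_entropy_W:
  assumes \<phi>: "W \<phi>" "\<And>x. \<bar>\<phi> x\<bar> \<le> C" and k: "0 < k"
  shows "integrable \<nu> (ent sol k \<phi>) \<and> (\<integral>t. ent sol k \<phi> t \<partial>\<nu>) \<le> 2 * (\<integral>x. rhs sol x * trunc k (sol x - \<phi> x) \<partial>lebesgue)"
proof -
  have k0: "0 \<le> k" using k by simp
  have C: "0 \<le> C" using \<phi>(2)[of 0] by (smt (verit) abs_ge_zero)
  have kC: "0 \<le> k + C" using k C by simp
  define T where "T x = trunc (k + C) (sol x)" for x
  have XT: "X T" unfolding T_def by (rule trunc_sol_X[OF kC])
  \<comment> \<open>Integrable by the entropy inequality of \<open>S\<close> with the test functions
    0 and \<phi>. On pairs that cross the boundary it bounds the negative part of every integrand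
    below, for all \<psi> that are at most \<phi> in modulus.\<close>
  define H where "H t = \<bar>ent S k (\<lambda>x. 0) t\<bar> + \<bar>ent S k \<phi> t\<bar>" for t
  have Hi: "integrable \<nu> H"
    unfolding H_def using entropy_ineqD(1)[OF S(1) k X_W[OF X_zero], of 0] entropy_ineqD(1)[OF S(1) k \<phi>(1), of C] \<phi>(2) by auto
  define Q where "Q \<psi> t = indicator (\<Omega> \<times> \<Omega>) t * \<bar>gap \<psi> t\<bar> powr p" for \<psi> :: "'a \<Rightarrow> real" and t
  have low: "AE t in \<nu>. - (e * \<bar>gap T t\<bar> powr p + H t + e powr (1 - p) * Q \<psi> t) \<le> ent sol k \<psi> t"
    if e: "0 < e" and \<psi>: "\<And>x. \<bar>\<psi> x\<bar> \<le> \<bar>\<phi> x\<bar>" for e \<psi>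
  proof -
    have "AE x in lebesgue. sol x \<le> S x" using sol_lim by eventually_elim simp
    from AE_nu_pair[OF this] show ?thesis
    proof eventually_elim
      case (elim t)
      obtain x y where t: "t = (x, y)" by (cases t)
      have nn: "0 \<le> e * \<bar>gap T t\<bar> powr p" "0 \<le> H t" "0 \<le> e powr (1 - p) * Q \<psi> t"
        using e by (auto simp: H_def Q_def)
      have \<psi>0: "\<psi> a = 0" if "a \<notin> \<Omega>" for a using \<psi>[of a] W_outside[OF \<phi>(1) that] by simp
      have S0: "S a = 0" if "a \<notin> \<Omega>" for a using entropy_ineq_outside[OF S(1) that] .
      have cr: "- (\<bar>flux p (S a) * trunc k (S a)\<bar> + \<bar>flux p (S a) * trunc k (S a - \<phi> a)\<bar>) \<le> flux p (sol a) * trunc k (sol a - \<psi> a)"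
        if "sol a \<le> S a" for a
        by (rule flux_cross_lower[OF p(1) k0 sol_nonneg that \<psi>])
      consider "x \<in> \<Omega>" "y \<in> \<Omega>" | "x \<in> \<Omega>" "y \<notin> \<Omega>" | "x \<notin> \<Omega>" "y \<in> \<Omega>" | "x \<notin> \<Omega>" "y \<notin> \<Omega>" by blast
      then show ?case
      proof cases
        case 1
        have \<psi>C: "\<bar>\<psi> x\<bar> \<le> C" for x using \<psi>[of x] \<phi>(2)[of x] by linarith
        have "- (e * \<bar>gap T t\<bar> powr p + e powr (1 - p) * \<bar>gap \<psi> t\<bar> powr p) \<le> ent sol k \<psi> t"
          unfolding T_def by (rule ent_lower[of k sol \<psi> C e t]) (auto simp: k0 sol_nonneg \<psi>C e)
        moreover have "Q \<psi> t = \<bar>gap \<psi> t\<bar> powr p" using 1 by (simp add: Q_def t)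
        ultimately show ?thesis using nn by simp
      next
        case 2
        have "- H t \<le> ent sol k \<psi> t"
          using cr[of x] elim 2 k0 by (simp add: H_def ent_def gap_def t sol_outside S0 \<psi>0 W_outside[OF \<phi>(1)])
        then show ?thesis using nn by linarith
      next
        case 3
        have "- H t \<le> ent sol k \<psi> t"
          using cr[of y] elim 3 k0 by (simp add: H_def ent_def gap_def t sol_outside S0 \<psi>0 W_outside[OF \<phi>(1)])
        then show ?thesis using nn by linarith
      next
        case 4
        then have "ent sol k \<psi> t = 0" by (simp add: ent_def gap_def t sol_outside)
        then show ?thesis using nn by linarith
      qed
    qed
  qed
  have "\<forall>n::nat. \<exists>\<eta>. test_fun \<Omega> \<eta> \<and> nrm (\<lambda>x. \<phi> x - \<eta> x) \<le> ennreal (1 / real (Suc n))"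
    using \<phi>(1) unfolding W_iff by simp
  then obtain \<eta> where \<eta>: "\<And>n::nat. test_fun \<Omega> (\<eta> n)" "\<And>n. nrm (\<lambda>x. \<phi> x - \<eta> n x) \<le> ennreal (1 / real (Suc n))"
    by metis
  note [measurable] = W_measurable[OF \<phi>(1)] test_fun_lebesgue[OF \<eta>(1)]
  have n1: "(\<integral>\<^sup>+x. ennreal (\<bar>\<phi> x - \<eta> n x\<bar> powr p) \<partial>muD) \<le> ennreal (1 / real (Suc n))"
    and n2: "(\<integral>\<^sup>+z. ennreal (\<bar>gap \<phi> z - gap (\<eta> n) z\<bar> powr p) \<partial>nuD) \<le> ennreal (1 / real (Suc n))" for n
    using \<eta>(2)[of n] unfolding nrm_diff by (auto dest: ennreal_add_leD)
  have "(\<lambda>n. \<integral>\<^sup>+x. ennreal (\<bar>\<phi> x - \<eta> n x\<bar> powr p) \<partial>muD) \<longlonglongrightarrow> 0"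
  proof (rule tendsto_sandwich[OF _ _ tendsto_const])
    show "(\<lambda>n. ennreal (1 / real (Suc n))) \<longlonglongrightarrow> 0"
      using tendsto_ennrealI[OF LIMSEQ_inverse_real_of_nat] by (simp add: inverse_eq_divide)
  qed (use n1 in auto)
  then obtain r where r: "strict_mono r" "AE x in muD. (\<lambda>n. ennreal (\<bar>\<phi> x - \<eta> (r n) x\<bar> powr p)) \<longlonglongrightarrow> 0"
    by (rule nn_integral_tendsto_0_AE_subseq[rotated]) auto
  have \<eta>l: "AE x in lebesgue. (\<lambda>n. \<eta> (r n) x) \<longlonglongrightarrow> \<phi> x"
    using r(2) unfolding AE_muD_iff
  proof eventually_elim
    case (elim x)
    show ?case
    proof (cases "x \<in> \<Omega>")
      case True
      then have "(\<lambda>n. \<bar>\<phi> x - \<eta> (r n) x\<bar> powr p) \<longlonglongrightarrow> 0"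
        using elim tendsto_ennreal_iff[of "\<lambda>n. \<bar>\<phi> x - \<eta> (r n) x\<bar> powr p" sequentially 0] by simp
      then have "(\<lambda>n. (\<bar>\<phi> x - \<eta> (r n) x\<bar> powr p) powr (1 / p)) \<longlonglongrightarrow> 0 powr (1 / p)"
        using p0 by (intro tendsto_powr' tendsto_const) auto
      then have "(\<lambda>n. \<bar>\<eta> (r n) x - \<phi> x\<bar>) \<longlonglongrightarrow> 0" using p0 by (simp add: powr_powr abs_minus_commute)
      then show ?thesis by (simp add: LIM_zero_iff tendsto_rabs_zero_iff)
    next
      case False
      then show ?thesis using W_outside[OF \<phi>(1)] test_fun_outside[OF \<eta>(1)] by simp
    qed
  qed
  \<comment> \<open>The approximating test function is clamped by the modulus of \<phi>. Being below
    \<phi> in modulus gives the uniform bound \<open>low\<close>; being below the test function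
    gives finite energy across the boundary, hence membership in \<open>X\<close>. The factor
    \<open>-1\<close> lets \<open>W_cmult\<close> apply.\<close>
  define \<psi> where "\<psi> n x = max (-1 * \<bar>\<phi> x\<bar>) (min \<bar>\<phi> x\<bar> (\<eta> (r n) x))" for n x
  have \<psi>W: "W (\<psi> n)" for n unfolding \<psi>_def by (intro W_max W_cmult W_abs W_min \<phi> W_test \<eta>)
  note [measurable] = W_measurable[OF \<psi>W]
  have \<psi>\<phi>: "\<bar>\<psi> n x\<bar> \<le> \<bar>\<phi> x\<bar>" for n x by (auto simp: \<psi>_def max_def min_def)
  have \<psi>\<eta>: "\<bar>\<psi> n x\<bar> \<le> \<bar>\<eta> (r n) x\<bar>" for n x by (auto simp: \<psi>_def max_def min_def)
  have \<psi>C: "\<bar>\<psi> n x\<bar> \<le> C" for n x using \<psi>\<phi>[of n x] \<phi>(2)[of x] by linarith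
  have \<psi>l: "AE x in lebesgue. (\<lambda>n. \<psi> n x) \<longlonglongrightarrow> \<phi> x"
    using \<eta>l
  proof eventually_elim
    case (elim x)
    then have "(\<lambda>n. \<psi> n x) \<longlonglongrightarrow> max (-1 * \<bar>\<phi> x\<bar>) (min \<bar>\<phi> x\<bar> (\<phi> x))"
      unfolding \<psi>_def by (intro tendsto_max tendsto_min tendsto_const)
    moreover have "max (-1 * \<bar>\<phi> x\<bar>) (min \<bar>\<phi> x\<bar> (\<phi> x)) = \<phi> x" by (auto simp: max_def min_def)
    ultimately show ?case by simp
  qed
  have gap\<psi>: "\<bar>gap (\<psi> n) t\<bar> \<le> \<bar>gap \<phi> t\<bar> + \<bar>gap (\<eta> (r n)) t\<bar>" for n t
    unfolding \<psi>_def gap_def mult_minus1 by (rule clamp_lipschitz)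
  note Q\<phi> = integrable_nuD_indicator[of "\<lambda>t. \<bar>gap \<phi> t\<bar> powr p", OF _ _ W_energy[OF \<phi>(1)], folded Q_def]
  have Q\<phi>i: "integrable \<nu> (Q \<phi>)" using Q\<phi>(1) by (simp add: Q_def[abs_def])
  have \<psi>X: "X (\<psi> n)" for n
    unfolding X_def
  proof (intro conjI \<psi>W)
    show "integrable \<nu> (\<lambda>t. \<bar>gap (\<psi> n) t\<bar> powr p)"
    proof (rule Bochner_Integration.integrable_bound)
      show "integrable \<nu> (\<lambda>t. 2 powr p * (Q \<phi> t + \<bar>gap (\<eta> (r n)) t\<bar> powr p))"
        using Q\<phi>i X_energy[OF X_test[OF \<eta>(1)]] by auto
      show "AE t in \<nu>. norm (\<bar>gap (\<psi> n) t\<bar> powr p) \<le> norm (2 powr p * (Q \<phi> t + \<bar>gap (\<eta> (r n)) t\<bar> powr p))"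
      proof (rule AE_I2)
        fix t :: "'a \<times> 'a"
        obtain x y where t: "t = (x, y)" by (cases t)
        have "\<bar>gap (\<psi> n) t\<bar> powr p \<le> 2 powr p * (Q \<phi> t + \<bar>gap (\<eta> (r n)) t\<bar> powr p)"
        proof (cases "x \<in> \<Omega> \<and> y \<in> \<Omega>")
          case True
          have "\<bar>gap (\<psi> n) t\<bar> powr p \<le> \<bar>\<bar>gap \<phi> t\<bar> + \<bar>gap (\<eta> (r n)) t\<bar>\<bar> powr p"
            using gap\<psi>[of n t] p0 by (intro abs_powr_mono) auto
          also have "\<dots> \<le> 2 powr p * (\<bar>\<bar>gap \<phi> t\<bar>\<bar> powr p + \<bar>\<bar>gap (\<eta> (r n)) t\<bar>\<bar> powr p)"
            by (rule abs_powr_add_le[OF p0])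
          finally show ?thesis using True by (simp add: Q_def t)
        next
          case False
          then have "\<bar>gap (\<psi> n) t\<bar> \<le> \<bar>gap (\<eta> (r n)) t\<bar>"
            using \<psi>\<eta>[of n x] \<psi>\<eta>[of n y] W_outside[OF \<psi>W, of x n] W_outside[OF \<psi>W, of y n]
              test_fun_outside[OF \<eta>(1), of x] test_fun_outside[OF \<eta>(1), of y] by (auto simp: gap_def t)
          then have "\<bar>gap (\<psi> n) t\<bar> powr p \<le> 1 * \<bar>gap (\<eta> (r n)) t\<bar> powr p" using p0 by (simp add: abs_powr_mono)
          also have "\<dots> \<le> 2 powr p * \<bar>gap (\<eta> (r n)) t\<bar> powr p"
            using p0 by (intro mult_right_mono ge_one_powr_ge_zero) auto
          also have "\<dots> \<le> 2 powr p * (Q \<phi> t + \<bar>gap (\<eta> (r n)) t\<bar> powr p)"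
            by (intro mult_left_mono) (auto simp: Q_def)
          finally show ?thesis .
        qed
        then show "norm (\<bar>gap (\<psi> n) t\<bar> powr p) \<le> norm (2 powr p * (Q \<phi> t + \<bar>gap (\<eta> (r n)) t\<bar> powr p))" by simp
      qed
      have "(\<lambda>t. \<bar>gap (\<psi> n) t\<bar> powr p) \<in> borel_measurable L2" by measurable
      then show "(\<lambda>t. \<bar>gap (\<psi> n) t\<bar> powr p) \<in> borel_measurable \<nu>" by measurable
    qed
  qed
  define B where "B = 2 powr p * ((\<integral>t. \<bar>gap \<phi> t\<bar> powr p \<partial>nuD) + 2 powr p * ((\<integral>t. \<bar>gap \<phi> t\<bar> powr p \<partial>nuD) + 1))"
  have Q\<psi>i: "integrable \<nu> (Q (\<psi> n))" and Q\<psi>B: "(\<integral>t. Q (\<psi> n) t \<partial>\<nu>) \<le> B" for n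
  proof -
    note E\<phi> = W_energy[OF \<phi>(1)] and E\<psi> = W_energy[OF \<psi>W, of n] and E\<eta> = W_energy[OF W_test[OF \<eta>(1)], of "r n"]
    show "integrable \<nu> (Q (\<psi> n))"
      using integrable_nuD_indicator(1)[of "\<lambda>t. \<bar>gap (\<psi> n) t\<bar> powr p", OF _ _ E\<psi>] by (simp add: Q_def[abs_def])
    have ie: "integrable nuD (\<lambda>z. \<bar>gap \<phi> z - gap (\<eta> (r n)) z\<bar> powr p)"
      using W_energy[OF W_diff[OF \<phi>(1) W_test[OF \<eta>(1)[of "r n"]]]] by (simp add: gap_diff)
    have "ennreal (\<integral>z. \<bar>gap \<phi> z - gap (\<eta> (r n)) z\<bar> powr p \<partial>nuD) \<le> ennreal (1 / real (Suc (r n)))"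
      using n2[of "r n"] nn_integral_eq_integral[OF ie] by simp
    also have "\<dots> \<le> ennreal 1" by (intro ennreal_leI) simp
    finally have le1: "(\<integral>z. \<bar>gap \<phi> z - gap (\<eta> (r n)) z\<bar> powr p \<partial>nuD) \<le> 1" by simp
    have "(\<integral>t. \<bar>gap (\<eta> (r n)) t\<bar> powr p \<partial>nuD) \<le> (\<integral>t. 2 powr p * (\<bar>gap \<phi> t\<bar> powr p + \<bar>gap \<phi> t - gap (\<eta> (r n)) t\<bar> powr p) \<partial>nuD)"
    proof (rule integral_mono)
      show "\<bar>gap (\<eta> (r n)) t\<bar> powr p \<le> 2 powr p * (\<bar>gap \<phi> t\<bar> powr p + \<bar>gap \<phi> t - gap (\<eta> (r n)) t\<bar> powr p)" for t
        using abs_powr_diff_le[OF p0, of "gap \<phi> t" "gap \<phi> t - gap (\<eta> (r n)) t"] by simp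
    qed (use E\<phi> E\<eta> ie in auto)
    also have "\<dots> = 2 powr p * ((\<integral>t. \<bar>gap \<phi> t\<bar> powr p \<partial>nuD) + (\<integral>t. \<bar>gap \<phi> t - gap (\<eta> (r n)) t\<bar> powr p \<partial>nuD))"
      using E\<phi> ie by simp
    also have "\<dots> \<le> 2 powr p * ((\<integral>t. \<bar>gap \<phi> t\<bar> powr p \<partial>nuD) + 1)" using le1 by simp
    finally have \<eta>B: "(\<integral>t. \<bar>gap (\<eta> (r n)) t\<bar> powr p \<partial>nuD) \<le> 2 powr p * ((\<integral>t. \<bar>gap \<phi> t\<bar> powr p \<partial>nuD) + 1)" .
    have "(\<integral>t. Q (\<psi> n) t \<partial>\<nu>) = (\<integral>t. \<bar>gap (\<psi> n) t\<bar> powr p \<partial>nuD)"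
      using integrable_nuD_indicator(2)[of "\<lambda>t. \<bar>gap (\<psi> n) t\<bar> powr p", OF _ _ E\<psi>] by (simp add: Q_def)
    also have "\<dots> \<le> (\<integral>t. 2 powr p * (\<bar>gap \<phi> t\<bar> powr p + \<bar>gap (\<eta> (r n)) t\<bar> powr p) \<partial>nuD)"
    proof (rule integral_mono)
      fix t
      have "\<bar>gap (\<psi> n) t\<bar> powr p \<le> \<bar>\<bar>gap \<phi> t\<bar> + \<bar>gap (\<eta> (r n)) t\<bar>\<bar> powr p"
        using gap\<psi>[of n t] p0 by (intro abs_powr_mono) auto
      also have "\<dots> \<le> 2 powr p * (\<bar>\<bar>gap \<phi> t\<bar>\<bar> powr p + \<bar>\<bar>gap (\<eta> (r n)) t\<bar>\<bar> powr p)"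
        by (rule abs_powr_add_le[OF p0])
      finally show "\<bar>gap (\<psi> n) t\<bar> powr p \<le> 2 powr p * (\<bar>gap \<phi> t\<bar> powr p + \<bar>gap (\<eta> (r n)) t\<bar> powr p)" by simp
    qed (use E\<phi> E\<psi> E\<eta> in auto)
    also have "\<dots> = 2 powr p * ((\<integral>t. \<bar>gap \<phi> t\<bar> powr p \<partial>nuD) + (\<integral>t. \<bar>gap (\<eta> (r n)) t\<bar> powr p \<partial>nuD))"
      using E\<phi> E\<eta> by simp
    also have "\<dots> \<le> B" unfolding B_def using \<eta>B by (intro mult_left_mono add_left_mono) auto
    finally show "(\<integral>t. Q (\<psi> n) t \<partial>\<nu>) \<le> B" .
  qed
  have B0: "0 \<le> B" unfolding B_def by (intro mult_nonneg_nonneg add_nonneg_nonneg) auto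
  have eX: "integrable \<nu> (ent sol k (\<psi> n))" "(\<integral>t. ent sol k (\<psi> n) t \<partial>\<nu>) \<le> 2 * (\<integral>x. rhs sol x * trunc k (sol x - \<psi> n x) \<partial>lebesgue)" for n
    using sol_entropy_X[OF \<psi>X \<psi>C k] by auto
  show ?thesis
  proof (rule fatou_small_defect[where F="\<lambda>n. ent sol k (\<psi> n)"
      and r="\<lambda>n. 2 * (\<integral>x. rhs sol x * trunc k (sol x - \<psi> n x) \<partial>lebesgue)"
      and H="\<lambda>t. 1 * \<bar>gap T t\<bar> powr p + H t + 1 powr (1 - p) * Q \<phi> t"])
    show "ent sol k \<phi> \<in> borel_measurable \<nu>" by (rule ent_measurable) measurable
    show "AE t in \<nu>. (\<lambda>n. ent sol k (\<psi> n) t) \<longlonglongrightarrow> ent sol k \<phi> t" by (rule ent_lim[OF _ \<psi>l]) simp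
    show "integrable \<nu> (\<lambda>t. 1 * \<bar>gap T t\<bar> powr p + H t + 1 powr (1 - p) * Q \<phi> t)"
      using X_energy[OF XT] Hi Q\<phi>i by auto
    show "AE t in \<nu>. - (1 * \<bar>gap T t\<bar> powr p + H t + 1 powr (1 - p) * Q \<phi> t) \<le> ent sol k \<phi> t"
      by (rule low) auto
    show "(\<lambda>n. 2 * (\<integral>x. rhs sol x * trunc k (sol x - \<psi> n x) \<partial>lebesgue)) \<longlonglongrightarrow> 2 * (\<integral>x. rhs sol x * trunc k (sol x - \<phi> x) \<partial>lebesgue)"
    proof (intro tendsto_mult tendsto_const, rule integral_dominated_convergence[where w="\<lambda>x. k * rhs sol x"])
      show "AE x in lebesgue. (\<lambda>n. rhs sol x * trunc k (sol x - \<psi> n x)) \<longlonglongrightarrow> rhs sol x * trunc k (sol x - \<phi> x)"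
        using \<psi>l by eventually_elim (intro tendsto_mult tendsto_trunc tendsto_diff tendsto_const)
      show "AE x in lebesgue. norm (rhs sol x * trunc k (sol x - \<psi> n x)) \<le> k * rhs sol x" for n
        using rhs_nonneg[of sol] by eventually_elim (use abs_mult_trunc_le[OF k0] in auto)
    qed (use rhs_sol_integrable in auto)
    fix d :: real assume d: "0 < d"
    define \<epsilon> where "\<epsilon> = d / (B + 1)"
    have \<epsilon>: "0 < \<epsilon>" using d B0 by (simp add: \<epsilon>_def)
    \<comment> \<open>Here the roles of Young's weight are exchanged: the truncation
      \<open>T\<close> is fixed and may have a large coefficient, while the energies of
      \<open>\<psi> n\<close> are only bounded. Hence \<open>e\<close> is chosen so that
      \<open>e powr (1 - p)\<close> is small.\<close>
    define e where "e = \<epsilon> powr (1 / (1 - p))"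
    have e: "0 < e" "e powr (1 - p) = \<epsilon>" using \<epsilon> p by (auto simp: e_def powr_powr)
    show "\<exists>G Gn. integrable \<nu> G \<and> (\<forall>n. integrable \<nu> (Gn n) \<and> (\<integral>x. Gn n x \<partial>\<nu>) \<le> d
       \<and> (AE x in \<nu>. 0 \<le> Gn n x) \<and> (AE x in \<nu>. - (G x + Gn n x) \<le> ent sol k (\<psi> n) x))"
    proof (rule exI[of _ "\<lambda>t. e * \<bar>gap T t\<bar> powr p + H t"], rule exI[of _ "\<lambda>n t. \<epsilon> * Q (\<psi> n) t"], intro conjI allI)
      show "integrable \<nu> (\<lambda>t. e * \<bar>gap T t\<bar> powr p + H t)" using X_energy[OF XT] Hi by simp
      fix n
      show "integrable \<nu> (\<lambda>t. \<epsilon> * Q (\<psi> n) t)" using Q\<psi>i by simp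
      have "(\<integral>t. \<epsilon> * Q (\<psi> n) t \<partial>\<nu>) \<le> \<epsilon> * (B + 1)"
        using Q\<psi>B[of n] \<epsilon> by simp
      also have "\<dots> = d" using B0 by (simp add: \<epsilon>_def)
      finally show "(\<integral>t. \<epsilon> * Q (\<psi> n) t \<partial>\<nu>) \<le> d" .
      show "AE t in \<nu>. 0 \<le> \<epsilon> * Q (\<psi> n) t" using \<epsilon> by (simp add: Q_def)
      show "AE t in \<nu>. - (e * \<bar>gap T t\<bar> powr p + H t + \<epsilon> * Q (\<psi> n) t) \<le> ent sol k (\<psi> n) t"
        using low[of e "\<psi> n", OF e(1) \<psi>\<phi>] unfolding e(2) .
    qed
  qed (use eX in auto)
qed

lemma sol_entropy_solution: "entropy_solution s p \<beta> \<Omega> (\<lambda>x. lam * sol x powr q + g x) sol"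
  unfolding entropy_solution_iff
proof (intro conjI sol_vanishing_tail)
  show "entropy_ineq (\<lambda>x. lam * sol x powr q + g x) sol"
    unfolding entropy_ineq_def
  proof (intro conjI allI impI sol_measurable sol_outside)
    show "W (\<lambda>x. trunc k (sol x))" if "0 < k" for k using that by (intro X_W trunc_sol_X) simp
    fix k :: real and \<phi> C assume k: "0 < k" and \<phi>: "W \<phi> \<and> (AE x in lebesgue. \<bar>\<phi> x\<bar> \<le> C)"
    \<comment> \<open>Truncation at \<open>C'\<close> yields a version of \<phi> that is bounded at
      every point; neither side of the inequality changes, as both see functions only up to null
      sets.\<close>
    define C' where "C' = max C 0"
    define \<phi>' where "\<phi>' x = trunc C' (\<phi> x)" for x
    have W': "W \<phi>'" unfolding \<phi>'_def using \<phi> by (intro W_trunc) (auto simp: C'_def)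
    have b': "\<bar>\<phi>' x\<bar> \<le> C'" for x unfolding \<phi>'_def by (rule abs_trunc_le) (simp add: C'_def)
    have eq: "AE x in lebesgue. \<phi>' x = \<phi> x"
      using \<phi>[THEN conjunct2] by eventually_elim (simp add: \<phi>'_def C'_def trunc_id)
    from AE_nu_pair[OF eq] have geq: "AE t in \<nu>. ent sol k \<phi>' t = ent sol k \<phi> t"
      by eventually_elim (simp add: ent_def gap_def)
    note [measurable] = W_measurable[OF W'] W_measurable[OF \<phi>[THEN conjunct1]]
      ent_measurable[OF sol_measurable W_measurable[OF W'], of k]
      ent_measurable[OF sol_measurable W_measurable[OF \<phi>[THEN conjunct1]], of k]
    note E = sol_entropy_W[OF W' b' k]
    show "integrable \<nu> (ent sol k \<phi>)" 
      by (rule integrable_cong_AE_imp[OF E[THEN conjunct1] _ geq]) measurable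
    have "(\<integral>t. ent sol k \<phi>' t \<partial>\<nu>) = (\<integral>t. ent sol k \<phi> t \<partial>\<nu>)"
      by (rule integral_cong_AE[OF _ _ geq]) measurable
    moreover have "(\<integral>x. rhs sol x * trunc k (sol x - \<phi>' x) \<partial>lebesgue) = (\<integral>x. rhs sol x * trunc k (sol x - \<phi> x) \<partial>lebesgue)"
      by (rule integral_cong_AE) (auto intro: eventually_mono[OF eq])
    ultimately show "1/2 * (\<integral>t. ent sol k \<phi> t \<partial>\<nu>)
        \<le> (\<integral>x. (indicator \<Omega> x * (lam * sol x powr q + g x)) * trunc k (sol x - \<phi> x) \<partial>lebesgue)"
      using E unfolding rhs_def by simp
  qed
qed

lemma sol_pos_sol: "pos_sol s p \<beta> \<Omega> q lam g sol"
  unfolding pos_sol_def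
proof (intro conjI sol_measurable sol_entropy_solution)
  show "AE x in lebesgue. 0 \<le> sol x" using sol_nonneg by simp
  show "set_integrable lebesgue \<Omega> (\<lambda>x. sol x powr q)"
    unfolding set_integrable_def
  proof (rule Bochner_Integration.integrable_bound)
    show "integrable lebesgue (\<lambda>x. 1 / lam * rhs sol x)" using rhs_sol_integrable by simp
    show "AE x in lebesgue. norm (indicator \<Omega> x *\<^sub>R sol x powr q) \<le> norm (1 / lam * rhs sol x)"
      using g_nonneg by eventually_elim (use lam in \<open>auto simp: rhs_def indicator_def field_simps\<close>)
  qed measurable
qed

text \<open>A solution is a supersolution with its own datum, so the domination hypothesis holds
  with equality.\<close>

lemma sol_le_pos_sol:
  assumes "pos_sol s p \<beta> \<Omega> q lam g v" shows "AE x in lebesgue. sol x \<le> v x"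
proof (rule sol_minimal)
  show "entropy_ineq (\<lambda>x. lam * v x powr q + g x) v" "AE x in lebesgue. 0 \<le> v x"
    using assms by (auto simp: pos_sol_def entropy_solution_iff)
  have "integrable lebesgue (\<lambda>x. indicator \<Omega> x * v x powr q)"
    using assms by (simp add: pos_sol_def set_integrable_def)
  then have "integrable lebesgue (\<lambda>x. lam * (indicator \<Omega> x * v x powr q) + indicator \<Omega> x * g x)"
    using g_integrable by simp
  then show "integrable lebesgue (\<lambda>x. indicator \<Omega> x * (lam * v x powr q + g x))"
    by (simp add: distrib_left mult.left_commute)
qed simp

end

theorem theorem4p4:
  fixes \<Omega> :: "'a::euclidean_space set"
    and s p \<beta> q :: real and g w :: "'a \<Rightarrow> real"
  assumes "0 < s" "s < 1" "1 < p" "p < real DIM('a)" "p * s < real DIM('a)"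
    and "0 \<le> \<beta>" "\<beta> < (real DIM('a) - p * s) / 2"
    and "smooth_bounded_domain \<Omega>" "0 \<in> \<Omega>"
    and "q > p - 1"
    and "g \<in> borel_measurable lebesgue" "set_integrable lebesgue \<Omega> g"
    and "AE x in lebesgue. x \<in> \<Omega> \<longrightarrow> 0 \<le> g x"
    and "\<not> (AE x in lebesgue. x \<in> \<Omega> \<longrightarrow> g x = 0)"
    and "entropy_solution s p \<beta> \<Omega> g w" "AE x in lebesgue. 0 \<le> w x"
    and "AE x in lebesgue. x \<in> \<Omega> \<longrightarrow> w x powr q \<le> g x"
  shows "\<exists>lbar>0. \<forall>lam. 0 < lam \<and> lam < lbar \<longrightarrow>
           (\<exists>u. pos_sol s p \<beta> \<Omega> q lam g u \<and>
                (\<forall>v. pos_sol s p \<beta> \<Omega> q lam g v \<longrightarrow> (AE x in lebesgue. u x \<le> v x)))"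
proof -
  interpret weighted_domain s p \<beta> \<Omega> by (rule weighted_domain.intro) (rule assms)+
  \<comment> \<open>From \<open>w powr q \<le> g\<close>, \<open>lam * (2 * w) powr q + g\<close> is
    at most \<open>(lam * 2 powr q + 1) * g\<close>, and this is below
    \<open>2 powr (p - 1) * g\<close> for \<open>lam < lbar\<close>. Any factor \<open>c > 1\<close>
    could stand in place of 2, since \<open>p > 1\<close> makes \<open>c powr (p - 1)\<close> exceed
    1.\<close>
  define lbar where "lbar = (2 powr (p - 1) - 1) / 2 powr q"
  have one: "1 < 2 powr (p - 1)" using assms(3) by simp
  have gi: "integrable lebesgue (\<lambda>x. indicator \<Omega> x * g x)"
    using assms(12) by (simp add: set_integrable_def)
  have "\<exists>u. pos_sol s p \<beta> \<Omega> q lam g u \<and> (\<forall>v. pos_sol s p \<beta> \<Omega> q lam g v \<longrightarrow> (AE x in lebesgue. u x \<le> v x))"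
    if lam: "0 < lam" "lam < lbar" for lam
  proof -
    interpret supersolution s p \<beta> \<Omega> q lam g "\<lambda>x. 2 powr (p - 1) * g x" "\<lambda>x. 2 * w x"
    proof unfold_locales
      show "entropy_ineq (\<lambda>x. 2 powr (p - 1) * g x) (\<lambda>x. 2 * w x)"
        using assms(15) by (intro entropy_ineq_scale) (auto simp: entropy_solution_iff)
      show "AE x in lebesgue. 0 \<le> 2 * w x" using assms(16) by simp
      show "integrable lebesgue (\<lambda>x. indicator \<Omega> x * (2 powr (p - 1) * g x))"
        using integrable_mult_right[OF gi, of "2 powr (p - 1)"] by (simp add: mult.left_commute)
      show "AE x in lebesgue. x \<in> \<Omega> \<longrightarrow> lam * (2 * w x) powr q + g x \<le> 2 powr (p - 1) * g x"
        using assms(13,16,17)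
      proof eventually_elim
        case (elim x)
        show ?case
        proof
          assume "x \<in> \<Omega>"
          then have *: "0 \<le> g x" "w x powr q \<le> g x" using elim by auto
          have "lam * 2 powr q \<le> 2 powr (p - 1) - 1" using lam(2) by (simp add: lbar_def pos_less_divide_eq)
          then have "(lam * 2 powr q) * g x \<le> (2 powr (p - 1) - 1) * g x" using * by (intro mult_right_mono)
          moreover have "(lam * 2 powr q) * w x powr q \<le> (lam * 2 powr q) * g x" using * lam by (intro mult_left_mono) auto
          moreover have "lam * (2 * w x) powr q = (lam * 2 powr q) * w x powr q" using elim by (simp add: powr_mult)
          ultimately show "lam * (2 * w x) powr q + g x \<le> 2 powr (p - 1) * g x"
            unfolding left_diff_distrib by linarith
        qed
      qed
      show "0 < q" using assms(3,10) by simp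
    qed (rule assms lam gi)+
    show ?thesis using sol_pos_sol sol_le_pos_sol by blast
  qed
  moreover have "0 < lbar" using one by (simp add: lbar_def)
  ultimately show ?thesis by blast
qed

end
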